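(* Let $\lambda\in C^\infty(S^1)$ be real-valued and let $s\ge1$ be a real number. For every sufficiently small $\epsilon>0$ there exists a continuous function $C=C(s,E,M)>0$ of the energy and mass (also allowed to depend on $\epsilon$ and on the fixed function $\lambda$) such that the following holds. For every $\Phi\in H^s(S^1)$, if $u$ is the global solution of $$iu_t+\Delta u=|u|^2u+\lambda u,\quad x\in S^1,\ t\in\mathbb{R},\qquad u(x,0)=\Phi(x),$$ then for all $t\in\mathbb{R}$, $$\|u(t)\|_{H^s}\le C\big(s,E(\Phi),M(\Phi)\big)\,(1+|t|)^{s+\epsilon}\,\|\Phi\|_{H^s}.$$
   Context: $S^1=\mathbb{R}/2\pi\mathbb{Z}$; $\widehat f(n)=\int_{S^1}f(x)e^{-inx}dx$; $\langle n\rangle=\sqrt{1+|n|^2}$; $\|f\|_{H^s}=\big(\sum_{n\in\mathbb{Z}}|\widehat f(n)|^2\langle n\rangle^{2s}\big)^{1/2}$. For $\Phi\in H^s(S^1)$, $s\ge1$, the equation has a unique global solution $u\in C(\mathbb{R};H^s(S^1))$ (in the sense of Duhamel's formula). The mass and energy are $$M(f)=\int_{S^1}|f|^2dx,\qquad E(f)=\frac12\int_{S^1}|\nabla f|^2dx+\frac14\int_{S^1}|f|^4dx+\frac12\int_{S^1}\lambda|f|^2dx,$$ and are conserved by the flow ($E$ need not be non-negative). *)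

theory Defs
  imports "HOL-Analysis.Analysis"
begin

text \<open>
  Functions on the circle \<open>S\<^sup>1 = \<real> / 2\<pi>\<int>\<close> are modelled as \<open>2\<pi>\<close>-periodic functions on the reals,
  and integrals over the circle as Lebesgue integrals over \<open>[0, 2\<pi>]\<close>.  Elements of \<open>L\<^sup>2\<close> and \<open>H\<^sup>s\<close>
  are represented by Borel functions, understood up to equality almost everywhere.
\<close>

definition circle_fun :: "(real \<Rightarrow> 'a) \<Rightarrow> bool" where
  "circle_fun f \<longleftrightarrow> (\<forall>x. f (x + 2 * pi) = f x)"

definition circle_int :: "(real \<Rightarrow> 'a::{banach, second_countable_topology}) \<Rightarrow> 'a" where
  "circle_int f = (LBINT x:{0..2 * pi}. f x)"

definition smooth_circle :: "(real \<Rightarrow> real) \<Rightarrow> bool" where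
  "smooth_circle g \<longleftrightarrow> circle_fun g \<and> (\<forall>k x. (deriv ^^ k) g differentiable (at x))"

definition L2_circle :: "(real \<Rightarrow> complex) set" where
  "L2_circle = {f. circle_fun f \<and> f \<in> borel_measurable borel
     \<and> set_integrable lborel {0..2 * pi} (\<lambda>x. (cmod (f x))\<^sup>2)}"

definition fourier :: "(real \<Rightarrow> complex) \<Rightarrow> int \<Rightarrow> complex" where
  "fourier f n = circle_int (\<lambda>x. f x * exp (- (\<i> * of_int n * of_real x)))"

definition japanese :: "int \<Rightarrow> real" where
  "japanese n = sqrt (1 + \<bar>real_of_int n\<bar>\<^sup>2)"

text \<open>The definition of \<open>H\<^sup>s\<close> as a subset of \<open>L\<^sup>2\<close> is the usual one for \<open>s \<ge> 0\<close> only.\<close>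

definition Hs :: "real \<Rightarrow> (real \<Rightarrow> complex) set" where
  "Hs s = {f \<in> L2_circle.
     (\<lambda>n. (cmod (fourier f n))\<^sup>2 * japanese n powr (2 * s)) summable_on UNIV}"

definition Hs_norm :: "real \<Rightarrow> (real \<Rightarrow> complex) \<Rightarrow> real" where
  "Hs_norm s f = sqrt (\<Sum>\<^sub>\<infinity>n. (cmod (fourier f n))\<^sup>2 * japanese n powr (2 * s))"

text \<open>
  Real-valued test functions suffice for the weak derivative of a complex-valued function, by
  linearity.  The weak derivative is unique up to null sets, so the integral of its squared
  modulus does not depend on the choice made in \<open>grad\<close>; it exists for every \<open>f \<in> H\<^sup>1\<close>.
\<close>

definition weak_deriv :: "(real \<Rightarrow> complex) \<Rightarrow> (real \<Rightarrow> complex) \<Rightarrow> bool" where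
  "weak_deriv f g \<longleftrightarrow> g \<in> L2_circle \<and>
     (\<forall>\<phi>. smooth_circle \<phi> \<longrightarrow>
        circle_int (\<lambda>x. f x * of_real (deriv \<phi> x)) = - circle_int (\<lambda>x. g x * of_real (\<phi> x)))"

definition grad :: "(real \<Rightarrow> complex) \<Rightarrow> real \<Rightarrow> complex" where
  "grad f = (SOME g. weak_deriv f g)"

definition mass :: "(real \<Rightarrow> complex) \<Rightarrow> real" where
  "mass f = circle_int (\<lambda>x. (cmod (f x))\<^sup>2)"

definition energy :: "(real \<Rightarrow> real) \<Rightarrow> (real \<Rightarrow> complex) \<Rightarrow> real" where
  "energy lam f =
     1 / 2 * circle_int (\<lambda>x. (cmod (grad f x))\<^sup>2)
     + 1 / 4 * circle_int (\<lambda>x. (cmod (f x)) ^ 4)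
     + 1 / 2 * circle_int (\<lambda>x. lam x * (cmod (f x))\<^sup>2)"

text \<open>
  The free group \<open>exp (i t \<Delta>)\<close>, i.e. the Fourier multiplier \<open>exp (- i t n\<^sup>2)\<close>, given by its Fourier
  series.  The factor \<open>1 / (2\<pi>)\<close> comes from the normalisation of \<open>fourier\<close>.  The series converges
  absolutely for \<open>f \<in> H\<^sup>s\<close> with \<open>s > 1/2\<close>, the only case in which it is used.
\<close>

definition free_group :: "real \<Rightarrow> (real \<Rightarrow> complex) \<Rightarrow> real \<Rightarrow> complex" where
  "free_group t f x = of_real (1 / (2 * pi)) *
     (\<Sum>\<^sub>\<infinity>n. exp (- (\<i> * of_real t * (of_int n)\<^sup>2)) * fourier f n * exp (\<i> * of_int n * of_real x))"

definition nonlin :: "(real \<Rightarrow> real) \<Rightarrow> (real \<Rightarrow> complex) \<Rightarrow> real \<Rightarrow> complex" where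
  "nonlin lam f x = of_real ((cmod (f x))\<^sup>2) * f x + of_real (lam x) * f x"

text \<open>
  \<open>u \<in> C(\<real>; H\<^sup>s)\<close> solves \<open>i u\<^sub>t + \<Delta> u = |u|\<^sup>2 u + \<lambda> u\<close>, \<open>u(0) = \<Phi>\<close> in the sense of Duhamel's formula
  \<open>u(t) = exp (i t \<Delta>) \<Phi> - i \<integral>\<^sub>0\<^sup>t exp (i (t - \<tau>) \<Delta>) (|u|\<^sup>2 u + \<lambda> u)(\<tau>) d\<tau>\<close>.  For \<open>s \<ge> 1\<close> point evaluation is
  continuous on \<open>H\<^sup>s\<close>, so the \<open>H\<^sup>s\<close>-valued integral may be evaluated pointwise in \<open>x\<close>.  The initial
  condition is the formula at \<open>t = 0\<close>.  For \<open>t < 0\<close> the integral is the oriented one.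
\<close>

definition Hs_continuous :: "real \<Rightarrow> (real \<Rightarrow> real \<Rightarrow> complex) \<Rightarrow> bool" where
  "Hs_continuous s u \<longleftrightarrow> (\<forall>t. u t \<in> Hs s) \<and>
     (\<forall>t0. ((\<lambda>t. Hs_norm s (\<lambda>x. u t x - u t0 x)) \<longlongrightarrow> 0) (at t0))"

definition nls_solution ::
    "(real \<Rightarrow> real) \<Rightarrow> real \<Rightarrow> (real \<Rightarrow> complex) \<Rightarrow> (real \<Rightarrow> real \<Rightarrow> complex) \<Rightarrow> bool" where
  "nls_solution lam s \<Phi> u \<longleftrightarrow> Hs_continuous s u \<and>
     (\<forall>t. AE x in lborel. u t x = free_group t \<Phi> x
        - \<i> * (LBINT \<tau>=ereal 0..ereal t. free_group (t - \<tau>) (nonlin lam (u \<tau>)) x))"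

end

theory Submission
  imports Defs
begin

text \<open>
  The Fourier coefficients \<open>a\<^sub>n\<close> of a solution satisfy \<open>i a\<^sub>n' = n\<^sup>2 a\<^sub>n + F\<^sub>n\<close>.  With the weight \<open>w(n) = \<langle>n\<rangle>\<^bsup>2s\<^esup>\<close>, the
  derivative of \<open>\<Sum> w(n) |a\<^sub>n|\<^sup>2\<close> is a quadrilinear sum over \<open>n\<^sub>1 - n\<^sub>2 + n\<^sub>3 - n\<^sub>4 = 0\<close> with symbol
  \<open>w(n\<^sub>1) - w(n\<^sub>2) + w(n\<^sub>3) - w(n\<^sub>4)\<close>, plus a bilinear sum with symbol \<open>w(n) - w(m)\<close> coming from \<open>\<lambda>\<close>.  On this
  set the phase \<open>n\<^sub>1\<^sup>2 - n\<^sub>2\<^sup>2 + n\<^sub>3\<^sup>2 - n\<^sub>4\<^sup>2\<close> factors as \<open>2 (n\<^sub>1 - n\<^sub>2) (n\<^sub>1 - n\<^sub>4)\<close>, while the symbol is a second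
  difference of \<open>w\<close>; hence their quotient is bounded by the largest \<open>\<langle>n\<^sub>j\<rangle>\<^bsup>2s - 2\<^esup>\<close>, and there are no resonant
  terms.  Likewise \<open>w(n) - w(m)\<close> is divisible by \<open>n\<^sup>2 - m\<^sup>2\<close>.  Adding the forms with these quotients as
  multipliers to \<open>\<Sum> w(n) |a\<^sub>n|\<^sup>2\<close> gives a modified energy whose derivative, as well as its distance to
  \<open>\<parallel>u\<parallel>\<^sup>2\<close> in \<open>H\<^sup>s\<close>, is bounded by the square of the \<open>H\<^bsup>s - 1\<^esup>\<close> norm, with a constant depending on the \<open>H\<^sup>1\<close>
  norm.  Interpolation between \<open>L\<^sup>2\<close> and \<open>H\<^sup>s\<close> then yields growth of order \<open>|t|\<^bsup>s/2\<^esup>\<close>.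

  For \<open>w = 1\<close> and \<open>w(n) = 1 + n\<^sup>2\<close> the quotients are the constants \<open>0\<close> and \<open>1\<close>, the modified energy is
  conserved, and one recovers the conservation of mass and energy that controls the \<open>H\<^sup>1\<close> norm.
\<close>

section \<open>Sums over countable types\<close>

text \<open>The obstacle is regularity. For a solution in H^s the terms n^2 a_n lie only in H^(s -
  2), so the squared norm cannot be differentiated by simply inserting the equation, and no smoother
  approximating solutions are constructed. But the squared frequencies occur only inside phases. In
  |a_n|^2 they cancel against the conjugate; in the correction forms they meet the multiplier, and
  multiplier times phase is again a difference of weights, of order 2 s. Hence every series of
  termwise derivatives converges absolutely for a solution in H^s, and the fundamental theorem of
  calculus is used term by term. The same identity, with other multipliers, proves conservation of
  mass and energy.

  Every estimate uses two quantities: the l^1 norm of the coefficients, which H^1 controls and which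
  is submultiplicative under convolution, and the square of one Sobolev norm, which enters linearly.
  Linearity permits a closing argument without short time steps: on [-T, T] the supremum of the
  squared H^s norm is compared with its value at 0, and interpolation with a parameter of order 1/(1
  + T) absorbs half of that supremum.\<close>

abbreviation summ :: "('a \<Rightarrow> 'b::{banach, second_countable_topology}) \<Rightarrow> bool" where
  "summ \<equiv> integrable (count_space UNIV)"

text \<open>Sums are integrals over the counting measure, so that Tonelli, Fubini and Cauchy-Schwarz
  apply to them. \<open>nsum\<close> always exists: bounds are proved for it first, and summability
  then follows from finiteness.\<close>

abbreviation nsum :: "('a \<Rightarrow> ennreal) \<Rightarrow> ennreal" where
  "nsum \<equiv> integral\<^sup>N (count_space UNIV)"

abbreviation tsum :: "('a \<Rightarrow> 'b::{banach, second_countable_topology}) \<Rightarrow> 'b" where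
  "tsum \<equiv> integral\<^sup>L (count_space UNIV)"

lemma summ_iff: "summ f \<longleftrightarrow> (nsum (\<lambda>x. ennreal (norm (f x)))) < \<infinity>"
  by (simp add: integrable_iff_bounded)

lemma tsum_eq_infsum:
  assumes "summ f" shows "tsum f = infsum f UNIV"
  using infsetsum_infsum[of f UNIV] assms by (simp add: abs_summable_on_def infsetsum_def)

lemma summ_iff_summable_on_norm: "summ f \<longleftrightarrow> (\<lambda>x. norm (f x)) summable_on UNIV"
  using abs_summable_equivalent[of f UNIV] by (simp add: abs_summable_on_def)

lemma summ_iff_summable_on:
  fixes f :: "'a \<Rightarrow> real" assumes "\<And>x. f x \<ge> 0" shows "summ f \<longleftrightarrow> f summable_on UNIV"
  using summ_iff_summable_on_norm[of f] assms by simp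

lemma pair_count_space:
  "(count_space UNIV :: 'a::countable measure) \<Otimes>\<^sub>M (count_space UNIV :: 'b::countable measure) = count_space UNIV"
  by (subst pair_measure_countable) auto

text \<open>The hypothesis puts the sum inside the integral, where bounds uniform in
  \<open>x\<close> are available. Tonelli turns it into integrability over the product with the
  counting measure, and the consequences are the parts of Fubini's theorem.\<close>

context
  fixes M :: "'a measure" and f :: "'q::countable \<Rightarrow> 'a \<Rightarrow> 'b::{banach, second_countable_topology}"
  assumes sf: "sigma_finite_measure M"
    and meas: "\<And>q. f q \<in> borel_measurable M"
    and bd: "(\<integral>\<^sup>+x. \<integral>\<^sup>+q. ennreal (norm (f q x)) \<partial>count_space UNIV \<partial>M) < \<infinity>"
begin

lemma integrable_count_pair: "integrable (count_space UNIV \<Otimes>\<^sub>M M) (\<lambda>(q, x). f q x)"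
proof (rule integrableI_bounded)
  interpret sigma_finite_measure M by fact
  show [measurable]: "(\<lambda>(q, x). f q x) \<in> borel_measurable (count_space UNIV \<Otimes>\<^sub>M M)"
    by (rule measurable_pair_measure_countable1) (auto intro: meas)
  have "(\<integral>\<^sup>+p. ennreal (norm (case p of (q, x) \<Rightarrow> f q x)) \<partial>(count_space UNIV \<Otimes>\<^sub>M M))
      = (\<integral>\<^sup>+q. \<integral>\<^sup>+x. ennreal (norm (f q x)) \<partial>M \<partial>count_space UNIV)"
    by (subst nn_integral_fst[symmetric]) auto
  also have "\<dots> = (\<integral>\<^sup>+x. \<integral>\<^sup>+q. ennreal (norm (f q x)) \<partial>count_space UNIV \<partial>M)"
    by (rule nn_integral_count_space_nn_integral[symmetric]) (use meas in auto)
  finally show "(\<integral>\<^sup>+p. ennreal (norm (case p of (q, x) \<Rightarrow> f q x)) \<partial>(count_space UNIV \<Otimes>\<^sub>M M)) < \<infinity>"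
    using bd by simp
qed

lemma pair_sigma_finite_count_space: "pair_sigma_finite (count_space (UNIV :: 'q set)) M"
  using sf by (simp add: pair_sigma_finite_def sigma_finite_measure_count_space)

lemma integrable_tsum: "integrable M (\<lambda>x. tsum (\<lambda>q. f q x))"
  using pair_sigma_finite.integrable_snd[OF pair_sigma_finite_count_space integrable_count_pair] .

lemma summ_integral: "summ (\<lambda>q. \<integral>x. f q x \<partial>M)"
  using pair_sigma_finite.integrable_fst[OF pair_sigma_finite_count_space integrable_count_pair] .

lemma integral_tsum: "(\<integral>x. tsum (\<lambda>q. f q x) \<partial>M) = tsum (\<lambda>q. \<integral>x. f q x \<partial>M)"
  using pair_sigma_finite.Fubini_integral[OF pair_sigma_finite_count_space integrable_count_pair] .

end

lemma tsum_pair: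
  fixes f :: "'a::countable \<times> 'b::countable \<Rightarrow> 'c::{banach, second_countable_topology}"
  assumes "summ f" shows "tsum f = tsum (\<lambda>a. tsum (\<lambda>b. f (a, b)))"
    and "summ (\<lambda>a. tsum (\<lambda>b. f (a, b)))" and "summ (\<lambda>b. f (a, b))"
proof -
  interpret pair_sigma_finite "count_space (UNIV::'a set)" "count_space (UNIV::'b set)"
    by (simp add: pair_sigma_finite_def sigma_finite_measure_count_space)
  have f: "integrable (count_space UNIV \<Otimes>\<^sub>M count_space UNIV) f"
    by (simp add: pair_count_space assms)
  show "tsum f = tsum (\<lambda>a. tsum (\<lambda>b. f (a, b)))"
    using integral_fst'[OF f] by (simp add: pair_count_space)
  show "summ (\<lambda>a. tsum (\<lambda>b. f (a, b)))"
    using integrable_fst'[OF f] .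
  show "summ (\<lambda>b. f (a, b))"
    using AE_integrable_fst'[OF f] by (simp add: AE_count_space)
qed

lemma norm_tsum_le:
  assumes "nsum (\<lambda>x. ennreal (norm (f x))) \<le> ennreal B" "B \<ge> 0"
  shows "norm (tsum f) \<le> B" and "summ f" and "tsum (\<lambda>x. norm (f x)) \<le> B"
proof -
  show s: "summ f"
    using assms(1) le_less_trans ennreal_less_top by (fastforce simp: summ_iff)
  have "norm (tsum f) \<le> tsum (\<lambda>x. norm (f x))" by simp
  also have "ennreal (tsum (\<lambda>x. norm (f x))) = nsum (\<lambda>x. ennreal (norm (f x)))"
    by (rule nn_integral_eq_integral[symmetric]) (use s in auto)
  then have 1: "tsum (\<lambda>x. norm (f x)) \<le> B" using assms by (metis ennreal_le_iff)
  finally show "norm (tsum f) \<le> B" by simp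
  show "tsum (\<lambda>x. norm (f x)) \<le> B" by (rule 1)
qed

text \<open>Each term is integrated by the fundamental theorem of calculus, and sum and integral are
  exchanged by Fubini. A bound for the sum of the norms of the derivatives, uniform on the interval,
  suffices; the price is an integral identity in place of a derivative at each point.\<close>

lemma tsum_has_integral:
  fixes g g' :: "'q::countable \<Rightarrow> real \<Rightarrow> 'b::euclidean_space"
  assumes "a \<le> b"
    and der: "\<And>q x. x \<in> {a..b} \<Longrightarrow> (g q has_vector_derivative g' q x) (at x within {a..b})"
    and cont: "\<And>q. continuous_on {a..b} (g' q)"
    and s: "\<And>x. x \<in> {a..b} \<Longrightarrow> summ (\<lambda>q. g q x)"
    and bd: "\<And>x. x \<in> {a..b} \<Longrightarrow> (nsum (\<lambda>q. ennreal (norm (g' q x)))) \<le> ennreal B"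
  shows "((\<lambda>x. tsum (\<lambda>q. g' q x)) has_integral (tsum (\<lambda>q. g q b) - tsum (\<lambda>q. g q a))) {a..b}"
proof -
  define M where "M = restrict_space lborel {a..b}"
  have sp: "space M = {a..b}" by (simp add: M_def space_restrict_space)
  interpret finite_measure M
    by (rule finite_measureI) (use \<open>a \<le> b\<close> in \<open>simp add: M_def sp emeasure_restrict_space space_restrict_space\<close>)
  have sf: "sigma_finite_measure M" by unfold_locales
  have meas: "g' q \<in> borel_measurable M" for q
    unfolding M_def using borel_measurable_continuous_on_restrict[OF cont, of q]
    by (metis measurable_cong_sets sets_lborel sets_restrict_space_cong)
  have "(\<integral>\<^sup>+x. \<integral>\<^sup>+q. ennreal (norm (g' q x)) \<partial>count_space UNIV \<partial>M) \<le> (\<integral>\<^sup>+x. ennreal B \<partial>M)"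
    by (rule nn_integral_mono) (use bd sp in auto)
  also have "\<dots> < \<infinity>" by (simp add: ennreal_mult_less_top emeasure_eq_measure)
  finally have fin: "(\<integral>\<^sup>+x. \<integral>\<^sup>+q. ennreal (norm (g' q x)) \<partial>count_space UNIV \<partial>M) < \<infinity>" .
  have int: "(\<integral>x. g' q x \<partial>M) = g q b - g q a" for q
  proof -
    have "(\<integral>x. g' q x \<partial>M) = (LINT x:{a..b}|lborel. g' q x)"
      unfolding M_def set_lebesgue_integral_def by (subst integral_restrict_space) auto
    also have "\<dots> = g q b - g q a"
      using integral_FTC_Icc[OF \<open>a \<le> b\<close>, of "g q" "g' q"] der cont \<open>a \<le> b\<close>
      by (simp add: set_lebesgue_integral_def)
    finally show ?thesis .
  qed
  have 1: "set_integrable lborel {a..b} (\<lambda>x. tsum (\<lambda>q. g' q x))"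
    using integrable_tsum[OF sf meas fin] unfolding set_integrable_def M_def
    by (subst (asm) integrable_restrict_space) auto
  have "(LINT x:{a..b}|lborel. tsum (\<lambda>q. g' q x)) = (\<integral>x. tsum (\<lambda>q. g' q x) \<partial>M)"
    unfolding M_def set_lebesgue_integral_def by (subst integral_restrict_space) auto
  also have "\<dots> = tsum (\<lambda>q. g q b - g q a)"
    using integral_tsum[OF sf meas fin] int by simp
  also have "\<dots> = tsum (\<lambda>q. g q b) - tsum (\<lambda>q. g q a)"
    by (rule Bochner_Integration.integral_diff) (use s \<open>a \<le> b\<close> in auto)
  finally show ?thesis
    using set_borel_integral_eq_integral[OF 1] by (simp add: has_integral_iff)
qed

section \<open>Multilinear estimates for weighted sequences\<close>

lemma japanese_ge_1: "japanese n \<ge> 1"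
  by (simp add: japanese_def)

lemma japanese_pos [simp]: "japanese n > 0"
  using japanese_ge_1[of n] by linarith

lemma japanese_minus [simp]: "japanese (- n) = japanese n"
  by (simp add: japanese_def)

lemma japanese_sq: "(japanese n)\<^sup>2 = 1 + (real_of_int n)\<^sup>2"
  by (simp add: japanese_def)

text \<open>The bracket of n is the Euclidean length of the vector (1, n), and (1, m + n) is no
  longer than (2, m + n), the sum of the two vectors.\<close>

lemma japanese_add_le: "japanese (m + n) \<le> japanese m + japanese n"
proof -
  have *: "japanese k = norm (Complex 1 (real_of_int k))" for k
    by (simp add: japanese_def cmod_def)
  moreover have "norm (Complex 1 (real_of_int (m + n))) \<le> norm (Complex 2 (real_of_int (m + n)))"
    by (simp add: cmod_def)
  moreover have "norm (Complex 2 (real_of_int (m + n)))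
      \<le> norm (Complex 1 (real_of_int m)) + norm (Complex 1 (real_of_int n))"
    using norm_triangle_ineq[of "Complex 1 (real_of_int m)" "Complex 1 (real_of_int n)"]
    by (simp add: complex_add)
  ultimately show ?thesis using *[of m] *[of n] *[of "m + n"] by linarith
qed

lemma japanese_diff_le: "japanese (m - n) \<le> japanese m + japanese n"
  using japanese_add_le[of m "- n"] by simp

text \<open>The sum of two numbers that are at least 1 is at most 1 plus their product, hence at
  most twice the product.\<close>

lemma japanese_add_le_mult: "japanese (m + n) \<le> 2 * japanese m * japanese n"
proof -
  have "0 \<le> (japanese m - 1) * (japanese n - 1)"
    using japanese_ge_1 by simp
  moreover have "0 \<le> japanese m * japanese n - 1"
    using mult_mono[OF japanese_ge_1[of m] japanese_ge_1[of n]] less_imp_le[OF japanese_pos[of m]] by simp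
  ultimately show ?thesis using japanese_add_le[of m n] by (simp add: algebra_simps)
qed

abbreviation jw :: "real \<Rightarrow> int \<Rightarrow> real" where "jw \<sigma> n \<equiv> japanese n powr \<sigma>"

lemma jw_double: "jw (2 * \<sigma>) n = (jw \<sigma> n)\<^sup>2"
  by (simp add: power2_eq_square flip: powr_add)

lemma jw_ge_1: "\<sigma> \<ge> 0 \<Longrightarrow> jw \<sigma> n \<ge> 1"
  using ge_one_powr_ge_zero japanese_ge_1 by blast

lemma jw_2: "jw 2 n = 1 + (real_of_int n)\<^sup>2"
  using japanese_sq[of n] by (simp add: less_imp_le)

lemma jw_mono: "\<sigma> \<le> \<tau> \<Longrightarrow> jw \<sigma> n \<le> jw \<tau> n"
  using japanese_ge_1 by (simp add: powr_mono)

lemma powr_le_sum3: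
  fixes a b c d :: real
  assumes "0 \<le> a" "a \<le> b + c + d" "b \<ge> 0" "c \<ge> 0" "d \<ge> 0" "\<sigma> \<ge> 0"
  shows "a powr \<sigma> \<le> 3 powr \<sigma> * (b powr \<sigma> + c powr \<sigma> + d powr \<sigma>)"
proof -
  have "\<exists>e\<in>{b, c, d}. a \<le> 3 * e" using assms by force
  then obtain e where e: "e \<in> {b, c, d}" "a \<le> 3 * e" by blast
  have "a powr \<sigma> \<le> (3 * e) powr \<sigma>" by (rule powr_mono2) (use e assms in auto)
  also have "\<dots> = 3 powr \<sigma> * e powr \<sigma>" using e assms by (auto simp: powr_mult)
  also have "\<dots> \<le> 3 powr \<sigma> * (b powr \<sigma> + c powr \<sigma> + d powr \<sigma>)"
    by (rule mult_left_mono) (use e in auto)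
  finally show ?thesis .
qed

text \<open>One minus sign in any position: this covers every way of solving n1 - n2 + n3 - n4 = 0
  for one frequency, with the other three in any order.\<close>

lemma jw_sum3:
  assumes "\<sigma> \<ge> 0" "n = p - r + q \<or> n = p + r - q \<or> n = - p + r + q"
  shows "jw \<sigma> n \<le> 3 powr \<sigma> * (jw \<sigma> p + jw \<sigma> r + jw \<sigma> q)"
proof (rule powr_le_sum3)
  show "japanese n \<le> japanese p + japanese r + japanese q"
    using assms(2) japanese_diff_le[of p r] japanese_add_le[of "p - r" q]
      japanese_add_le[of p r] japanese_diff_le[of "p + r" q]
      japanese_diff_le[of r p] japanese_add_le[of "r - p" q]
    by (elim disjE) auto
qed (use assms less_imp_le[OF japanese_pos] in auto)

lemma jw_add: 
  assumes "\<sigma> \<ge> 0" shows "jw \<sigma> (m + n) \<le> 2 powr \<sigma> * jw \<sigma> m * jw \<sigma> n"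
proof -
  have "jw \<sigma> (m + n) \<le> (2 * japanese m * japanese n) powr \<sigma>"
    by (rule powr_mono2) (use assms japanese_add_le_mult less_imp_le[OF japanese_pos] in auto)
  then show ?thesis by (simp add: powr_mult less_imp_le)
qed

section \<open>The quadrilinear form with the sum of the weights\<close>

definition l1_norm :: "(int \<Rightarrow> complex) \<Rightarrow> ennreal" where
  "l1_norm b = nsum (\<lambda>n. ennreal (cmod (b n)))"

definition hs_sq :: "real \<Rightarrow> (int \<Rightarrow> complex) \<Rightarrow> ennreal" where
  "hs_sq \<sigma> b = nsum (\<lambda>n. ennreal ((jw \<sigma> n * cmod (b n))\<^sup>2))"

text \<open>The sum of the four weights is comparable with the largest one and symmetric in the
  frequencies; \<open>n - p + r\<close> is the fourth frequency of the quadruple.\<close>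

definition quad_weight :: "real \<Rightarrow> int \<times> int \<times> int \<Rightarrow> real" where
  "quad_weight \<sigma> = (\<lambda>(n, p, r). jw (2 * \<sigma>) p + jw (2 * \<sigma>) r + jw (2 * \<sigma>) (n - p + r) + jw (2 * \<sigma>) n)"

lemma nn_sum3:
  fixes f g h :: "int \<Rightarrow> ennreal"
  shows "nsum (\<lambda>(n, p, r). f n * g p * h r)
    = nsum (\<lambda>n. f n) * nsum (\<lambda>n. g n) * nsum (\<lambda>n. h n)"
proof -
  have "nsum (\<lambda>(n, p, r). f n * g p * h r)
     = (\<integral>\<^sup>+n. \<integral>\<^sup>+p. \<integral>\<^sup>+r. f n * g p * h r \<partial>count_space UNIV \<partial>count_space UNIV \<partial>count_space UNIV)"
    by (simp add: nn_integral_fst_count_space[symmetric])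
  then show ?thesis by (simp add: nn_integral_cmult nn_integral_multc)
qed

lemma nn_sum_bij:
  assumes "bij \<phi>" shows "nsum (\<lambda>x. f (\<phi> x)) = nsum (\<lambda>x. f x)"
  using nn_integral_bij_count_space[of \<phi> UNIV UNIV f] assms by simp

lemma l1_norm_bij: "bij \<phi> \<Longrightarrow> (nsum (\<lambda>n. ennreal (cmod (b (\<phi> n))))) = l1_norm b"
  unfolding l1_norm_def by (rule nn_sum_bij)

lemma bij_selfinv: "(\<And>x. \<phi> (\<phi> x) = x) \<Longrightarrow> bij \<phi>"
  by (rule o_bij[of \<phi>]) auto

text \<open>Each weight is at most a constant times the sum of the other three, so the sum of the
  squares is dominated by products of weights at two different frequencies. The arithmetic-geometric
  mean then leaves one weighted factor squared and two plain factors, while one frequency drops out.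
  The twelve terms are grouped by the missing frequency, in the order \<open>n - p + r\<close>,
  \<open>r\<close>, \<open>p\<close>, \<open>n\<close>; the three frequencies that remain vary
  independently, so that the sums factor.\<close>

lemma quad_weight_pointwise:
  fixes b1 b2 b3 b4 :: "int \<Rightarrow> complex"
  assumes "\<sigma> \<ge> 0"
  defines "B \<equiv> \<lambda>b n. cmod (b n)" and "X \<equiv> \<lambda>b n. (jw \<sigma> n * cmod (b n))\<^sup>2"
  shows "quad_weight \<sigma> (n, p, r) * (B b1 p * B b2 r * B b3 (n - p + r) * B b4 n)
    \<le> 3 powr \<sigma> *
     ((X b4 n * B b1 p * B b2 r + B b4 n * X b1 p * B b2 r + B b4 n * B b1 p * X b2 r)
    + (X b4 n * B b1 p * B b3 (n-p+r) + B b4 n * X b1 p * B b3 (n-p+r) + B b4 n * B b1 p * X b3 (n-p+r))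
    + (X b4 n * B b3 (n-p+r) * B b2 r + B b4 n * X b3 (n-p+r) * B b2 r + B b4 n * B b3 (n-p+r) * X b2 r)
    + (X b3 (n-p+r) * B b1 p * B b2 r + B b3 (n-p+r) * X b1 p * B b2 r + B b3 (n-p+r) * B b1 p * X b2 r))"
proof -
  define q where "q = n - p + r"
  define K where "K = 3 powr \<sigma>"
  define x1 x2 x3 x4 where "x1 = jw \<sigma> p" and "x2 = jw \<sigma> r" and "x3 = jw \<sigma> q" and "x4 = jw \<sigma> n"
  define y1 y2 y3 y4 where "y1 = B b1 p" and "y2 = B b2 r" and "y3 = B b3 q" and "y4 = B b4 n"
  have x: "x1 \<ge> 0" "x2 \<ge> 0" "x3 \<ge> 0" "x4 \<ge> 0" by (auto simp: x1_def x2_def x3_def x4_def)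
  have y: "y1 \<ge> 0" "y2 \<ge> 0" "y3 \<ge> 0" "y4 \<ge> 0" by (auto simp: y1_def y2_def y3_def y4_def B_def)
  have K: "K \<ge> 0" by (simp add: K_def)
  have h: "x1 \<le> K * (x4 + x2 + x3)" "x2 \<le> K * (x1 + x3 + x4)" "x3 \<le> K * (x4 + x1 + x2)"
      "x4 \<le> K * (x1 + x2 + x3)"
    unfolding x1_def x2_def x3_def x4_def K_def
    using jw_sum3[OF assms(1), of p n r q] jw_sum3[OF assms(1), of r p q n]
      jw_sum3[OF assms(1), of q n p r] jw_sum3[OF assms(1), of n p r q]
    by (simp_all add: q_def algebra_simps)
  have am: "u * v \<le> (u\<^sup>2 + v\<^sup>2) / 2" for u v :: real
    using sum_squares_bound[of u v] by simp
  have "x1\<^sup>2 + x2\<^sup>2 + x3\<^sup>2 + x4\<^sup>2 \<le> x1 * (K * (x4 + x2 + x3)) + x2 * (K * (x1 + x3 + x4))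
     + x3 * (K * (x4 + x1 + x2)) + x4 * (K * (x1 + x2 + x3))"
    unfolding power2_eq_square by (intro add_mono mult_left_mono h x)
  also have "\<dots> = 2 * K * (x1*x2 + x1*x3 + x1*x4 + x2*x3 + x2*x4 + x3*x4)" by (simp add: algebra_simps)
  finally have 1: "(x1\<^sup>2 + x2\<^sup>2 + x3\<^sup>2 + x4\<^sup>2) * (y1 * y2 * y3 * y4)
      \<le> 2 * K * (x1*x2 + x1*x3 + x1*x4 + x2*x3 + x2*x4 + x3*x4) * (y1 * y2 * y3 * y4)"
    by (intro mult_right_mono) (use y in auto)
  also have "\<dots> = 2 * K * ((x1*y1)*(x2*y2)*(y3*y4) + (x1*y1)*(x3*y3)*(y2*y4) + (x1*y1)*(x4*y4)*(y2*y3)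
      + (x2*y2)*(x3*y3)*(y1*y4) + (x2*y2)*(x4*y4)*(y1*y3) + (x3*y3)*(x4*y4)*(y1*y2))"
    by (simp add: algebra_simps)
  also have "\<dots> \<le> 2 * K * (((x1*y1)\<^sup>2+(x2*y2)\<^sup>2)/2*(y3*y4) + ((x1*y1)\<^sup>2+(x3*y3)\<^sup>2)/2*(y2*y4) + ((x1*y1)\<^sup>2+(x4*y4)\<^sup>2)/2*(y2*y3)
      + ((x2*y2)\<^sup>2+(x3*y3)\<^sup>2)/2*(y1*y4) + ((x2*y2)\<^sup>2+(x4*y4)\<^sup>2)/2*(y1*y3) + ((x3*y3)\<^sup>2+(x4*y4)\<^sup>2)/2*(y1*y2))"
    by (intro mult_left_mono add_mono mult_right_mono am) (use y K in auto)
  also have "\<dots> = K * (((x4*y4)\<^sup>2 * y1 * y2 + y4 * (x1*y1)\<^sup>2 * y2 + y4 * y1 * (x2*y2)\<^sup>2)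
    + ((x4*y4)\<^sup>2 * y1 * y3 + y4 * (x1*y1)\<^sup>2 * y3 + y4 * y1 * (x3*y3)\<^sup>2)
    + ((x4*y4)\<^sup>2 * y3 * y2 + y4 * (x3*y3)\<^sup>2 * y2 + y4 * y3 * (x2*y2)\<^sup>2)
    + ((x3*y3)\<^sup>2 * y1 * y2 + y3 * (x1*y1)\<^sup>2 * y2 + y3 * y1 * (x2*y2)\<^sup>2))"
    by (simp add: field_simps)
  finally have main: "(x1\<^sup>2 + x2\<^sup>2 + x3\<^sup>2 + x4\<^sup>2) * (y1 * y2 * y3 * y4) \<le> \<dots>" .
  have e: "quad_weight \<sigma> (n, p, r) = x1\<^sup>2 + x2\<^sup>2 + x3\<^sup>2 + x4\<^sup>2"
    unfolding quad_weight_def x1_def x2_def x3_def x4_def q_def jw_double by simp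
  have f: "X b1 p = (x1*y1)\<^sup>2" "X b2 r = (x2*y2)\<^sup>2" "X b3 q = (x3*y3)\<^sup>2" "X b4 n = (x4*y4)\<^sup>2"
    by (auto simp: X_def x1_def x2_def x3_def x4_def y1_def y2_def y3_def y4_def B_def)
  show ?thesis
    using main unfolding q_def[symmetric] e f y1_def[symmetric] y2_def[symmetric] y3_def[symmetric] y4_def[symmetric]
      K_def[symmetric] .
qed

lemma tri_bound:
  assumes "\<And>b. b \<in> {f, g, h} \<Longrightarrow> l1_norm b \<le> P" "\<And>b. b \<in> {f, g, h} \<Longrightarrow> hs_sq \<sigma> b \<le> Z"
  defines "B \<equiv> \<lambda>b n. cmod (b n)" and "X \<equiv> \<lambda>b n. (jw \<sigma> n * cmod (b n))\<^sup>2"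
  shows "nsum (\<lambda>(n, p, r). ennreal (X f n * B g p * B h r + B f n * X g p * B h r + B f n * B g p * X h r))
     \<le> 3 * Z * P * P"
proof -
  have nn: "B b n \<ge> 0" "X b n \<ge> 0" for b n by (auto simp: B_def X_def)
  have "nsum (\<lambda>(n, p, r). ennreal (X f n * B g p * B h r + B f n * X g p * B h r + B f n * B g p * X h r))
    = nsum (\<lambda>x. (case x of (n, p, r) \<Rightarrow> ennreal (X f n) * ennreal (B g p) * ennreal (B h r)) +
             (case x of (n, p, r) \<Rightarrow> ennreal (B f n) * ennreal (X g p) * ennreal (B h r)) +
             (case x of (n, p, r) \<Rightarrow> ennreal (B f n) * ennreal (B g p) * ennreal (X h r)))"
    by (intro nn_integral_cong) (auto simp: nn ennreal_mult ennreal_plus split: prod.splits)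
  also have "\<dots> = hs_sq \<sigma> f * l1_norm g * l1_norm h + l1_norm f * hs_sq \<sigma> g * l1_norm h + l1_norm f * l1_norm g * hs_sq \<sigma> h"
    by (simp add: nn_integral_add nn_sum3 hs_sq_def l1_norm_def X_def B_def)
  also have "\<dots> \<le> Z * P * P + P * Z * P + P * P * Z"
    by (intro add_mono mult_mono) (use assms in auto)
  also have "\<dots> = (1 + 1 + 1) * Z * P * P" by (simp only: distrib_right mult_1) (simp add: ac_simps)
  also have "(1 + 1 + 1 :: ennreal) = 3" by simp
  finally show ?thesis .
qed

text \<open>The factor 12 counts the terms of \<open>quad_weight_pointwise\<close>, each of which
  contributes \<open>Z * P\<^sup>2\<close>.\<close>

lemma quad_bound:
  fixes b1 b2 b3 b4 :: "int \<Rightarrow> complex" and Z P :: real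
  assumes "\<sigma> \<ge> 0" "P \<ge> 0" "Z \<ge> 0"
    and "\<And>b. b \<in> {b1, b2, b3, b4} \<Longrightarrow> l1_norm b \<le> ennreal P"
    and "\<And>b. b \<in> {b1, b2, b3, b4} \<Longrightarrow> hs_sq \<sigma> b \<le> ennreal Z"
  shows "nsum (\<lambda>(n, p, r). ennreal (quad_weight \<sigma> (n, p, r) * (cmod (b1 p) * cmod (b2 r) * cmod (b3 (n - p + r)) * cmod (b4 n))))
    \<le> ennreal (12 * 3 powr \<sigma> * Z * P\<^sup>2)"
proof -
  define B where "B = (\<lambda>(b :: int \<Rightarrow> complex) n. cmod (b n))"
  define X where "X = (\<lambda>b n. (jw \<sigma> n * cmod (b n))\<^sup>2)"
  define tri where "tri = (\<lambda>f g h (n, p, r). ennreal (X f n * B g p * B h r + B f n * X g p * B h r + B f n * B g p * X h r))"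
  have nn: "B b n \<ge> 0" "X b n \<ge> 0" for b n by (auto simp: B_def X_def)
  have t: "nsum (\<lambda>x. tri f g h x) \<le> ennreal (3 * Z * P\<^sup>2)"
    if "{f, g, h} \<subseteq> {b1, b2, b3, b4}" for f g h
  proof -
    have "nsum (\<lambda>x. tri f g h x) \<le> 3 * ennreal Z * ennreal P * ennreal P"
      unfolding tri_def X_def B_def by (rule tri_bound) (use assms that in auto)
    also have "\<dots> = ennreal (3 * Z * P\<^sup>2)"
      using assms by (simp add: ennreal_mult power2_eq_square mult.assoc)
    finally show ?thesis .
  qed
  \<comment> \<open>Changes of variables from (n, p, r) to the frequencies that are left when
    \<open>r\<close>, \<open>p\<close> or \<open>n\<close> is missing; the group without
    \<open>n - p + r\<close> is already in such coordinates.\<close>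
  define \<phi>1 \<phi>2 \<phi>3 :: "int \<times> int \<times> int \<Rightarrow> int \<times> int \<times> int"
    where "\<phi>1 = (\<lambda>(n, p, r). (n, p, n - p + r))" and "\<phi>2 = (\<lambda>(n, p, r). (n, n - p + r, r))"
      and "\<phi>3 = (\<lambda>(n, p, r). (n - p + r, p, r))"
  have bij: "bij \<phi>1" "bij \<phi>2" "bij \<phi>3"
  proof -
    show "bij \<phi>2" by (rule bij_selfinv) (auto simp: \<phi>2_def)
    show "bij \<phi>1" by (rule o_bij[of "\<lambda>(n, p, q). (n, p, q - n + p)"]) (auto simp: \<phi>1_def)
    show "bij \<phi>3" by (rule o_bij[of "\<lambda>(q, p, r). (q + p - r, p, r)"]) (auto simp: \<phi>3_def)
  qed
  have "nsum (\<lambda>(n, p, r). ennreal (quad_weight \<sigma> (n, p, r) * (cmod (b1 p) * cmod (b2 r) * cmod (b3 (n - p + r)) * cmod (b4 n))))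
    \<le> nsum (\<lambda>x. ennreal (3 powr \<sigma>) * (tri b4 b1 b2 x + tri b4 b1 b3 (\<phi>1 x) + tri b4 b3 b2 (\<phi>2 x) + tri b3 b1 b2 (\<phi>3 x)))"
    (is "(\<integral>\<^sup>+x. ?l x \<partial>_) \<le> (\<integral>\<^sup>+x. ?r x \<partial>_)")
  proof (rule nn_integral_mono)
    fix x :: "int \<times> int \<times> int"
    obtain n p r where x: "x = (n, p, r)" by (cases x) auto
    show "?l x \<le> ?r x"
      unfolding x using quad_weight_pointwise[OF assms(1), of n p r b1 b2 b3 b4]
      by (simp add: tri_def \<phi>1_def \<phi>2_def \<phi>3_def B_def X_def
        flip: ennreal_plus ennreal_mult)
  qed
  also have "\<dots> = ennreal (3 powr \<sigma>) * (nsum (\<lambda>x. tri b4 b1 b2 x) + nsum (\<lambda>x. tri b4 b1 b3 x)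
      + nsum (\<lambda>x. tri b4 b3 b2 x) + nsum (\<lambda>x. tri b3 b1 b2 x))"
    by (simp add: nn_integral_cmult nn_integral_add nn_sum_bij[OF bij(1)] nn_sum_bij[OF bij(2)] nn_sum_bij[OF bij(3)])
  also have "\<dots> \<le> ennreal (3 powr \<sigma>) * (ennreal (3 * Z * P\<^sup>2) + ennreal (3 * Z * P\<^sup>2) + ennreal (3 * Z * P\<^sup>2) + ennreal (3 * Z * P\<^sup>2))"
    by (intro mult_left_mono add_mono t) auto
  also have "\<dots> = ennreal (12 * 3 powr \<sigma> * Z * P\<^sup>2)"
    using assms by (simp flip: ennreal_plus ennreal_mult)
  finally show ?thesis .
qed

lemma norm_tsum_le_nn: "ennreal (norm (tsum f)) \<le> nsum (\<lambda>x. ennreal (norm (f x)))"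
proof (cases "summ f")
  case True then show ?thesis by (rule integral_norm_bound_ennreal)
next
  case False then show ?thesis by (simp add: not_integrable_integral_eq)
qed

lemma nn_sum_swap:
  fixes f :: "'a::countable \<Rightarrow> 'b::countable \<Rightarrow> ennreal"
  shows "(\<integral>\<^sup>+x. \<integral>\<^sup>+y. f x y \<partial>count_space UNIV \<partial>count_space UNIV)
    = (\<integral>\<^sup>+y. \<integral>\<^sup>+x. f x y \<partial>count_space UNIV \<partial>count_space UNIV)"
  by (rule nn_integral_count_space_nn_integral) auto

text \<open>Young's inequality for a summable and a square summable sequence: Cauchy-Schwarz for the
  measure with density \<open>W\<close>, then Tonelli. The family \<open>\<phi>\<close> covers
  convolutions with either sign and with several summation indices.\<close>

lemma conv_sq_le:
  fixes W :: "'q::countable \<Rightarrow> ennreal" and C :: "int \<Rightarrow> ennreal"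
    and \<phi> :: "int \<Rightarrow> 'q \<Rightarrow> int"
  assumes "\<And>q. bij (\<lambda>n. \<phi> n q)"
  shows "nsum (\<lambda>n. (nsum (\<lambda>q. W q * C (\<phi> n q)))\<^sup>2)
    \<le> (nsum (\<lambda>q. W q))\<^sup>2 * nsum (\<lambda>n. (C n)\<^sup>2)"
proof -
  have *: "(nsum (\<lambda>q. W q * C (\<phi> n q)))\<^sup>2
     \<le> nsum (\<lambda>q. W q * (C (\<phi> n q))\<^sup>2) * nsum (\<lambda>q. W q)" for n
    using Cauchy_Schwarz_nn_integral[of "\<lambda>q. C (\<phi> n q)" "density (count_space UNIV) W" "\<lambda>_. 1"]
    by (simp add: nn_integral_density emeasure_density)
  have "nsum (\<lambda>n. (nsum (\<lambda>q. W q * C (\<phi> n q)))\<^sup>2)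
    \<le> nsum (\<lambda>n. nsum (\<lambda>q. W q * (C (\<phi> n q))\<^sup>2) * nsum (\<lambda>q. W q))"
    by (rule nn_integral_mono) (use * in auto)
  also have "\<dots> = nsum (\<lambda>n. nsum (\<lambda>q. W q * (C (\<phi> n q))\<^sup>2)) * nsum (\<lambda>q. W q)"
    by (rule nn_integral_multc) auto
  also have "nsum (\<lambda>n. nsum (\<lambda>q. W q * (C (\<phi> n q))\<^sup>2))
    = nsum (\<lambda>q. nsum (\<lambda>n. W q * (C (\<phi> n q))\<^sup>2))"
    by (rule nn_sum_swap)
  also have "\<dots> = nsum (\<lambda>q. W q * nsum (\<lambda>n. (C (\<phi> n q))\<^sup>2))"
    by (simp add: nn_integral_cmult)
  also have "\<dots> = nsum (\<lambda>q. W q * nsum (\<lambda>n. (C n)\<^sup>2))"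
    by (simp add: nn_sum_bij[OF assms, of "\<lambda>n. (C n)\<^sup>2"])
  finally show ?thesis
    by (simp add: nn_integral_multc power2_eq_square ac_simps)
qed

lemma ennreal_sq_sum3: "((u::ennreal) + v + w)\<^sup>2 \<le> 3 * (u\<^sup>2 + v\<^sup>2 + w\<^sup>2)"
proof (cases u; cases v; cases w)
  fix x y z assume *: "u = ennreal x" "v = ennreal y" "w = ennreal z" "0 \<le> x" "0 \<le> y" "0 \<le> z"
  have "(x + y + z)\<^sup>2 \<le> 3 * (x\<^sup>2 + y\<^sup>2 + z\<^sup>2)"
    using sum_squares_bound[of x y] sum_squares_bound[of x z] sum_squares_bound[of y z]
    by (simp add: power2_sum algebra_simps)
  moreover have "(u + v + w)\<^sup>2 = ennreal ((x + y + z)\<^sup>2)"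
    using * by (simp add: ennreal_power flip: ennreal_plus)
  moreover have "3 * (u\<^sup>2 + v\<^sup>2 + w\<^sup>2) = ennreal (3 * (x\<^sup>2 + y\<^sup>2 + z\<^sup>2))"
    using * by (simp add: ennreal_mult ennreal_power)
  ultimately show ?thesis by (simp only: ennreal_leI)
qed auto

lemma bij_int_shift: "bij (\<lambda>n::int. n + c)" "bij (\<lambda>n::int. c - n)" "bij (\<lambda>n::int. c + n)" "bij (\<lambda>n::int. n - c)"
proof -
  show "bij (\<lambda>n::int. n + c)" by (rule o_bij[of "\<lambda>n. n - c"]) auto
  show "bij (\<lambda>n::int. c - n)" by (rule o_bij[of "\<lambda>n. c - n"]) auto
  show "bij (\<lambda>n::int. c + n)" by (rule o_bij[of "\<lambda>n. n - c"]) auto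
  show "bij (\<lambda>n::int. n - c)" by (rule o_bij[of "\<lambda>n. n + c"]) auto
qed

section \<open>The convolutions that represent the nonlinearity and the potential\<close>

definition cub :: "(int \<Rightarrow> complex) \<Rightarrow> (int \<Rightarrow> complex) \<Rightarrow> (int \<Rightarrow> complex) \<Rightarrow> int \<Rightarrow> complex" where
  "cub a b c n = tsum (\<lambda>(p, r). a p * cnj (b r) * c (n - p + r))"

definition lin :: "(int \<Rightarrow> complex) \<Rightarrow> (int \<Rightarrow> complex) \<Rightarrow> int \<Rightarrow> complex" where
  "lin l a n = tsum (\<lambda>m. l (n - m) * a m)"

text \<open>The Fourier coefficients of |u|^2 u + \<lambda> u when \<open>a\<close> and
  \<open>l\<close> are those of u and \<lambda>; see \<open>coef_nonlin\<close>.\<close>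

definition nls_rhs :: "(int \<Rightarrow> complex) \<Rightarrow> (int \<Rightarrow> complex) \<Rightarrow> int \<Rightarrow> complex" where
  "nls_rhs l a n = cub a a a n + lin l a n"

lemma nn_sum2: "nsum (\<lambda>(p, r). f p * g r) = nsum (\<lambda>p. f p) * nsum (\<lambda>r. g r)"
  for f :: "'a::countable \<Rightarrow> ennreal" and g :: "'b::countable \<Rightarrow> ennreal"
  by (subst nn_integral_fst_count_space[symmetric]) (simp add: nn_integral_cmult nn_integral_multc)

lemma cub_le_nn: "ennreal (cmod (cub a b c n))
    \<le> nsum (\<lambda>(p, r). ennreal (cmod (a p)) * ennreal (cmod (b r)) * ennreal (cmod (c (n - p + r))))"
  unfolding cub_def
  by (rule order_trans[OF norm_tsum_le_nn])
     (auto intro!: nn_integral_mono simp: norm_mult ennreal_mult split: prod.splits)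

lemma lin_le_nn: "ennreal (cmod (lin l a n))
    \<le> nsum (\<lambda>m. ennreal (cmod (l (n - m))) * ennreal (cmod (a m)))"
  unfolding lin_def
  by (rule order_trans[OF norm_tsum_le_nn])
     (auto intro!: nn_integral_mono simp: norm_mult ennreal_mult split: prod.splits)

text \<open>Absolutely convergent Fourier series form an algebra: in the triple sum the outer index
  occurs in the last factor only and is summed first.\<close>

lemma l1_cub: "l1_norm (cub a b c) \<le> l1_norm a * l1_norm b * l1_norm c"
proof -
  have "l1_norm (cub a b c) \<le> nsum (\<lambda>n. nsum (\<lambda>(p, r). ennreal (cmod (a p)) * ennreal (cmod (b r)) * ennreal (cmod (c (n - p + r)))))"
    unfolding l1_norm_def[of "cub a b c"] by (rule nn_integral_mono) (rule cub_le_nn)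
  also have "\<dots> = nsum (\<lambda>x. nsum (\<lambda>n. (case x of (p, r) \<Rightarrow> ennreal (cmod (a p)) * ennreal (cmod (b r)) * ennreal (cmod (c (n - p + r))))))"
    by (rule nn_sum_swap)
  also have "\<dots> = nsum (\<lambda>(p, r). ennreal (cmod (a p)) * ennreal (cmod (b r)) * l1_norm c)"
  proof (rule nn_integral_cong, clarify)
    fix p r :: int
    show "nsum (\<lambda>n. ennreal (cmod (a p)) * ennreal (cmod (b r)) * ennreal (cmod (c (n - p + r))))
      = ennreal (cmod (a p)) * ennreal (cmod (b r)) * l1_norm c"
      using l1_norm_bij[OF bij_int_shift(1)[of "r - p"], of c] by (simp add: nn_integral_cmult algebra_simps)
  qed
  also have "\<dots> = nsum (\<lambda>(p, r). ennreal (cmod (a p)) * (ennreal (cmod (b r)) * l1_norm c))"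
    by (simp add: mult.assoc)
  also have "\<dots> = l1_norm a * l1_norm b * l1_norm c"
    by (subst nn_sum2) (simp add: l1_norm_def nn_integral_multc mult.assoc)
  finally show ?thesis .
qed

lemma l1_lin: "l1_norm (lin l a) \<le> l1_norm l * l1_norm a"
proof -
  have "l1_norm (lin l a) \<le> nsum (\<lambda>n. nsum (\<lambda>m. ennreal (cmod (l (n - m))) * ennreal (cmod (a m))))"
    unfolding l1_norm_def[of "lin l a"] by (rule nn_integral_mono) (rule lin_le_nn)
  also have "\<dots> = nsum (\<lambda>m. nsum (\<lambda>n. ennreal (cmod (l (n - m))) * ennreal (cmod (a m))))"
    by (rule nn_sum_swap)
  also have "\<dots> = l1_norm l * l1_norm a"
    by (simp add: nn_integral_multc l1_norm_bij[OF bij_int_shift(4)] nn_integral_cmult flip: l1_norm_def)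
  finally show ?thesis .
qed

text \<open>The weight at the output frequency is moved to one of the three factors, which is then
  measured in H^\<sigma> and the other two in l^1. Therefore \<open>Z\<close> enters linearly. The
  factor 9 is 3, from the square of a sum of three terms, times the number of terms.\<close>

lemma hs_sq_cub:
  fixes P Z :: real
  assumes "\<sigma> \<ge> 0" "P \<ge> 0" "Z \<ge> 0"
    and l1: "\<And>d. d \<in> {a, b, c} \<Longrightarrow> l1_norm d \<le> ennreal P"
    and hs: "\<And>d. d \<in> {a, b, c} \<Longrightarrow> hs_sq \<sigma> d \<le> ennreal Z"
  shows "hs_sq \<sigma> (cub a b c) \<le> ennreal (9 * (3 powr \<sigma>)\<^sup>2 * P ^ 4 * Z)"
proof -
  define B where "B = (\<lambda>(b :: int \<Rightarrow> complex) n. ennreal (cmod (b n)))"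
  define X where "X = (\<lambda>(b :: int \<Rightarrow> complex) n. ennreal (jw \<sigma> n * cmod (b n)))"
  define K where "K = ennreal (3 powr \<sigma>)"
  have hsX: "hs_sq \<sigma> d = nsum (\<lambda>n. (X d n)\<^sup>2)" for d
    by (simp add: hs_sq_def X_def ennreal_power)
  have l1B: "l1_norm d = nsum (\<lambda>n. B d n)" for d
    by (simp add: l1_norm_def B_def)
  define T where "T = (\<lambda>f g h (n :: int). \<integral>\<^sup>+(p, r). (f p :: ennreal) * g r * h (n - p + r) \<partial>count_space UNIV)"
  have key: "nsum (\<lambda>n. (nsum (\<lambda>q. (case q of (x, y) \<Rightarrow> B d x * B e y) * X f (\<phi> n q)))\<^sup>2)
      \<le> ennreal (P ^ 4 * Z)"
    if "{d, e, f} \<subseteq> {a, b, c}" "\<And>q. bij (\<lambda>n. \<phi> n q)" for d e f and \<phi> :: "int \<Rightarrow> int \<times> int \<Rightarrow> int"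
  proof -
    have "nsum (\<lambda>n. (nsum (\<lambda>q. (case q of (x, y) \<Rightarrow> B d x * B e y) * X f (\<phi> n q)))\<^sup>2)
      \<le> (nsum (\<lambda>q. (case q of (x, y) \<Rightarrow> B d x * B e y)))\<^sup>2 * nsum (\<lambda>n. (X f n)\<^sup>2)"
      by (rule conv_sq_le) (use that in auto)
    also have "\<dots> = (l1_norm d * l1_norm e)\<^sup>2 * hs_sq \<sigma> f"
      by (subst nn_sum2) (simp add: hsX l1B)
    also have "\<dots> \<le> (ennreal P * ennreal P)\<^sup>2 * ennreal Z"
      by (intro mult_mono power_mono l1 hs) (use that in auto)
    also have "\<dots> = ennreal (P ^ 4 * Z)"
      using assms by (simp add: ennreal_mult ennreal_power power_mult_distrib power4_eq_xxxx power2_eq_square mult.assoc)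
    finally show ?thesis .
  qed
  \<comment> \<open>The summation variables are chosen so that the plain factors depend on one
    variable each and the weighted factor alone contains \<open>n\<close>, the form required by
    \<open>conv_sq_le\<close>.\<close>
  have T1: "T (X a) (B b) (B c) n = nsum (\<lambda>q. (case q of (x, y) \<Rightarrow> B c x * B b y) * X a (n - fst q + snd q))" for n
  proof -
    have "bij (\<lambda>(p, r). (n - p + r, r))" by (rule bij_selfinv) auto
    from nn_sum_bij[OF this, of "\<lambda>q. (case q of (x, y) \<Rightarrow> B c x * B b y) * X a (n - fst q + snd q)"]
    show ?thesis unfolding T_def by (simp add: split_def ac_simps)
  qed
  have T2: "T (B a) (X b) (B c) n = nsum (\<lambda>q. (case q of (x, y) \<Rightarrow> B a x * B c y) * X b (fst q + snd q - n))" for n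
  proof -
    have "bij (\<lambda>(p, r). (p, n - p + r))" by (rule o_bij[of "\<lambda>(p, r). (p, r - n + p)"]) auto
    from nn_sum_bij[OF this, of "\<lambda>q. (case q of (x, y) \<Rightarrow> B a x * B c y) * X b (fst q + snd q - n)"]
    show ?thesis unfolding T_def by (simp add: split_def ac_simps)
  qed
  have T3: "T (B a) (B b) (X c) n = nsum (\<lambda>q. (case q of (x, y) \<Rightarrow> B a x * B b y) * X c (n - fst q + snd q))" for n
    unfolding T_def by (simp add: split_def ac_simps)
  have b1: "bij (\<lambda>n. n - fst q + snd q)" and b2: "bij (\<lambda>n. fst q + snd q - n)" for q :: "int \<times> int"
    using bij_int_shift(1)[of "snd q - fst q"] bij_int_shift(2)[of "fst q + snd q"] by (simp_all add: algebra_simps)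
  have S: "nsum (\<lambda>n. (T (X a) (B b) (B c) n)\<^sup>2) \<le> ennreal (P ^ 4 * Z)"
    "nsum (\<lambda>n. (T (B a) (X b) (B c) n)\<^sup>2) \<le> ennreal (P ^ 4 * Z)"
    "nsum (\<lambda>n. (T (B a) (B b) (X c) n)\<^sup>2) \<le> ennreal (P ^ 4 * Z)"
    unfolding T1 T2 T3 by (intro key b1 b2; simp)+
  have pt: "X (cub a b c) n \<le> K * (T (X a) (B b) (B c) n + T (B a) (X b) (B c) n + T (B a) (B b) (X c) n)" for n
  proof -
    have "X (cub a b c) n = ennreal (jw \<sigma> n) * ennreal (cmod (cub a b c n))"
      by (simp add: X_def ennreal_mult)
    also have "\<dots> \<le> ennreal (jw \<sigma> n) * nsum (\<lambda>(p, r). B a p * B b r * B c (n - p + r))"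
      unfolding B_def by (intro mult_left_mono cub_le_nn) auto
    also have "\<dots> = nsum (\<lambda>q. ennreal (jw \<sigma> n) * (case q of (p, r) \<Rightarrow> B a p * B b r * B c (n - p + r)))"
      by (simp add: nn_integral_cmult)
    also have "\<dots> \<le> nsum (\<lambda>q. K * ((case q of (p, r) \<Rightarrow> X a p * B b r * B c (n - p + r))
       + (case q of (p, r) \<Rightarrow> B a p * X b r * B c (n - p + r))
       + (case q of (p, r) \<Rightarrow> B a p * B b r * X c (n - p + r))))"
    proof (rule nn_integral_mono, clarify)
      fix p r :: int
      have "jw \<sigma> n * (cmod (a p) * cmod (b r) * cmod (c (n - p + r)))
        \<le> 3 powr \<sigma> * (jw \<sigma> p + jw \<sigma> r + jw \<sigma> (n - p + r)) * (cmod (a p) * cmod (b r) * cmod (c (n - p + r)))"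
        by (intro mult_right_mono jw_sum3) (use assms in auto)
      then have "ennreal (jw \<sigma> n * (cmod (a p) * cmod (b r) * cmod (c (n - p + r))))
        \<le> ennreal (3 powr \<sigma> * ((jw \<sigma> p * cmod (a p)) * cmod (b r) * cmod (c (n - p + r))
           + cmod (a p) * (jw \<sigma> r * cmod (b r)) * cmod (c (n - p + r))
           + cmod (a p) * cmod (b r) * (jw \<sigma> (n - p + r) * cmod (c (n - p + r)))))"
        by (intro ennreal_leI) (simp add: algebra_simps)
      then show "ennreal (jw \<sigma> n) * (B a p * B b r * B c (n - p + r))
        \<le> K * (X a p * B b r * B c (n - p + r) + B a p * X b r * B c (n - p + r) + B a p * B b r * X c (n - p + r))"
        by (simp add: K_def B_def X_def flip: ennreal_plus ennreal_mult)
    qed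
    also have "\<dots> = K * (T (X a) (B b) (B c) n + T (B a) (X b) (B c) n + T (B a) (B b) (X c) n)"
      by (simp add: nn_integral_cmult nn_integral_add T_def)
    finally show ?thesis .
  qed
  have "hs_sq \<sigma> (cub a b c) \<le> nsum (\<lambda>n. K\<^sup>2 * (3 * ((T (X a) (B b) (B c) n)\<^sup>2 + (T (B a) (X b) (B c) n)\<^sup>2 + (T (B a) (B b) (X c) n)\<^sup>2)))"
    unfolding hsX
  proof (rule nn_integral_mono)
    fix n
    have "(X (cub a b c) n)\<^sup>2 \<le> (K * (T (X a) (B b) (B c) n + T (B a) (X b) (B c) n + T (B a) (B b) (X c) n))\<^sup>2"
      by (intro power_mono pt) auto
    also have "\<dots> \<le> K\<^sup>2 * (3 * ((T (X a) (B b) (B c) n)\<^sup>2 + (T (B a) (X b) (B c) n)\<^sup>2 + (T (B a) (B b) (X c) n)\<^sup>2))"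
      unfolding power_mult_distrib by (intro mult_left_mono ennreal_sq_sum3) auto
    finally show "(X (cub a b c) n)\<^sup>2 \<le> K\<^sup>2 * (3 * ((T (X a) (B b) (B c) n)\<^sup>2 + (T (B a) (X b) (B c) n)\<^sup>2 + (T (B a) (B b) (X c) n)\<^sup>2))" .
  qed
  also have "\<dots> = K\<^sup>2 * (3 * (nsum (\<lambda>n. (T (X a) (B b) (B c) n)\<^sup>2)
     + nsum (\<lambda>n. (T (B a) (X b) (B c) n)\<^sup>2) + nsum (\<lambda>n. (T (B a) (B b) (X c) n)\<^sup>2)))"
    by (simp add: nn_integral_cmult nn_integral_add)
  also have "\<dots> \<le> K\<^sup>2 * (3 * (ennreal (P ^ 4 * Z) + ennreal (P ^ 4 * Z) + ennreal (P ^ 4 * Z)))"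
    by (intro mult_left_mono add_mono S) auto
  also have "\<dots> = ennreal (9 * (3 powr \<sigma>)\<^sup>2 * P ^ 4 * Z)"
  proof -
    have "3 * ennreal y = ennreal (3 * y)" if "y \<ge> 0" for y
      using that by (simp add: ennreal_mult)
    moreover have "ennreal (P ^ 4 * Z) + ennreal (P ^ 4 * Z) + ennreal (P ^ 4 * Z) = ennreal (3 * (P ^ 4 * Z))"
      using assms by (simp flip: ennreal_plus)
    ultimately show ?thesis
      using assms by (simp add: K_def ennreal_power flip: ennreal_mult)
  qed
  finally show ?thesis .
qed

text \<open>The weight is split as a product and not as a sum: the coefficients of the potential
  decay fast enough to carry a full weight of their own, and what remains is Young's
  inequality.\<close>

lemma hs_sq_lin:
  fixes L Z :: real
  assumes "\<sigma> \<ge> 0" "L \<ge> 0" "Z \<ge> 0"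
    and l: "nsum (\<lambda>k. ennreal (jw \<sigma> k * cmod (l k))) \<le> ennreal L"
    and hs: "hs_sq \<sigma> a \<le> ennreal Z"
  shows "hs_sq \<sigma> (lin l a) \<le> ennreal ((2 powr \<sigma>)\<^sup>2 * L\<^sup>2 * Z)"
proof -
  define X where "X = (\<lambda>(b :: int \<Rightarrow> complex) n. ennreal (jw \<sigma> n * cmod (b n)))"
  define K where "K = ennreal (2 powr \<sigma>)"
  have hsX: "hs_sq \<sigma> d = nsum (\<lambda>n. (X d n)\<^sup>2)" for d
    by (simp add: hs_sq_def X_def ennreal_power)
  have pt: "X (lin l a) n \<le> K * nsum (\<lambda>k. X l k * X a (n - k))" for n
  proof -
    have "X (lin l a) n = ennreal (jw \<sigma> n) * ennreal (cmod (lin l a n))"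
      by (simp add: X_def ennreal_mult)
    also have "\<dots> \<le> ennreal (jw \<sigma> n) * nsum (\<lambda>m. ennreal (cmod (l (n - m))) * ennreal (cmod (a m)))"
      by (intro mult_left_mono lin_le_nn) auto
    also have "\<dots> = nsum (\<lambda>m. ennreal (jw \<sigma> n) * (ennreal (cmod (l (n - m))) * ennreal (cmod (a m))))"
      by (simp add: nn_integral_cmult)
    also have "\<dots> \<le> nsum (\<lambda>m. K * (X l (n - m) * X a m))"
    proof (rule nn_integral_mono)
      fix m
      have "jw \<sigma> n * (cmod (l (n - m)) * cmod (a m)) \<le> 2 powr \<sigma> * jw \<sigma> (n - m) * jw \<sigma> m * (cmod (l (n - m)) * cmod (a m))"
        by (intro mult_right_mono) (use jw_add[OF assms(1), of "n - m" m] in auto)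
      then have "ennreal (jw \<sigma> n * (cmod (l (n - m)) * cmod (a m)))
         \<le> ennreal (2 powr \<sigma> * ((jw \<sigma> (n - m) * cmod (l (n - m))) * (jw \<sigma> m * cmod (a m))))"
        by (intro ennreal_leI) (simp add: algebra_simps)
      then show "ennreal (jw \<sigma> n) * (ennreal (cmod (l (n - m))) * ennreal (cmod (a m))) \<le> K * (X l (n - m) * X a m)"
        by (simp add: K_def X_def flip: ennreal_mult)
    qed
    also have "\<dots> = K * nsum (\<lambda>m. X l (n - m) * X a m)"
      by (simp add: nn_integral_cmult)
    also have "nsum (\<lambda>m. X l (n - m) * X a m) = nsum (\<lambda>k. X l k * X a (n - k))"
      using nn_sum_bij[OF bij_int_shift(2)[of n], of "\<lambda>k. X l k * X a (n - k)"] by simp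
    finally show ?thesis .
  qed
  have "hs_sq \<sigma> (lin l a) \<le> nsum (\<lambda>n. (K * nsum (\<lambda>k. X l k * X a (n - k)))\<^sup>2)"
    unfolding hsX by (intro nn_integral_mono power_mono pt) auto
  also have "\<dots> = K\<^sup>2 * nsum (\<lambda>n. (nsum (\<lambda>k. X l k * X a (n - k)))\<^sup>2)"
    by (simp add: power_mult_distrib nn_integral_cmult)
  also have "\<dots> \<le> K\<^sup>2 * ((nsum (\<lambda>k. X l k))\<^sup>2 * nsum (\<lambda>n. (X a n)\<^sup>2))"
    by (intro mult_left_mono conv_sq_le bij_int_shift) auto
  also have "\<dots> \<le> K\<^sup>2 * ((ennreal L)\<^sup>2 * ennreal Z)"
    by (intro mult_left_mono mult_mono power_mono) (use l hs hsX in \<open>auto simp: X_def\<close>)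
  also have "\<dots> = ennreal ((2 powr \<sigma>)\<^sup>2 * L\<^sup>2 * Z)"
    using assms by (simp add: K_def ennreal_power mult.assoc flip: ennreal_mult)
  finally show ?thesis .
qed

lemma japanese_nonneg [simp]: "japanese n \<ge> 0" and japanese_nonzero [simp]: "japanese n \<noteq> 0"
  using japanese_pos[of n] by linarith+

lemma hs_sq_add: "hs_sq \<sigma> (\<lambda>n. a n + b n) \<le> 2 * (hs_sq \<sigma> a + hs_sq \<sigma> b)"
proof -
  have "hs_sq \<sigma> (\<lambda>n. a n + b n)
    \<le> nsum (\<lambda>n. 2 * (ennreal ((jw \<sigma> n * cmod (a n))\<^sup>2) + ennreal ((jw \<sigma> n * cmod (b n))\<^sup>2)))"
    unfolding hs_sq_def
  proof (rule nn_integral_mono)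
    fix n
    have "(jw \<sigma> n * cmod (a n + b n))\<^sup>2 \<le> (jw \<sigma> n * cmod (a n) + jw \<sigma> n * cmod (b n))\<^sup>2"
      using mult_left_mono[OF norm_triangle_ineq[of "a n" "b n"], of "jw \<sigma> n"]
      by (intro power_mono) (auto simp: algebra_simps)
    also have "\<dots> \<le> 2 * ((jw \<sigma> n * cmod (a n))\<^sup>2 + (jw \<sigma> n * cmod (b n))\<^sup>2)"
      using sum_squares_bound[of "jw \<sigma> n * cmod (a n)" "jw \<sigma> n * cmod (b n)"] by (simp add: power2_sum)
    finally have "ennreal ((jw \<sigma> n * cmod (a n + b n))\<^sup>2) \<le> ennreal (2 * ((jw \<sigma> n * cmod (a n))\<^sup>2 + (jw \<sigma> n * cmod (b n))\<^sup>2))"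
      by (rule ennreal_leI)
    then show "ennreal ((jw \<sigma> n * cmod (a n + b n))\<^sup>2) \<le> 2 * (ennreal ((jw \<sigma> n * cmod (a n))\<^sup>2) + ennreal ((jw \<sigma> n * cmod (b n))\<^sup>2))"
      by (simp add: ennreal_mult)
  qed
  also have "\<dots> = 2 * (hs_sq \<sigma> a + hs_sq \<sigma> b)"
    by (simp add: nn_integral_cmult nn_integral_add hs_sq_def)
  finally show ?thesis .
qed

lemma l1_norm_add: "l1_norm (\<lambda>n. a n + b n) \<le> l1_norm a + l1_norm b"
proof -
  have "l1_norm (\<lambda>n. a n + b n) \<le> nsum (\<lambda>n. ennreal (cmod (a n)) + ennreal (cmod (b n)))"
    unfolding l1_norm_def by (intro nn_integral_mono) (simp add: norm_triangle_ineq flip: ennreal_plus)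
  then show ?thesis by (simp add: nn_integral_add l1_norm_def)
qed

lemma l1_norm_le_weighted:
  assumes "\<sigma> \<ge> 0" shows "l1_norm l \<le> nsum (\<lambda>k. ennreal (jw \<sigma> k * cmod (l k)))"
  unfolding l1_norm_def
proof (intro nn_integral_mono ennreal_leI)
  fix k show "cmod (l k) \<le> jw \<sigma> k * cmod (l k)"
    using mult_right_mono[OF jw_ge_1[OF assms, of k], of "cmod (l k)"] by simp
qed

lemma l1_nls_rhs:
  assumes "P \<ge> 0" "L \<ge> 0" "l1_norm a \<le> ennreal P" "l1_norm l \<le> ennreal L"
  shows "l1_norm (nls_rhs l a) \<le> ennreal (P ^ 3 + L * P)"
proof -
  have "l1_norm (nls_rhs l a) \<le> l1_norm (cub a a a) + l1_norm (lin l a)"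
    using l1_norm_add[of "cub a a a" "lin l a"] by (simp add: nls_rhs_def[abs_def])
  also have "\<dots> \<le> l1_norm a * l1_norm a * l1_norm a + l1_norm l * l1_norm a"
    by (intro add_mono l1_cub l1_lin)
  also have "\<dots> \<le> ennreal P * ennreal P * ennreal P + ennreal L * ennreal P"
    by (intro add_mono mult_mono) (use assms in auto)
  also have "\<dots> = ennreal (P ^ 3 + L * P)"
    using assms by (simp add: power3_eq_cube flip: ennreal_mult ennreal_plus)
  finally show ?thesis .
qed

text \<open>The estimate is tame: the square of the high norm enters linearly, with a constant built
  from l^1 bounds. This keeps the constants of the growth estimate independent of the H^s
  norm.\<close>

lemma hs_sq_nls_rhs:
  fixes P Z L :: real
  assumes "\<sigma> \<ge> 0" "P \<ge> 0" "L \<ge> 0" "Z \<ge> 0" "l1_norm a \<le> ennreal P" "hs_sq \<sigma> a \<le> ennreal Z"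
    and l: "nsum (\<lambda>k. ennreal (jw \<sigma> k * cmod (l k))) \<le> ennreal L"
  shows "hs_sq \<sigma> (nls_rhs l a) \<le> ennreal (18 * (3 powr \<sigma>)\<^sup>2 * (P ^ 4 + L\<^sup>2) * Z)"
proof -
  have "hs_sq \<sigma> (nls_rhs l a) \<le> 2 * (hs_sq \<sigma> (cub a a a) + hs_sq \<sigma> (lin l a))"
    using hs_sq_add[of \<sigma> "cub a a a" "lin l a"] by (simp add: nls_rhs_def[abs_def])
  also have "\<dots> \<le> 2 * (ennreal (9 * (3 powr \<sigma>)\<^sup>2 * P ^ 4 * Z) + ennreal ((2 powr \<sigma>)\<^sup>2 * L\<^sup>2 * Z))"
    using hs_sq_cub[of \<sigma> P Z a a a] hs_sq_lin[OF assms(1,3,4) l assms(6)] assms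
    by (intro mult_left_mono add_mono) auto
  also have "\<dots> = ennreal (2 * (9 * (3 powr \<sigma>)\<^sup>2 * P ^ 4 * Z + (2 powr \<sigma>)\<^sup>2 * L\<^sup>2 * Z))"
  proof -
    have "2 * (ennreal u + ennreal v) = ennreal (2 * (u + v))" if "u \<ge> 0" "v \<ge> 0" for u v
      using that by (simp add: ennreal_mult)
    then show ?thesis using assms by simp
  qed
  also have "\<dots> \<le> ennreal (18 * (3 powr \<sigma>)\<^sup>2 * (P ^ 4 + L\<^sup>2) * Z)"
  proof (rule ennreal_leI)
    have "(2 powr \<sigma>)\<^sup>2 \<le> 9 * (3 powr \<sigma>)\<^sup>2"
      using power_mono[OF powr_mono2[of \<sigma> 2 3] powr_ge_zero, of 2] zero_le_power2[of "3 powr \<sigma>"] assms(1)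
      by (smt (verit))
    then have "(2 powr \<sigma>)\<^sup>2 * (L\<^sup>2 * Z) \<le> 9 * (3 powr \<sigma>)\<^sup>2 * (L\<^sup>2 * Z)"
      by (rule mult_right_mono) (use assms in auto)
    then show "2 * (9 * (3 powr \<sigma>)\<^sup>2 * P ^ 4 * Z + (2 powr \<sigma>)\<^sup>2 * L\<^sup>2 * Z) \<le> 18 * (3 powr \<sigma>)\<^sup>2 * (P ^ 4 + L\<^sup>2) * Z"
      by (simp add: algebra_simps)
  qed
  finally show ?thesis .
qed

section \<open>Bilinear and diagonal bounds\<close>

definition bil_weight :: "real \<Rightarrow> int \<times> int \<Rightarrow> real" where
  "bil_weight \<sigma> = (\<lambda>(n, m). jw (2 * \<sigma>) n + jw (2 * \<sigma>) m)"

text \<open>Each of the two weights is at most a constant times the other one times that of n - m,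
  so both squares are dominated by the product of all three weights. The arithmetic-geometric mean
  separates \<open>a\<close> from \<open>b\<close>, and in each resulting sum one variable is
  free.\<close>

lemma bil_bound:
  fixes L Z :: real
  assumes "\<sigma> \<ge> 0" "L \<ge> 0" "Z \<ge> 0"
    and l: "nsum (\<lambda>k. ennreal (jw \<sigma> k * cmod (l k))) \<le> ennreal L"
    and hs: "hs_sq \<sigma> a \<le> ennreal Z" "hs_sq \<sigma> b \<le> ennreal Z"
  shows "nsum (\<lambda>(n, m). ennreal (bil_weight \<sigma> (n, m) * (cmod (l (n - m)) * cmod (a m) * cmod (b n))))
     \<le> ennreal (2 * 2 powr \<sigma> * L * Z)"
proof -
  define X where "X = (\<lambda>(b :: int \<Rightarrow> complex) n. ennreal ((jw \<sigma> n * cmod (b n))\<^sup>2))"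
  define Y where "Y = (\<lambda>n. ennreal (jw \<sigma> n * cmod (l n)))"
  define K where "K = 2 powr \<sigma>"
  have "nsum (\<lambda>(n, m). ennreal (bil_weight \<sigma> (n, m) * (cmod (l (n - m)) * cmod (a m) * cmod (b n))))
    \<le> nsum (\<lambda>x. ennreal K * ((case x of (n, m) \<Rightarrow> Y (n - m) * X a m) + (case x of (n, m) \<Rightarrow> Y (n - m) * X b n)))"
  proof (rule nn_integral_mono, clarify)
    fix n m :: int
    define x y z where "x = jw \<sigma> n" and "y = jw \<sigma> m" and "z = jw \<sigma> (n - m)"
    define A B Q where "A = cmod (a m)" and "B = cmod (b n)" and "Q = cmod (l (n - m))"
    have nn: "x \<ge> 0" "y \<ge> 0" "z \<ge> 0" "A \<ge> 0" "B \<ge> 0" "Q \<ge> 0"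
      by (auto simp: x_def y_def z_def A_def B_def Q_def)
    have "x \<le> K * y * z" using jw_add[OF assms(1), of m "n - m"] by (simp add: x_def y_def z_def K_def)
    then have 1: "x * x \<le> x * (K * y * z)" using nn by (intro mult_left_mono)
    have "y \<le> K * x * z"
      using jw_add[OF assms(1), of n "m - n"] japanese_minus[of "n - m"] by (simp add: x_def y_def z_def K_def)
    then have 2: "y * y \<le> y * (K * x * z)" using nn by (intro mult_left_mono)
    have "(x\<^sup>2 + y\<^sup>2) * (Q * A * B) \<le> (2 * K * z * x * y) * (Q * A * B)"
      by (intro mult_right_mono) (use 1 2 nn in \<open>auto simp: power2_eq_square algebra_simps\<close>)
    also have "\<dots> = K * (z * Q) * (2 * (y * A) * (x * B))" by (simp add: algebra_simps)
    also have "\<dots> \<le> K * (z * Q) * ((y * A)\<^sup>2 + (x * B)\<^sup>2)"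
      by (intro mult_left_mono sum_squares_bound) (use nn K_def in auto)
    finally have "ennreal ((x\<^sup>2 + y\<^sup>2) * (Q * A * B)) \<le> ennreal (K * ((z * Q) * (y * A)\<^sup>2 + (z * Q) * (x * B)\<^sup>2))"
      by (intro ennreal_leI) (simp add: algebra_simps)
    also have "\<dots> = ennreal K * (ennreal (z * Q) * ennreal ((y * A)\<^sup>2) + ennreal (z * Q) * ennreal ((x * B)\<^sup>2))"
      using nn by (simp add: K_def flip: ennreal_mult ennreal_plus)
    finally show "ennreal (bil_weight \<sigma> (n, m) * (cmod (l (n - m)) * cmod (a m) * cmod (b n)))
       \<le> ennreal K * (Y (n - m) * X a m + Y (n - m) * X b n)"
      by (simp add: bil_weight_def jw_double X_def Y_def flip: x_def y_def z_def A_def B_def Q_def)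
  qed
  also have "\<dots> = ennreal K * (nsum (\<lambda>(n, m). Y (n - m) * X a m) + nsum (\<lambda>(n, m). Y (n - m) * X b n))"
    by (simp add: nn_integral_cmult nn_integral_add)
  also have "nsum (\<lambda>(n, m). Y (n - m) * X a m) = nsum (\<lambda>n. Y n) * hs_sq \<sigma> a"
    by (subst nn_integral_snd_count_space[symmetric])
       (simp add: nn_integral_multc nn_sum_bij[OF bij_int_shift(4)] nn_integral_cmult hs_sq_def X_def)
  also have "nsum (\<lambda>(n, m). Y (n - m) * X b n) = nsum (\<lambda>n. Y n) * hs_sq \<sigma> b"
    by (subst nn_integral_fst_count_space[symmetric])
       (simp add: nn_integral_multc nn_sum_bij[OF bij_int_shift(2)] nn_integral_cmult hs_sq_def X_def)
  also have "ennreal K * (nsum (\<lambda>n. Y n) * hs_sq \<sigma> a + nsum (\<lambda>n. Y n) * hs_sq \<sigma> b)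
    \<le> ennreal K * (ennreal L * ennreal Z + ennreal L * ennreal Z)"
    by (intro mult_left_mono add_mono mult_mono hs) (use l in \<open>auto simp: Y_def\<close>)
  also have "\<dots> = ennreal (2 * 2 powr \<sigma> * L * Z)"
    using assms by (simp add: K_def flip: ennreal_mult ennreal_plus)
  finally show ?thesis .
qed

lemma quad1_bound:
  fixes Z :: real
  assumes "Z \<ge> 0" "hs_sq \<sigma> a \<le> ennreal Z" "hs_sq \<sigma> b \<le> ennreal Z"
  shows "nsum (\<lambda>n. ennreal (jw (2 * \<sigma>) n * (cmod (a n) * cmod (b n)))) \<le> ennreal (2 * Z)"
proof -
  have "nsum (\<lambda>n. ennreal (jw (2 * \<sigma>) n * (cmod (a n) * cmod (b n))))
    \<le> nsum (\<lambda>n. ennreal ((jw \<sigma> n * cmod (a n))\<^sup>2) + ennreal ((jw \<sigma> n * cmod (b n))\<^sup>2))"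
  proof (rule nn_integral_mono)
    fix n
    have "jw (2 * \<sigma>) n * (cmod (a n) * cmod (b n)) = (jw \<sigma> n * cmod (a n)) * (jw \<sigma> n * cmod (b n))"
      unfolding jw_double by (simp add: power2_eq_square)
    also have "\<dots> \<le> 2 * (jw \<sigma> n * cmod (a n)) * (jw \<sigma> n * cmod (b n))" by simp
    also have "\<dots> \<le> (jw \<sigma> n * cmod (a n))\<^sup>2 + (jw \<sigma> n * cmod (b n))\<^sup>2" by (rule sum_squares_bound)
    finally show "ennreal (jw (2 * \<sigma>) n * (cmod (a n) * cmod (b n))) \<le> ennreal ((jw \<sigma> n * cmod (a n))\<^sup>2) + ennreal ((jw \<sigma> n * cmod (b n))\<^sup>2)"
      by (simp add: ennreal_leI flip: ennreal_plus)
  qed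
  also have "\<dots> = hs_sq \<sigma> a + hs_sq \<sigma> b" by (simp add: nn_integral_add hs_sq_def)
  also have "\<dots> \<le> ennreal Z + ennreal Z" by (intro add_mono assms)
  also have "\<dots> = ennreal (2 * Z)" using assms by (simp flip: ennreal_plus)
  finally show ?thesis .
qed

section \<open>Embedding and interpolation of Sobolev spaces\<close>

lemma summ_inverse_japanese_sq: "summ (\<lambda>n. 1 / (japanese n)\<^sup>2)"
proof -
  have nat: "(\<lambda>n::nat. 1 / (1 + (real n)\<^sup>2)) summable_on UNIV"
  proof (rule norm_summable_imp_summable_on)
    have "summable (\<lambda>n::nat. 1 / (real n)\<^sup>2)"
      using inverse_power_summable[of 2, where 'a=real] by (simp add: inverse_eq_divide)
    then show "summable (\<lambda>n::nat. norm (1 / (1 + (real n)\<^sup>2)))"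
    proof (rule summable_comparison_test_ev[rotated])
      show "\<forall>\<^sub>F n in sequentially. norm (norm (1 / (1 + (real n)\<^sup>2))) \<le> 1 / (real n)\<^sup>2"
        using eventually_gt_at_top[of 0]
        by eventually_elim (simp add: field_simps add_pos_nonneg)
    qed
  qed
  have "(\<lambda>n. 1 / (japanese n)\<^sup>2) summable_on (range int)"
    using nat by (subst summable_on_reindex) (auto simp: o_def japanese_sq)
  moreover have "(\<lambda>n. 1 / (japanese n)\<^sup>2) summable_on (range (\<lambda>n. - int n))"
    using nat by (subst summable_on_reindex) (auto simp: o_def japanese_sq inj_on_def)
  ultimately have "(\<lambda>n. 1 / (japanese n)\<^sup>2) summable_on (range int \<union> range (\<lambda>n. - int n))"
    by (rule summable_on_union)
  also have "range int \<union> range (\<lambda>n. - int n) = UNIV"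
    by (auto simp: image_iff) (metis int_cases2)
  finally show ?thesis by (subst summ_iff_summable_on) auto
qed

text \<open>The square of the constant that Cauchy-Schwarz gives for the embedding of H^1 into the
  absolutely convergent Fourier series.\<close>

definition sob_const :: real where "sob_const = tsum (\<lambda>n. 1 / (japanese n)\<^sup>2)"

lemma sob_const_nonneg: "sob_const \<ge> 0"
  unfolding sob_const_def by (rule Bochner_Integration.integral_nonneg) auto

lemma l1_norm_sq_le: "(l1_norm a)\<^sup>2 \<le> ennreal sob_const * hs_sq 1 a"
proof -
  have "l1_norm a = nsum (\<lambda>n. ennreal (1 / japanese n) * ennreal (jw 1 n * cmod (a n)))"
    unfolding l1_norm_def
    by (intro nn_integral_cong) (simp flip: ennreal_mult)
  also have "\<dots>\<^sup>2 \<le> nsum (\<lambda>n. (ennreal (1 / japanese n))\<^sup>2) * nsum (\<lambda>n. (ennreal (jw 1 n * cmod (a n)))\<^sup>2)"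
    by (rule Cauchy_Schwarz_nn_integral) auto
  also have "nsum (\<lambda>n. (ennreal (1 / japanese n))\<^sup>2) = ennreal sob_const"
    unfolding sob_const_def
    by (subst nn_integral_eq_integral[symmetric])
       (auto simp: summ_inverse_japanese_sq ennreal_power less_imp_le power_divide)
  finally show ?thesis by (simp add: hs_sq_def ennreal_power less_imp_le)
qed

lemma l1_norm_le_sqrt:
  assumes "A \<ge> 0" "hs_sq 1 a \<le> ennreal A" shows "l1_norm a \<le> ennreal (sqrt (sob_const * A))"
proof -
  define q where "q = sqrt (sob_const * A)"
  have q: "q \<ge> 0" "q\<^sup>2 = sob_const * A"
    using assms(1) sob_const_nonneg unfolding q_def by auto
  have "(l1_norm a)\<^sup>2 \<le> ennreal sob_const * ennreal A"
    using l1_norm_sq_le[of a] mult_left_mono[OF assms(2), of "ennreal sob_const"] by (meson order_trans zero_le)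
  also have "\<dots> = ennreal (q\<^sup>2)"
    unfolding q(2) using assms(1) sob_const_nonneg by (intro ennreal_mult[symmetric])
  finally have *: "(l1_norm a)\<^sup>2 \<le> ennreal (q\<^sup>2)" .
  have "l1_norm a \<le> ennreal q"
  proof (cases "l1_norm a")
    case (real r)
    then have "r\<^sup>2 \<le> q\<^sup>2"
      using * by (simp add: ennreal_power)
    then have "r \<le> q" using q(1) by (rule power2_le_imp_le)
    then show ?thesis using real by (simp add: ennreal_leI)
  next
    case top
    then show ?thesis using * by (simp add: ennreal_power top_unique)
  qed
  then show ?thesis by (simp add: q_def)
qed

lemma hs_sq_mono: "\<sigma> \<le> \<tau> \<Longrightarrow> hs_sq \<sigma> a \<le> hs_sq \<tau> a"
  unfolding hs_sq_def by (intro nn_integral_mono ennreal_leI power_mono mult_right_mono jw_mono) auto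

text \<open>The frequencies are split at \<langle>n\<rangle>^2 = 1/\<delta>. Above, \<delta>
  \<langle>n\<rangle>^2 is at least 1 and may be inserted as a factor; below, the weight is at most
  its value at the threshold. The parameter stays free because it is used later for
  absorption.\<close>

lemma hs_sq_interpolate:
  assumes "\<delta> > 0" "s \<ge> 1"
  shows "hs_sq (s - 1) a \<le> ennreal \<delta> * hs_sq s a + ennreal (\<delta> powr (1 - s)) * hs_sq 0 a"
proof -
  have "hs_sq (s - 1) a \<le> nsum (\<lambda>n. ennreal \<delta> * ennreal ((jw s n * cmod (a n))\<^sup>2) + ennreal (\<delta> powr (1 - s)) * ennreal ((jw 0 n * cmod (a n))\<^sup>2))"
    unfolding hs_sq_def
  proof (rule nn_integral_mono)
    fix n
    define y where "y = (japanese n)\<^sup>2"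
    have y: "y > 0" by (simp add: y_def)
    have e: "(jw \<sigma> n)\<^sup>2 = y powr \<sigma>" for \<sigma>
      by (simp add: y_def power2_eq_square powr_mult)
    have "y powr (s - 1) \<le> \<delta> * y powr s + \<delta> powr (1 - s)"
    proof (cases "\<delta> * y \<ge> 1")
      case True
      have "y powr (s - 1) \<le> (\<delta> * y) * y powr (s - 1)"
        using mult_right_mono[OF True, of "y powr (s - 1)"] by simp
      also have "\<dots> = \<delta> * y powr s"
        using powr_mult_base[of y "s - 1"] y by (simp add: mult.assoc)
      finally show ?thesis using powr_ge_zero[of \<delta> "1 - s"] by linarith
    next
      case False
      then have "y \<le> 1 / \<delta>" using assms by (simp add: field_simps)
      then have "y powr (s - 1) \<le> (1 / \<delta>) powr (s - 1)"
        using y assms by (intro powr_mono2) auto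
      also have "(1 / \<delta>) powr (s - 1) = \<delta> powr (- (s - 1))"
        unfolding powr_minus_divide using assms by (simp add: powr_divide)
      finally have "y powr (s - 1) \<le> \<delta> powr (1 - s)" by (simp only: minus_diff_eq)
      moreover have "0 \<le> \<delta> * y powr s" using assms by (intro mult_nonneg_nonneg) auto
      ultimately show ?thesis by linarith
    qed
    then have "y powr (s - 1) * (cmod (a n))\<^sup>2 \<le> (\<delta> * y powr s + \<delta> powr (1 - s)) * (cmod (a n))\<^sup>2"
      by (rule mult_right_mono) auto
    then have "(jw (s - 1) n * cmod (a n))\<^sup>2 \<le> \<delta> * (jw s n * cmod (a n))\<^sup>2 + \<delta> powr (1 - s) * (jw 0 n * cmod (a n))\<^sup>2"
      unfolding power_mult_distrib e using y by (simp add: algebra_simps)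
    then show "ennreal ((jw (s - 1) n * cmod (a n))\<^sup>2) \<le> ennreal \<delta> * ennreal ((jw s n * cmod (a n))\<^sup>2) + ennreal (\<delta> powr (1 - s)) * ennreal ((jw 0 n * cmod (a n))\<^sup>2)"
      using assms by (simp add: ennreal_leI flip: ennreal_mult ennreal_plus)
  qed
  also have "\<dots> = ennreal \<delta> * hs_sq s a + ennreal (\<delta> powr (1 - s)) * hs_sq 0 a"
    unfolding hs_sq_def by (simp add: nn_integral_add nn_integral_cmult)
  finally show ?thesis .
qed

section \<open>Difference quotients of the weight\<close>

lemma jw_double_eq: "jw (2 * \<sigma>) n = (1 + (real_of_int n)\<^sup>2) powr \<sigma>"
  unfolding japanese_sq[symmetric] jw_double by (simp add: power2_eq_square powr_mult)

text \<open>The weight extended to real arguments, so that the mean value theorem applies.\<close>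

definition wfun :: "real \<Rightarrow> real \<Rightarrow> real" where "wfun s x = (1 + x\<^sup>2) powr s"

lemma one_plus_sq_pos: "1 + x\<^sup>2 > (0::real)"
  by (simp add: add_pos_nonneg)

lemma one_plus_sq_powr_deriv:
  "((\<lambda>x::real. (1 + x\<^sup>2) powr r) has_real_derivative r * (1 + x\<^sup>2) powr (r - 1) * (2 * x)) (at x within A)"
proof (rule DERIV_chain2[OF has_real_derivative_powr])
  show "((\<lambda>x::real. 1 + x\<^sup>2) has_real_derivative 2 * x) (at x within A)"
    by (auto intro!: derivative_eq_intros)
qed (rule one_plus_sq_pos)

lemma wfun_deriv: "(wfun s has_real_derivative 2 * s * x * (1 + x\<^sup>2) powr (s - 1)) (at x within A)"
  using one_plus_sq_powr_deriv[of s x A] by (simp add: wfun_def[abs_def] ac_simps)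

lemma wfun_deriv2: "((\<lambda>x. 2 * s * x * (1 + x\<^sup>2) powr (s - 1)) has_real_derivative
    2 * s * (1 + x\<^sup>2) powr (s - 1) + 4 * s * (s - 1) * x\<^sup>2 * (1 + x\<^sup>2) powr (s - 2)) (at x within A)"
proof -
  have 1: "((\<lambda>x. 2 * s * x) has_real_derivative 2 * s) (at x within A)"
    by (auto intro!: derivative_eq_intros)
  show ?thesis
    by (rule DERIV_cong[OF DERIV_mult[OF 1 one_plus_sq_powr_deriv]]) (simp add: power2_eq_square)
qed

text \<open>As x^2 \<le> 1 + x^2, both terms are bounded by multiples of (1 + x^2)^(s - 1), which
  increases with |x| because s \<ge> 1; the factors add up to 4 s^2 - 2 s.\<close>

lemma wfun_deriv2_bound:
  fixes s x R :: real
  assumes "s \<ge> 1" "\<bar>x\<bar> \<le> R"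
  shows "\<bar>2 * s * (1 + x\<^sup>2) powr (s - 1) + 4 * s * (s - 1) * x\<^sup>2 * (1 + x\<^sup>2) powr (s - 2)\<bar> \<le> 4 * s\<^sup>2 * (1 + R\<^sup>2) powr (s - 1)"
proof -
  have "x\<^sup>2 * (1 + x\<^sup>2) powr (s - 2) \<le> (1 + x\<^sup>2) * (1 + x\<^sup>2) powr (s - 2)"
    by (rule mult_right_mono) auto
  also have "\<dots> = (1 + x\<^sup>2) powr (s - 1)"
    using powr_mult_base[of "1 + x\<^sup>2" "s - 2"] one_plus_sq_pos[of x] by simp
  finally have 1: "x\<^sup>2 * (1 + x\<^sup>2) powr (s - 2) \<le> (1 + x\<^sup>2) powr (s - 1)" .
  have 2: "(1 + x\<^sup>2) powr (s - 1) \<le> (1 + R\<^sup>2) powr (s - 1)"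
    using assms abs_le_square_iff[of x R] one_plus_sq_pos[of x] by (intro powr_mono2) auto
  have "\<bar>2 * s * (1 + x\<^sup>2) powr (s - 1) + 4 * s * (s - 1) * x\<^sup>2 * (1 + x\<^sup>2) powr (s - 2)\<bar>
     = 2 * s * (1 + x\<^sup>2) powr (s - 1) + 4 * s * (s - 1) * (x\<^sup>2 * (1 + x\<^sup>2) powr (s - 2))"
    using assms by (simp add: mult.assoc)
  also have "\<dots> \<le> 2 * s * (1 + R\<^sup>2) powr (s - 1) + 4 * s * (s - 1) * (1 + R\<^sup>2) powr (s - 1)"
    using assms 1 2 by (intro add_mono mult_left_mono) auto
  also have "\<dots> = (4 * s\<^sup>2 - 2 * s) * (1 + R\<^sup>2) powr (s - 1)" by (simp add: algebra_simps power2_eq_square)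
  also have "\<dots> \<le> 4 * s\<^sup>2 * (1 + R\<^sup>2) powr (s - 1)"
    using assms by (intro mult_right_mono) auto
  finally show ?thesis .
qed

text \<open>The mean value theorem is used twice: for the difference over a step \<open>a\<close>,
  as a function of its base point, with increment \<open>b\<close>; and for the first derivative
  with increment \<open>a\<close>.\<close>

lemma wfun_double_difference:
  fixes a b c R s :: real
  assumes "s \<ge> 1" "\<bar>c\<bar> \<le> R" "\<bar>c + a\<bar> \<le> R" "\<bar>c + b\<bar> \<le> R" "\<bar>c + a + b\<bar> \<le> R"
  shows "\<bar>(wfun s (c + b + a) - wfun s (c + b)) - (wfun s (c + a) - wfun s c)\<bar>
     \<le> 4 * s\<^sup>2 * (1 + R\<^sup>2) powr (s - 1) * \<bar>a\<bar> * \<bar>b\<bar>"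
proof -
  define B where "B = 4 * s\<^sup>2 * (1 + R\<^sup>2) powr (s - 1)"
  define w' where "w' = (\<lambda>x. 2 * s * x * (1 + x\<^sup>2) powr (s - 1))"
  \<comment> \<open>The base points for which both ends of a step \<open>a\<close> stay in [-R, R].
    They form an interval, which gives the convexity needed below.\<close>
  define S where "S = {- R..R} \<inter> (\<lambda>x. x + a) -` {- R..R}"
  have "S = {max (-R) (-R-a) .. min R (R-a)}" by (auto simp: S_def)
  then have cS: "convex S" by simp
  have w'_lip: "norm (w' y - w' x) \<le> B * norm (y - x)" if "x \<in> {-R..R}" "y \<in> {-R..R}" for x y
    unfolding w'_def
  proof (rule field_differentiable_bound[OF _ wfun_deriv2])
    show "convex {-R..R}" by simp
    show "norm (2 * s * (1 + z\<^sup>2) powr (s - 1) + 4 * s * (s - 1) * z\<^sup>2 * (1 + z\<^sup>2) powr (s - 2)) \<le> B"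
      if "z \<in> {-R..R}" for z
      unfolding real_norm_def B_def using that by (intro wfun_deriv2_bound assms) auto
  qed (use that in auto)
  have "norm ((wfun s (c + b + a) - wfun s (c + b)) - (wfun s (c + a) - wfun s c)) \<le> (B * \<bar>a\<bar>) * norm ((c + b) - c)"
  proof (rule field_differentiable_bound[OF cS, of "\<lambda>x. wfun s (x + a) - wfun s x" "\<lambda>x. w' (x + a) - w' x"])
    show "((\<lambda>x. wfun s (x + a) - wfun s x) has_field_derivative w' (z + a) - w' z) (at z within S)" for z
      unfolding w'_def
    proof (rule DERIV_diff[OF _ wfun_deriv])
      have "((\<lambda>x. x + a) has_real_derivative 1) (at z within S)" by (auto intro!: derivative_eq_intros)
      from DERIV_chain2[OF wfun_deriv this]
      show "((\<lambda>x. wfun s (x + a)) has_real_derivative 2 * s * (z + a) * (1 + (z + a)\<^sup>2) powr (s - 1)) (at z within S)"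
        by simp
    qed
    show "norm (w' (z + a) - w' z) \<le> B * \<bar>a\<bar>" if "z \<in> S" for z
      using w'_lip[of z "z + a"] that by (auto simp: S_def)
  qed (use assms in \<open>auto simp: S_def algebra_simps\<close>)
  then show ?thesis by (simp add: B_def)
qed

section \<open>Quotients of weight differences by the phase\<close>

definition quad_phase :: "int \<times> int \<times> int \<Rightarrow> real" where
  "quad_phase = (\<lambda>(n, p, r). (real_of_int p)\<^sup>2 - (real_of_int r)\<^sup>2 + (real_of_int (n - p + r))\<^sup>2 - (real_of_int n)\<^sup>2)"

definition quad_diff :: "(int \<Rightarrow> real) \<Rightarrow> int \<times> int \<times> int \<Rightarrow> real" where
  "quad_diff w = (\<lambda>(n, p, r). w p - w r + w (n - p + r) - w n)"

text \<open>The frequencies form a degenerate parallelogram: with q as base point, n = q + a, r = q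
  + b and p = q + a + b. The alternating sum of the weights is a second difference with steps
  \<open>a\<close> and \<open>b\<close>, and the phase equals 2 a b. So the steps cancel, and what
  remains is the size of the second derivative of the weight.\<close>

lemma quad_diff_bound:
  assumes "s \<ge> 1"
  shows "\<bar>quad_diff (jw (2 * s)) x\<bar> \<le> 2 * s\<^sup>2 * quad_weight (s - 1) x * \<bar>quad_phase x\<bar>"
proof -
  obtain n p r where x: "x = (n, p, r)" by (cases x)
  define q where "q = n - p + r"
  define R where "R = max (max \<bar>real_of_int n\<bar> \<bar>real_of_int p\<bar>) (max \<bar>real_of_int r\<bar> \<bar>real_of_int q\<bar>)"
  define c a b where "c = real_of_int q" and "a = real_of_int p - real_of_int r" and "b = real_of_int r - real_of_int q"
  have e: "real_of_int p = c + a + b" "real_of_int r = c + b" "real_of_int n = c + a"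
    by (auto simp: c_def a_def b_def q_def)
  have w: "jw (2 * s) k = wfun s (real_of_int k)" for k by (simp add: jw_double_eq wfun_def)
  have "\<bar>quad_diff (jw (2 * s)) x\<bar> \<le> 4 * s\<^sup>2 * (1 + R\<^sup>2) powr (s - 1) * \<bar>a * b\<bar>"
  proof -
    have "\<bar>c\<bar> \<le> R" "\<bar>c + a\<bar> \<le> R" "\<bar>c + b\<bar> \<le> R" "\<bar>c + a + b\<bar> \<le> R"
      unfolding e(1)[symmetric] unfolding e(2,3)[symmetric] by (simp_all add: R_def c_def le_max_iff_disj)
    then have "\<bar>(wfun s (c + b + a) - wfun s (c + b)) - (wfun s (c + a) - wfun s c)\<bar>
       \<le> 4 * s\<^sup>2 * (1 + R\<^sup>2) powr (s - 1) * \<bar>a\<bar> * \<bar>b\<bar>"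
      by (rule wfun_double_difference[OF assms])
    moreover have "quad_diff (jw (2 * s)) x = (wfun s (c + b + a) - wfun s (c + b)) - (wfun s (c + a) - wfun s c)"
      by (simp add: x quad_diff_def w e add.commute add.left_commute flip: q_def c_def)
    ultimately show ?thesis by (simp add: abs_mult mult.assoc)
  qed
  also have "\<bar>a * b\<bar> = \<bar>quad_phase x\<bar> / 2"
  proof -
    have "quad_phase x = 2 * (a * b)"
      by (simp add: x quad_phase_def a_def b_def q_def power2_eq_square algebra_simps)
    then show ?thesis by simp
  qed
  also have "(1 + R\<^sup>2) powr (s - 1) \<le> quad_weight (s - 1) x"
  proof -
    have "R \<in> {\<bar>real_of_int n\<bar>, \<bar>real_of_int p\<bar>, \<bar>real_of_int r\<bar>, \<bar>real_of_int q\<bar>}"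
      unfolding R_def max_def by simp
    then have "(1 + R\<^sup>2) powr (s - 1) \<in> {jw (2 * (s - 1)) n, jw (2 * (s - 1)) p, jw (2 * (s - 1)) r, jw (2 * (s - 1)) q}"
      unfolding jw_double_eq by auto
    moreover have "jw (2 * (s - 1)) k \<ge> 0" for k by simp
    moreover have "quad_weight (s - 1) x = jw (2 * (s - 1)) p + jw (2 * (s - 1)) r + jw (2 * (s - 1)) q + jw (2 * (s - 1)) n"
      by (simp add: x quad_weight_def q_def)
    ultimately show ?thesis by (smt (verit) insertE singletonD)
  qed
  finally have "\<bar>quad_diff (jw (2 * s)) x\<bar> \<le> 4 * s\<^sup>2 * quad_weight (s - 1) x * (\<bar>quad_phase x\<bar> / 2)"
    by (simp add: mult_left_mono mult_right_mono)
  then show ?thesis by (simp add: ac_simps)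
qed

definition quad_quot :: "real \<Rightarrow> int \<times> int \<times> int \<Rightarrow> real" where
  "quad_quot s x = quad_diff (jw (2 * s)) x / quad_phase x"

text \<open>Where the phase vanishes, \<open>quad_diff_bound\<close> forces the difference of the
  weights to vanish too. The value 0 that division by zero gives to the quotient is therefore
  consistent, and no resonant terms survive.\<close>

lemma quad_quot_phase: "s \<ge> 1 \<Longrightarrow> quad_quot s x * quad_phase x = quad_diff (jw (2 * s)) x"
  using quad_diff_bound[of s x] by (auto simp: quad_quot_def)

lemma quad_quot_bound: "s \<ge> 1 \<Longrightarrow> \<bar>quad_quot s x\<bar> \<le> 2 * s\<^sup>2 * quad_weight (s - 1) x"
  using quad_diff_bound[of s x]
  by (cases "quad_phase x = 0") (auto simp: quad_quot_def field_simps quad_weight_def split: prod.splits intro!: add_nonneg_nonneg)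

definition bil_quot :: "real \<Rightarrow> int \<times> int \<Rightarrow> real" where
  "bil_quot s = (\<lambda>(n, m). (jw (2 * s) n - jw (2 * s) m) / ((real_of_int n)\<^sup>2 - (real_of_int m)\<^sup>2))"

lemma powr_diff_bound:
  fixes y z R s :: real
  assumes "s \<ge> 1" "0 \<le> y" "0 \<le> z" "y \<le> R" "z \<le> R"
  shows "\<bar>(1 + y) powr s - (1 + z) powr s\<bar> \<le> s * (1 + R) powr (s - 1) * \<bar>y - z\<bar>"
proof -
  have "norm ((1 + y) powr s - (1 + z) powr s) \<le> (s * (1 + R) powr (s - 1)) * norm (y - z)"
  proof (rule field_differentiable_bound[of "{0..R}" "\<lambda>x. (1 + x) powr s" "\<lambda>x. s * (1 + x) powr (s - 1)"])
    show "((\<lambda>x. (1 + x) powr s) has_field_derivative s * (1 + x) powr (s - 1)) (at x within {0..R})" if "x \<in> {0..R}" for x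
      using that by (auto intro!: derivative_eq_intros simp: powr_diff field_simps)
    show "norm (s * (1 + x) powr (s - 1)) \<le> s * (1 + R) powr (s - 1)" if "x \<in> {0..R}" for x
      using that assms by (auto intro!: mult_left_mono powr_mono2)
  qed (use assms in auto)
  then show ?thesis by simp
qed

text \<open>The weight depends on n through n^2 only, so the mean value theorem in the variable n^2
  produces the phase directly. The resonance m = - n is harmless because the weight is even.\<close>

lemma jw_diff_bound:
  assumes "s \<ge> 1"
  shows "\<bar>jw (2 * s) n - jw (2 * s) m\<bar> \<le> s * bil_weight (s - 1) (n, m) * \<bar>(real_of_int n)\<^sup>2 - (real_of_int m)\<^sup>2\<bar>"
proof -
  define R where "R = max ((real_of_int n)\<^sup>2) ((real_of_int m)\<^sup>2)"
  have "\<bar>jw (2 * s) n - jw (2 * s) m\<bar> \<le> s * (1 + R) powr (s - 1) * \<bar>(real_of_int n)\<^sup>2 - (real_of_int m)\<^sup>2\<bar>"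
    unfolding jw_double_eq by (rule powr_diff_bound) (use assms in \<open>auto simp: R_def\<close>)
  also have "(1 + R) powr (s - 1) \<le> bil_weight (s - 1) (n, m)"
    unfolding bil_weight_def prod.case jw_double_eq R_def max_def by auto
  finally show ?thesis using assms by (simp add: mult_left_mono mult_right_mono)
qed

lemma bil_quot_phase:
  "s \<ge> 1 \<Longrightarrow> bil_quot s (n, m) * ((real_of_int n)\<^sup>2 - (real_of_int m)\<^sup>2) = jw (2 * s) n - jw (2 * s) m"
  using jw_diff_bound[of s n m] by (auto simp: bil_quot_def)

lemma bil_quot_bound:
  assumes "s \<ge> 1" shows "\<bar>bil_quot s x\<bar> \<le> s * bil_weight (s - 1) x"
proof (cases x)
  case (Pair n m)
  define D where "D = (real_of_int n)\<^sup>2 - (real_of_int m)\<^sup>2"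
  show ?thesis
  proof (cases "D = 0")
    case True
    have "bil_weight (s - 1) x \<ge> 0" by (simp add: Pair bil_weight_def)
    then show ?thesis using True assms by (simp add: Pair bil_quot_def flip: D_def)
  next
    case False
    have "\<bar>bil_quot s x\<bar> = \<bar>jw (2 * s) n - jw (2 * s) m\<bar> / \<bar>D\<bar>"
      by (simp add: Pair bil_quot_def abs_divide flip: D_def)
    also have "\<dots> \<le> s * bil_weight (s - 1) x"
      using jw_diff_bound[OF assms, of n m] False unfolding D_def[symmetric] Pair
      by (subst pos_divide_le_eq) auto
    finally show ?thesis .
  qed
qed

section \<open>Modified energies\<close>

text \<open>Absolute summability and a bound for the sum in one predicate. It is stable under sums
  and scalar factors, so that both properties are carried along together.\<close>

definition sum_bd :: "('a \<Rightarrow> complex) \<Rightarrow> real \<Rightarrow> bool" where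
  "sum_bd f B \<longleftrightarrow> 0 \<le> B \<and> (nsum (\<lambda>x. ennreal (cmod (f x)))) \<le> ennreal B"

lemma sum_bd_summ: "sum_bd f B \<Longrightarrow> summ f"
  and sum_bd_norm: "sum_bd f B \<Longrightarrow> cmod (tsum f) \<le> B"
  unfolding sum_bd_def using norm_tsum_le[of f B] by auto

lemma sum_bd_mono: "sum_bd f B \<Longrightarrow> B \<le> B' \<Longrightarrow> sum_bd f B'"
  unfolding sum_bd_def using ennreal_leI order_trans by fastforce

lemma sum_bd_add:
  assumes "sum_bd f B" "sum_bd g C" shows "sum_bd (\<lambda>x. f x + g x) (B + C)"
proof -
  have "nsum (\<lambda>x. ennreal (cmod (f x + g x)))
     \<le> nsum (\<lambda>x. ennreal (cmod (f x)) + ennreal (cmod (g x)))"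
    by (intro nn_integral_mono) (simp add: norm_triangle_ineq flip: ennreal_plus)
  also have "\<dots> \<le> ennreal B + ennreal C"
    using assms by (simp add: nn_integral_add sum_bd_def add_mono)
  finally show ?thesis using assms by (simp add: sum_bd_def)
qed

lemma sum_bd_cmult:
  assumes "sum_bd f B" shows "sum_bd (\<lambda>x. c * f x) (cmod c * B)"
proof -
  have "nsum (\<lambda>x. ennreal (cmod (c * f x))) = ennreal (cmod c) * nsum (\<lambda>x. ennreal (cmod (f x)))"
    by (simp add: norm_mult ennreal_mult nn_integral_cmult)
  also have "\<dots> \<le> ennreal (cmod c) * ennreal B"
    using assms by (intro mult_left_mono) (auto simp: sum_bd_def)
  finally show ?thesis using assms by (simp add: sum_bd_def ennreal_mult)
qed

text \<open>The frequencies of a quadruple \<open>n\<^sub>1 - n\<^sub>2 + n\<^sub>3 - n\<^sub>4 = 0\<close> are encoded as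
  \<open>(n, p, r) = (n\<^sub>4, n\<^sub>1, n\<^sub>2)\<close>.\<close>

definition quad :: "(int \<Rightarrow> complex) \<Rightarrow> (int \<Rightarrow> complex) \<Rightarrow> (int \<Rightarrow> complex) \<Rightarrow> (int \<Rightarrow> complex)
    \<Rightarrow> int \<times> int \<times> int \<Rightarrow> complex" where
  "quad b1 b2 b3 b4 = (\<lambda>(n, p, r). b1 p * cnj (b2 r) * b3 (n - p + r) * cnj (b4 n))"

definition bil :: "(int \<Rightarrow> complex) \<Rightarrow> (int \<Rightarrow> complex) \<Rightarrow> (int \<Rightarrow> complex) \<Rightarrow> int \<times> int \<Rightarrow> complex" where
  "bil l c b = (\<lambda>(n, m). l (n - m) * c m * cnj (b n))"

text \<open>\<open>P\<close> bounds the norm under which convolution is submultiplicative,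
  \<open>Z\<close> the square of a Sobolev norm. Both are upper bounds and not exact values, so that
  a state and its forcing can share one class.\<close>

definition seq_bd :: "real \<Rightarrow> real \<Rightarrow> real \<Rightarrow> (int \<Rightarrow> complex) set" where
  "seq_bd \<sigma> P Z = {b. l1_norm b \<le> ennreal P \<and> hs_sq \<sigma> b \<le> ennreal Z}"

definition weighted_l1 :: "real \<Rightarrow> (int \<Rightarrow> complex) \<Rightarrow> ennreal" where
  "weighted_l1 \<sigma> l = nsum (\<lambda>k. ennreal (jw \<sigma> k * cmod (l k)))"

lemma sum_bd_weighted:
  assumes "C \<ge> 0" "B \<ge> 0" "\<And>x. \<bar>V x\<bar> \<le> C * W x"
    and B: "nsum (\<lambda>x. ennreal (W x * cmod (q x))) \<le> ennreal B"
  shows "sum_bd (\<lambda>x. of_real (V x) * q x) (C * B)"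
proof -
  have "nsum (\<lambda>x. ennreal (cmod (of_real (V x) * q x))) \<le> nsum (\<lambda>x. ennreal C * ennreal (W x * cmod (q x)))"
  proof (rule nn_integral_mono)
    fix x
    have "\<bar>V x\<bar> * cmod (q x) \<le> C * W x * cmod (q x)"
      by (intro mult_right_mono assms) auto
    then show "ennreal (cmod (of_real (V x) * q x)) \<le> ennreal C * ennreal (W x * cmod (q x))"
      using assms(1) by (simp add: norm_mult ennreal_leI mult.assoc flip: ennreal_mult')
  qed
  also have "\<dots> = ennreal C * nsum (\<lambda>x. ennreal (W x * cmod (q x)))"
    by (rule nn_integral_cmult) auto
  also have "\<dots> \<le> ennreal C * ennreal B"
    by (intro mult_left_mono B) auto
  finally show ?thesis using assms(1,2) by (simp add: sum_bd_def ennreal_mult')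
qed

lemma sum_bd_quad:
  assumes "\<sigma> \<ge> 0" "P \<ge> 0" "Z \<ge> 0" "C \<ge> 0" "\<And>x. \<bar>V x\<bar> \<le> C * quad_weight \<sigma> x"
    and b: "b1 \<in> seq_bd \<sigma> P Z" "b2 \<in> seq_bd \<sigma> P Z" "b3 \<in> seq_bd \<sigma> P Z" "b4 \<in> seq_bd \<sigma> P Z"
  shows "sum_bd (\<lambda>x. of_real (V x) * quad b1 b2 b3 b4 x) (C * (12 * 3 powr \<sigma> * Z * P\<^sup>2))"
proof (rule sum_bd_weighted)
  have "(\<lambda>x. ennreal (quad_weight \<sigma> x * cmod (quad b1 b2 b3 b4 x)))
    = (\<lambda>(n, p, r). ennreal (quad_weight \<sigma> (n, p, r) * (cmod (b1 p) * cmod (b2 r) * cmod (b3 (n - p + r)) * cmod (b4 n))))"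
    by (auto simp: quad_def norm_mult)
  then show "nsum (\<lambda>x. ennreal (quad_weight \<sigma> x * cmod (quad b1 b2 b3 b4 x))) \<le> ennreal (12 * 3 powr \<sigma> * Z * P\<^sup>2)"
    using quad_bound[of \<sigma> P Z b1 b2 b3 b4] assms by (auto simp: seq_bd_def)
qed (use assms in auto)

lemma sum_bd_bil:
  assumes "\<sigma> \<ge> 0" "L \<ge> 0" "Z \<ge> 0" "C \<ge> 0" "\<And>x. \<bar>V x\<bar> \<le> C * bil_weight \<sigma> x"
    and l: "weighted_l1 \<sigma> l \<le> ennreal L"
    and b: "b1 \<in> seq_bd \<sigma> P Z" "b2 \<in> seq_bd \<sigma> P Z"
  shows "sum_bd (\<lambda>x. of_real (V x) * bil l b1 b2 x) (C * (2 * 2 powr \<sigma> * L * Z))"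
proof (rule sum_bd_weighted)
  have "(\<lambda>x. ennreal (bil_weight \<sigma> x * cmod (bil l b1 b2 x)))
    = (\<lambda>(n, m). ennreal (bil_weight \<sigma> (n, m) * (cmod (l (n - m)) * cmod (b1 m) * cmod (b2 n))))"
    by (auto simp: bil_def norm_mult)
  then show "nsum (\<lambda>x. ennreal (bil_weight \<sigma> x * cmod (bil l b1 b2 x))) \<le> ennreal (2 * 2 powr \<sigma> * L * Z)"
    using bil_bound[of \<sigma> L Z l b1 b2] assms by (auto simp: seq_bd_def weighted_l1_def)
qed (use assms in auto)

lemma sum_bd_mode:
  assumes "Z \<ge> 0" "C \<ge> 0" "\<And>n. \<bar>w n\<bar> \<le> C * jw (2 * \<sigma>) n"
    and b: "b1 \<in> seq_bd \<sigma> P Z" "b2 \<in> seq_bd \<sigma> P Z"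
  shows "sum_bd (\<lambda>n. of_real (w n) * (b1 n * cnj (b2 n))) (C * (2 * Z))"
proof (rule sum_bd_weighted)
  show "nsum (\<lambda>n. ennreal (jw (2 * \<sigma>) n * cmod (b1 n * cnj (b2 n)))) \<le> ennreal (2 * Z)"
    using quad1_bound[of Z \<sigma> b1 b2] assms by (simp add: seq_bd_def norm_mult)
qed (use assms in auto)

lemma tsum_bij: "bij \<phi> \<Longrightarrow> tsum (\<lambda>x. f (\<phi> x)) = tsum f"
  for f :: "'b \<Rightarrow> 'c::{banach, second_countable_topology}"
  using integral_bij_count_space[of \<phi> UNIV UNIV f] by simp

lemma integral_cnj': "(\<integral>x. cnj (f x) \<partial>M) = cnj (\<integral>x. f x \<partial>M)"
  by (rule integral_bounded_linear'[OF bounded_linear_cnj bounded_linear_cnj]) simp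

text \<open>The two conjugated slots enter the relation between the frequencies with the same sign,
  so exchanging them is a change of summation variables.\<close>

lemma quad_swap24: "tsum (\<lambda>(n, p, r). of_real (w r) * quad a b c d (n, p, r))
    = tsum (\<lambda>(n, p, r). of_real (w n) * quad a d c b (n, p, r))"
  (is "tsum ?f = tsum ?g")
proof -
  have "bij (\<lambda>(n :: int, p :: int, r :: int). (r, p, n))" by (rule bij_selfinv) auto
  from tsum_bij[OF this, of ?f]
  show ?thesis by (simp add: split_def quad_def algebra_simps)
qed

text \<open>Exchanging conjugated with plain slots reverses all signs in the relation between the
  frequencies, which leaves it true, and conjugates the product. With the two companion lemmas a
  weight in any slot can be moved to slot \<open>n\<close>, up to conjugation.\<close>

lemma quad_swap_conj: "tsum (\<lambda>(n, p, r). of_real (w p) * quad a b c d (n, p, r))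
    = cnj (tsum (\<lambda>(n, p, r). of_real (w n) * quad d c b a (n, p, r)))"
  (is "tsum ?f = cnj (tsum ?g)")
proof -
  have "bij (\<lambda>(n :: int, p :: int, r :: int). (p, n, n - p + r))" by (rule bij_selfinv) auto
  from tsum_bij[OF this, of ?f]
  show ?thesis by (simp add: split_def quad_def algebra_simps flip: integral_cnj')
qed

lemma quad_swap_conj': "tsum (\<lambda>(n, p, r). of_real (w (n - p + r)) * quad a b c d (n, p, r))
    = cnj (tsum (\<lambda>(n, p, r). of_real (w n) * quad b a d c (n, p, r)))"
  (is "tsum ?f = cnj (tsum ?g)")
proof -
  have "bij (\<lambda>(n :: int, p :: int, r :: int). (n - p + r, r, p))" by (rule bij_selfinv) auto
  from tsum_bij[OF this, of ?f]
  show ?thesis by (simp add: split_def quad_def algebra_simps flip: integral_cnj')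
qed

text \<open>The hypothesis expresses that the potential is real-valued; it makes the bilinear form
  Hermitian.\<close>

lemma bil_swap:
  assumes "\<And>k. l (- k) = cnj (l k)"
  shows "tsum (\<lambda>(n, m). of_real (w m) * bil l a b (n, m)) = cnj (tsum (\<lambda>(n, m). of_real (w n) * bil l b a (n, m)))"
  (is "tsum ?f = cnj (tsum ?g)")
proof -
  have "bij (\<lambda>(n :: int, m :: int). (m, n))" by (rule bij_selfinv) auto
  from tsum_bij[OF this, of ?f]
  have "tsum ?f = tsum (\<lambda>x. ?f (case x of (n, m) \<Rightarrow> (m, n)))" by simp
  also have "(\<lambda>x. ?f (case x of (n, m) \<Rightarrow> (m, n))) = (\<lambda>x. cnj (?g x))"
  proof
    fix x :: "int \<times> int"
    obtain n m where x: "x = (n, m)" by (cases x)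
    have "l (m - n) = cnj (l (n - m))" using assms[of "n - m"] by simp
    then show "?f (case x of (n, m) \<Rightarrow> (m, n)) = cnj (?g x)" by (simp add: x bil_def)
  qed
  finally show ?thesis by (simp only: integral_cnj')
qed

lemma tsum_quad_cub:
  assumes "summ (\<lambda>x. of_real (w (fst x)) * quad b b b d x)"
  shows "tsum (\<lambda>(n, p, r). of_real (w n) * quad b b b d (n, p, r)) = tsum (\<lambda>n. of_real (w n) * (cub b b b n * cnj (d n)))"
    and "summ (\<lambda>n. of_real (w n) * (cub b b b n * cnj (d n)))"
proof -
  have e: "tsum (\<lambda>y. of_real (w (fst (n, y))) * quad b b b d (n, y)) = of_real (w n) * (cub b b b n * cnj (d n))" for n
  proof -
    have "(\<lambda>y. of_real (w (fst (n, y))) * quad b b b d (n, y))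
       = (\<lambda>y. (of_real (w n) * cnj (d n)) * (case y of (p, r) \<Rightarrow> b p * cnj (b r) * b (n - p + r)))"
      by (auto simp: quad_def fun_eq_iff)
    then show ?thesis by (simp add: cub_def)
  qed
  from tsum_pair(1,2)[OF assms]
  show "tsum (\<lambda>(n, p, r). of_real (w n) * quad b b b d (n, p, r)) = tsum (\<lambda>n. of_real (w n) * (cub b b b n * cnj (d n)))"
    and "summ (\<lambda>n. of_real (w n) * (cub b b b n * cnj (d n)))"
    unfolding e by (simp_all add: split_def)
qed

lemma tsum_bil_lin:
  assumes "summ (\<lambda>x. of_real (w (fst x)) * bil l b d x)"
  shows "tsum (\<lambda>(n, m). of_real (w n) * bil l b d (n, m)) = tsum (\<lambda>n. of_real (w n) * (lin l b n * cnj (d n)))"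
    and "summ (\<lambda>n. of_real (w n) * (lin l b n * cnj (d n)))"
proof -
  have e: "tsum (\<lambda>y. of_real (w (fst (n, y))) * bil l b d (n, y)) = of_real (w n) * (lin l b n * cnj (d n))" for n
  proof -
    have "(\<lambda>y. of_real (w (fst (n, y))) * bil l b d (n, y))
       = (\<lambda>m. (of_real (w n) * cnj (d n)) * (l (n - m) * b m))"
      by (auto simp: bil_def fun_eq_iff)
    then show ?thesis by (simp add: lin_def)
  qed
  from tsum_pair(1,2)[OF assms]
  show "tsum (\<lambda>(n, m). of_real (w n) * bil l b d (n, m)) = tsum (\<lambda>n. of_real (w n) * (lin l b n * cnj (d n)))"
    and "summ (\<lambda>n. of_real (w n) * (lin l b n * cnj (d n)))"
    unfolding e by (simp_all add: split_def)
qed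

text \<open>The factor 1/2 reflects that the derivative of |a_n|^2 has two terms while the
  alternating sum of the weights has four. With the weight \<open>jw 2\<close> and both multipliers
  1 this corresponds to mass + 2 energy, up to the factor 2 pi.\<close>

definition mod_energy :: "(int \<Rightarrow> complex) \<Rightarrow> (int \<Rightarrow> real) \<Rightarrow> (int \<times> int \<times> int \<Rightarrow> real) \<Rightarrow> (int \<times> int \<Rightarrow> real)
    \<Rightarrow> (int \<Rightarrow> complex) \<Rightarrow> complex" where
  "mod_energy l w K L b = tsum (\<lambda>n. of_real (w n) * (b n * cnj (b n)))
     + 1 / 2 * tsum (\<lambda>x. of_real (K x) * quad b b b b x) + tsum (\<lambda>x. of_real (L x) * bil l b b x)"

definition quad_var :: "(int \<times> int \<times> int \<Rightarrow> real) \<Rightarrow> (int \<Rightarrow> complex) \<Rightarrow> (int \<Rightarrow> complex) \<Rightarrow> int \<times> int \<times> int \<Rightarrow> complex" where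
  "quad_var K b g x = of_real (K x) * quad g b b b x + of_real (K x) * quad b g b b x
     + of_real (K x) * quad b b g b x + of_real (K x) * quad b b b g x"

definition bil_var :: "(int \<Rightarrow> complex) \<Rightarrow> (int \<times> int \<Rightarrow> real) \<Rightarrow> (int \<Rightarrow> complex) \<Rightarrow> (int \<Rightarrow> complex) \<Rightarrow> int \<times> int \<Rightarrow> complex" where
  "bil_var l L b g x = of_real (L x) * bil l g b x + of_real (L x) * bil l b g x"

text \<open>What is left of the time derivative once the free flow has cancelled: the correction
  forms with one slot at a time replaced by the nonlinear part \<open>g\<close> of the derivative of
  the state.\<close>

definition mod_energy_rate :: "(int \<Rightarrow> complex) \<Rightarrow> (int \<times> int \<times> int \<Rightarrow> real) \<Rightarrow> (int \<times> int \<Rightarrow> real)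
    \<Rightarrow> (int \<Rightarrow> complex) \<Rightarrow> complex" where
  "mod_energy_rate l K L b = (let g = (\<lambda>n. - \<i> * nls_rhs l b n) in
     1 / 2 * tsum (quad_var K b g) + tsum (bil_var l L b g))"

lemma sum_bd_quad_var:
  assumes "\<sigma> \<ge> 0" "P \<ge> 0" "Z \<ge> 0" "C \<ge> 0" "\<And>x. \<bar>V x\<bar> \<le> C * quad_weight \<sigma> x"
    and b: "b \<in> seq_bd \<sigma> P Z" "g \<in> seq_bd \<sigma> P Z"
  shows "sum_bd (quad_var V b g) (C * (48 * 3 powr \<sigma> * Z * P\<^sup>2))"
proof -
  note q = sum_bd_quad[OF assms(1-5)]
  show ?thesis
    unfolding quad_var_def[abs_def]
    by (rule sum_bd_mono[OF sum_bd_add[OF sum_bd_add[OF sum_bd_add[OF q q] q] q]]) (use b in auto)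
qed

lemma sum_bd_bil_var:
  assumes "\<sigma> \<ge> 0" "L \<ge> 0" "Z \<ge> 0" "C \<ge> 0" "\<And>x. \<bar>V x\<bar> \<le> C * bil_weight \<sigma> x"
    and l: "weighted_l1 \<sigma> l \<le> ennreal L"
    and b: "b \<in> seq_bd \<sigma> P Z" "g \<in> seq_bd \<sigma> P Z"
  shows "sum_bd (bil_var l V b g) (C * (4 * 2 powr \<sigma> * L * Z))"
  unfolding bil_var_def[abs_def]
  by (rule sum_bd_mono[OF sum_bd_add[OF sum_bd_bil[OF assms(1-6)] sum_bd_bil[OF assms(1-6)]]]) (use b in auto)

lemma jw_le_quad_weight: "jw (2 * \<sigma>) n \<le> quad_weight \<sigma> (n, p, r)" "jw (2 * \<sigma>) p \<le> quad_weight \<sigma> (n, p, r)"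
    "jw (2 * \<sigma>) r \<le> quad_weight \<sigma> (n, p, r)" "jw (2 * \<sigma>) (n - p + r) \<le> quad_weight \<sigma> (n, p, r)"
  by (auto simp: quad_weight_def intro!: add_nonneg_nonneg add_increasing add_increasing2)

lemma quad_weight_mono: "\<sigma> \<le> \<tau> \<Longrightarrow> quad_weight \<sigma> x \<le> quad_weight \<tau> x"
  by (cases x) (auto simp: quad_weight_def intro!: add_mono jw_mono)

lemma bil_weight_mono: "\<sigma> \<le> \<tau> \<Longrightarrow> bil_weight \<sigma> x \<le> bil_weight \<tau> x"
  by (cases x) (auto simp: bil_weight_def intro!: add_mono jw_mono)

text \<open>The weight has order 2 s but the multipliers only 2 s - 2; this gain makes the
  corrections and their rate of lower order. The last two conditions determine the multipliers
  wherever the phase does not vanish.\<close>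

locale mod_weights =
  fixes s :: real and w :: "int \<Rightarrow> real" and K :: "int \<times> int \<times> int \<Rightarrow> real" and L :: "int \<times> int \<Rightarrow> real" and C :: real
  assumes s: "s \<ge> 1" and C: "C \<ge> 0"
    and w: "\<And>n. \<bar>w n\<bar> \<le> C * jw (2 * s) n"
    and K: "\<And>x. \<bar>K x\<bar> \<le> C * quad_weight (s - 1) x"
    and L: "\<And>x. \<bar>L x\<bar> \<le> C * bil_weight (s - 1) x"
    and K_phase: "\<And>x. K x * quad_phase x = quad_diff w x"
    and L_phase: "\<And>n m. L (n, m) * ((real_of_int n)\<^sup>2 - (real_of_int m)\<^sup>2) = w n - w m"
begin

lemma K_s: "\<bar>K x\<bar> \<le> C * quad_weight s x"
  using K[of x] mult_left_mono[OF quad_weight_mono[of "s - 1" s x] C] by linarith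

lemma L_s: "\<bar>L x\<bar> \<le> C * bil_weight s x"
  using L[of x] mult_left_mono[OF bil_weight_mono[of "s - 1" s x] C] by linarith

lemma w_quad: "\<bar>w n\<bar> \<le> C * quad_weight s (n, p, r)" "\<bar>w p\<bar> \<le> C * quad_weight s (n, p, r)"
    "\<bar>w r\<bar> \<le> C * quad_weight s (n, p, r)" "\<bar>w (n - p + r)\<bar> \<le> C * quad_weight s (n, p, r)"
  by (rule order_trans[OF w]; intro mult_left_mono jw_le_quad_weight C)+

lemma w_bil: "\<bar>w n\<bar> \<le> C * bil_weight s (n, m)" "\<bar>w m\<bar> \<le> C * bil_weight s (n, m)"
  by (rule order_trans[OF w]; intro mult_left_mono C; simp add: bil_weight_def)+

end

definition bil_diff :: "(int \<Rightarrow> real) \<Rightarrow> int \<times> int \<Rightarrow> real" where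
  "bil_diff w = (\<lambda>(n, m). w n - w m)"

text \<open>The contributions in which the free flow acts cancel: this is how the multipliers
  \<open>K\<close> and \<open>L\<close> were chosen.\<close>

lemma (in mod_weights) resonance_cancel:
  assumes sym: "\<And>k. l (- k) = cnj (l k)" and l: "weighted_l1 s l \<le> ennreal \<Lambda>" and nn: "\<Lambda> \<ge> 0" "P \<ge> 0" "Z \<ge> 0"
    and b: "b \<in> seq_bd s P Z" "g \<in> seq_bd s P Z" and g: "g = (\<lambda>n. - \<i> * nls_rhs l b n)"
  shows "tsum (\<lambda>n. of_real (w n) * (g n * cnj (b n)) + of_real (w n) * (b n * cnj (g n)))
    + 1 / 2 * tsum (\<lambda>x. - \<i> * (of_real (quad_diff w x) * quad b b b b x))
    + tsum (\<lambda>x. \<i> * (of_real (bil_diff w x) * bil l b b x)) = 0"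
proof -
  have s0: "s \<ge> 0" using s by simp
  have sq: "summ (\<lambda>x. of_real (V x) * quad b b b b x)" if "\<And>x. \<bar>V x\<bar> \<le> C * quad_weight s x" for V
    using sum_bd_summ[OF sum_bd_quad[OF s0 nn(2,3) C that b(1) b(1) b(1) b(1)]] .
  have sb: "summ (\<lambda>x. of_real (V x) * bil l b b x)" if "\<And>x. \<bar>V x\<bar> \<le> C * bil_weight s x" for V
    using sum_bd_summ[OF sum_bd_bil[OF s0 nn(1,3) C that l b(1) b(1)]] .
  define Pq where "Pq = tsum (\<lambda>(n, p, r). of_real (w n) * quad b b b b (n, p, r))"
  define Pl where "Pl = tsum (\<lambda>(n, m). of_real (w n) * bil l b b (n, m))"
  have sq4: "summ (\<lambda>(n, p, r). of_real (w n) * quad b b b b (n, p, r))"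
      "summ (\<lambda>(n, p, r). of_real (w p) * quad b b b b (n, p, r))"
      "summ (\<lambda>(n, p, r). of_real (w r) * quad b b b b (n, p, r))"
      "summ (\<lambda>(n, p, r). of_real (w (n - p + r)) * quad b b b b (n, p, r))"
    using sq[of "\<lambda>(n, p, r). w n"] sq[of "\<lambda>(n, p, r). w p"] sq[of "\<lambda>(n, p, r). w r"] sq[of "\<lambda>(n, p, r). w (n - p + r)"]
    by (auto simp: split_def w_quad)
  have sb2: "summ (\<lambda>(n, m). of_real (w n) * bil l b b (n, m))" "summ (\<lambda>(n, m). of_real (w m) * bil l b b (n, m))"
    using sb[of "\<lambda>(n, m). w n"] sb[of "\<lambda>(n, m). w m"] by (auto simp: split_def w_bil)
  \<comment> \<open>The symmetries of the form move each of the four weights to slot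
    \<open>n\<close>: the conjugated slots \<open>n\<close> and \<open>r\<close> give
    \<open>Pq\<close>, the plain ones its conjugate.\<close>
  have quad: "tsum (\<lambda>x. of_real (quad_diff w x) * quad b b b b x) = 2 * cnj Pq - 2 * Pq"
  proof -
    define f1 f2 f3 f4 where "f1 = (\<lambda>(n, p, r). of_real (w n) * quad b b b b (n, p, r))"
      and "f2 = (\<lambda>(n, p, r). of_real (w p) * quad b b b b (n, p, r))"
      and "f3 = (\<lambda>(n, p, r). of_real (w r) * quad b b b b (n, p, r))"
      and "f4 = (\<lambda>(n, p, r). of_real (w (n - p + r)) * quad b b b b (n, p, r))"
    have s4: "summ f1" "summ f2" "summ f3" "summ f4"
      using sq4 by (simp_all only: f1_def f2_def f3_def f4_def)
    have t4: "tsum f1 = Pq" "tsum f2 = cnj Pq" "tsum f3 = Pq" "tsum f4 = cnj Pq"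
      using quad_swap_conj[of w b b b b] quad_swap24[of w b b b b] quad_swap_conj'[of w b b b b]
      by (simp_all only: f1_def f2_def f3_def f4_def Pq_def)
    have "(\<lambda>x. of_real (quad_diff w x) * quad b b b b x) = (\<lambda>x. f2 x - f3 x + f4 x - f1 x)"
      by (auto simp: fun_eq_iff quad_diff_def f1_def f2_def f3_def f4_def algebra_simps)
    then have "tsum (\<lambda>x. of_real (quad_diff w x) * quad b b b b x) = cnj Pq - Pq + cnj Pq - Pq"
      using s4 t4 by simp
    then show ?thesis by simp
  qed
  have bil: "tsum (\<lambda>x. of_real (bil_diff w x) * bil l b b x) = Pl - cnj Pl"
  proof -
    define f1 f2 where "f1 = (\<lambda>(n, m). of_real (w n) * bil l b b (n, m))"
      and "f2 = (\<lambda>(n, m). of_real (w m) * bil l b b (n, m))"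
    have s2: "summ f1" "summ f2" using sb2 by (simp_all only: f1_def f2_def)
    have t2: "tsum f1 = Pl" "tsum f2 = cnj Pl"
      using bil_swap[of l w b b, OF sym] by (simp_all only: f1_def f2_def Pl_def)
    have "(\<lambda>x. of_real (bil_diff w x) * bil l b b x) = (\<lambda>x. f1 x - f2 x)"
      by (auto simp: fun_eq_iff bil_diff_def f1_def f2_def algebra_simps)
    then show ?thesis using s2 t2 by simp
  qed
  have cq: "Pq = tsum (\<lambda>n. of_real (w n) * (cub b b b n * cnj (b n)))" "summ (\<lambda>n. of_real (w n) * (cub b b b n * cnj (b n)))"
    using tsum_quad_cub[of w b b] sq4(1) by (auto simp: Pq_def split_def)
  have cl: "Pl = tsum (\<lambda>n. of_real (w n) * (lin l b n * cnj (b n)))" "summ (\<lambda>n. of_real (w n) * (lin l b n * cnj (b n)))"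
    using tsum_bil_lin[of w l b b] sb2(1) by (auto simp: Pl_def split_def)
  define q where "q = (\<lambda>n. of_real (w n) * (nls_rhs l b n * cnj (b n)))"
  have q: "summ q" "tsum q = Pq + Pl"
  proof -
    have "q = (\<lambda>n. of_real (w n) * (cub b b b n * cnj (b n)) + of_real (w n) * (lin l b n * cnj (b n)))"
      by (auto simp: q_def nls_rhs_def algebra_simps)
    then show "summ q" "tsum q = Pq + Pl" using cq cl by simp_all
  qed
  \<comment> \<open>The derivative of the quadratic part is twice the imaginary part of
    \<open>Pq + Pl\<close>. The other two sums give its negative, the quartic one thanks to the
    factor 1/2.\<close>
  have "tsum (\<lambda>n. of_real (w n) * (g n * cnj (b n)) + of_real (w n) * (b n * cnj (g n)))
      = tsum (\<lambda>n. - \<i> * q n + \<i> * cnj (q n))"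
    by (intro arg_cong[of _ _ tsum]) (auto simp: q_def g)
  also have "\<dots> = - \<i> * (Pq + Pl) + \<i> * cnj (Pq + Pl)"
    using q by (simp add: integral_cnj')
  finally have "tsum (\<lambda>n. of_real (w n) * (g n * cnj (b n)) + of_real (w n) * (b n * cnj (g n))) = - \<i> * (Pq + Pl) + \<i> * cnj (Pq + Pl)" .
  then show ?thesis
    unfolding integral_mult_right_zero quad bil by (simp add: algebra_simps)
qed

text \<open>With multipliers 1 the corrections are the Hamiltonian of the nonlinear part, whose
  gradient is the nonlinearity itself. The rate is thus twice the real part of the pairing
  \<open>Y + Y2\<close> of the nonlinearity with \<open>g\<close>. Since \<open>g\<close> is - i
  times the nonlinearity, this pairing is i times a real number.\<close>

lemma mod_energy_rate_canonical:
  assumes sym: "\<And>k. l (- k) = cnj (l k)" and l: "weighted_l1 s l \<le> ennreal \<Lambda>" and nn: "s \<ge> 0" "\<Lambda> \<ge> 0" "P \<ge> 0" "Z \<ge> 0"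
    and b: "b \<in> seq_bd s P Z" "(\<lambda>n. - \<i> * nls_rhs l b n) \<in> seq_bd s P Z"
  shows "mod_energy_rate l (\<lambda>_. 1) (\<lambda>_. 1) b = 0"
proof -
  define g where "g = (\<lambda>n. - \<i> * nls_rhs l b n)"
  have g: "g \<in> seq_bd s P Z" using b(2) by (simp add: g_def)
  have w1: "\<bar>1\<bar> \<le> 1 * quad_weight s x" "\<bar>1\<bar> \<le> 1 * bil_weight s y" for x y
    by (cases x; cases y; use jw_ge_1[of "2 * s"] nn(1) in \<open>auto simp: quad_weight_def bil_weight_def intro!: add_increasing2 add_nonneg_nonneg\<close>)+
  have sq: "summ (quad b1 b2 b3 b4)" if "b1 \<in> {b, g}" "b2 \<in> {b, g}" "b3 \<in> {b, g}" "b4 \<in> {b, g}" for b1 b2 b3 b4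
    using sum_bd_summ[OF sum_bd_quad[OF nn(1,3,4) zero_le_one, of "\<lambda>_. 1" b1 b2 b3 b4]] w1(1) that b g by auto
  have sb: "summ (bil l b1 b2)" if "b1 \<in> {b, g}" "b2 \<in> {b, g}" for b1 b2
    using sum_bd_summ[OF sum_bd_bil[OF nn(1,2,4) zero_le_one, of "\<lambda>_. 1" l b1 P b2]] w1(2) that b g l by auto
  define Y where "Y = tsum (quad b b b g)"
  define Y2 where "Y2 = tsum (bil l b g)"
  have e: "(\<lambda>(n, p, r). f (n, p, r)) = f" "(\<lambda>(n, m). h (n, m)) = h" for f :: "int \<times> int \<times> int \<Rightarrow> complex" and h :: "int \<times> int \<Rightarrow> complex"
    by auto
  have sw: "tsum (quad g b b b) = cnj Y" "tsum (quad b g b b) = Y" "tsum (quad b b g b) = cnj Y"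
    using quad_swap_conj[of "\<lambda>_. 1" g b b b] quad_swap24[of "\<lambda>_. 1" b g b b] quad_swap_conj'[of "\<lambda>_. 1" b b g b]
    by (simp_all add: Y_def e)
  have "tsum (quad_var (\<lambda>_. 1) b g) = cnj Y + Y + cnj Y + Y"
    unfolding quad_var_def[abs_def] using sq by (simp add: sw Y_def[symmetric])
  moreover have "tsum (bil_var l (\<lambda>_. 1) b g) = cnj Y2 + Y2"
    unfolding bil_var_def[abs_def] using sb bil_swap[of l "\<lambda>_. 1" g b, OF sym] by (simp add: Y2_def[symmetric] e)
  moreover have "Y = tsum (\<lambda>n. cub b b b n * cnj (g n))" "summ (\<lambda>n. cub b b b n * cnj (g n))"
    using tsum_quad_cub[of "\<lambda>_. 1" b g] sq[of b b b g] by (simp_all add: Y_def e)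
  moreover have "Y2 = tsum (\<lambda>n. lin l b n * cnj (g n))" "summ (\<lambda>n. lin l b n * cnj (g n))"
    using tsum_bil_lin[of "\<lambda>_. 1" l b g] sb[of b g] by (simp_all add: Y2_def e)
  moreover have "tsum (\<lambda>n. cub b b b n * cnj (g n) + lin l b n * cnj (g n)) = \<i> * of_real (tsum (\<lambda>n. (cmod (nls_rhs l b n))\<^sup>2))"
  proof -
    have "cub b b b n * cnj (g n) + lin l b n * cnj (g n) = \<i> * of_real ((cmod (nls_rhs l b n))\<^sup>2)" for n
      unfolding complex_norm_square by (simp add: g_def nls_rhs_def algebra_simps)
    then show ?thesis by (simp del: of_real_power)
  qed
  ultimately have "Y + Y2 = \<i> * of_real (tsum (\<lambda>n. (cmod (nls_rhs l b n))\<^sup>2))" by simp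
  then have "Y + Y2 + cnj (Y + Y2) = 0" by (metis add.right_inverse complex_cnj_complex_of_real complex_cnj_i complex_cnj_mult mult_minus_left)
  moreover have "mod_energy_rate l (\<lambda>_. 1) (\<lambda>_. 1) b = 1 / 2 * tsum (quad_var (\<lambda>_. 1) b g) + tsum (bil_var l (\<lambda>_. 1) b g)"
    by (simp add: mod_energy_rate_def g_def Let_def)
  ultimately show ?thesis
    using \<open>tsum (quad_var (\<lambda>_. 1) b g) = cnj Y + Y + cnj Y + Y\<close> \<open>tsum (bil_var l (\<lambda>_. 1) b g) = cnj Y2 + Y2\<close>
    by (simp add: algebra_simps)
qed

section \<open>Growth for the system of Fourier coefficients\<close>

text \<open>All that the growth argument uses of a solution: one scalar equation for each
  coefficient with continuous forcing, boundedness in H^s on compact time intervals, and a real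
  potential with weighted summable coefficients.\<close>

locale nls_coeffs =
  fixes l :: "int \<Rightarrow> complex" and s :: real and a :: "real \<Rightarrow> int \<Rightarrow> complex" and \<Lambda> :: real
  assumes s: "s \<ge> 1"
    and l_sym: "\<And>k. l (- k) = cnj (l k)"
    and l_summ: "weighted_l1 s l \<le> ennreal \<Lambda>" and \<Lambda>: "\<Lambda> \<ge> 0"
    and deriv: "\<And>n t. ((\<lambda>t. a t n) has_vector_derivative
          - \<i> * (of_real ((real_of_int n)\<^sup>2) * a t n + nls_rhs l (a t) n)) (at t)"
    and cont_rhs: "\<And>n. continuous_on UNIV (\<lambda>t. nls_rhs l (a t) n)"
    and bdd: "\<And>T. \<exists>B. \<forall>t. \<bar>t\<bar> \<le> T \<longrightarrow> hs_sq s (a t) \<le> ennreal B"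
begin

definition "force t n = - \<i> * nls_rhs l (a t) n"

lemma weighted_l1_le: "\<sigma> \<le> s \<Longrightarrow> weighted_l1 \<sigma> l \<le> ennreal \<Lambda>"
  by (rule order_trans[OF _ l_summ])
     (auto simp: weighted_l1_def intro!: nn_integral_mono ennreal_leI mult_right_mono jw_mono)

lemma force_norms: "l1_norm (force t) = l1_norm (nls_rhs l (a t))" "hs_sq \<sigma> (force t) = hs_sq \<sigma> (nls_rhs l (a t))"
  by (simp_all add: l1_norm_def hs_sq_def force_def norm_mult)

text \<open>\<open>P'\<close> and \<open>Z'\<close> are the sums of the bounds for the state and for
  the forcing, so that one class contains both.\<close>

lemma seq_bd_state:
  assumes "0 \<le> \<sigma>" "\<sigma> \<le> s" "0 \<le> P" "0 \<le> Z" "a t \<in> seq_bd \<sigma> P Z"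
  defines "P' \<equiv> P + P ^ 3 + \<Lambda> * P" and "Z' \<equiv> (1 + 18 * (3 powr \<sigma>)\<^sup>2 * (P ^ 4 + \<Lambda>\<^sup>2)) * Z"
  shows "a t \<in> seq_bd \<sigma> P' Z'" "force t \<in> seq_bd \<sigma> P' Z'" "P \<le> P'" "Z \<le> Z'"
proof -
  show PP: "P \<le> P'" using assms \<Lambda> by simp
  have "1 * Z \<le> Z'" unfolding Z'_def by (rule mult_right_mono) (use assms in auto)
  then show ZZ: "Z \<le> Z'" by simp
  show "a t \<in> seq_bd \<sigma> P' Z'"
    using assms(5) PP ZZ by (auto simp: seq_bd_def intro: order_trans ennreal_leI)
  have l: "weighted_l1 \<sigma> l \<le> ennreal \<Lambda>" by (rule weighted_l1_le) fact
  have l0: "l1_norm l \<le> ennreal \<Lambda>"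
    using l1_norm_le_weighted[OF assms(1), of l] l by (auto simp: weighted_l1_def)
  have "l1_norm (force t) \<le> ennreal (P ^ 3 + \<Lambda> * P)"
    unfolding force_norms using assms(5) by (intro l1_nls_rhs assms \<Lambda> l0) (simp add: seq_bd_def)
  also have "\<dots> \<le> ennreal P'" using assms by (intro ennreal_leI) (simp add: P'_def)
  finally have 1: "l1_norm (force t) \<le> ennreal P'" .
  have "hs_sq \<sigma> (force t) \<le> ennreal (18 * (3 powr \<sigma>)\<^sup>2 * (P ^ 4 + \<Lambda>\<^sup>2) * Z)"
    unfolding force_norms using assms(5) l by (intro hs_sq_nls_rhs assms \<Lambda>) (simp_all add: seq_bd_def weighted_l1_def)
  also have "\<dots> \<le> ennreal Z'" using assms by (intro ennreal_leI) (simp add: Z'_def algebra_simps)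
  finally show "force t \<in> seq_bd \<sigma> P' Z'" using 1 by (simp add: seq_bd_def)
qed

lemma cont_a: "continuous_on A (\<lambda>t. a t n)"
  by (rule continuous_at_imp_continuous_on) (use deriv has_vector_derivative_continuous in blast)

lemma cont_force: "continuous_on A (\<lambda>t. force t n)"
  unfolding force_def by (intro continuous_intros continuous_on_subset[OF cont_rhs]) auto

lemma deriv_a: "((\<lambda>t. a t n) has_vector_derivative force t n - \<i> * of_real ((real_of_int n)\<^sup>2) * a t n) (at t within A)"
  using has_vector_derivative_at_within[OF deriv[of n t], of A] by (simp add: force_def algebra_simps)

lemma deriv_cnj_a: "((\<lambda>t. cnj (a t n)) has_vector_derivative cnj (force t n) + \<i> * of_real ((real_of_int n)\<^sup>2) * cnj (a t n)) (at t within A)"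
  using bounded_linear.has_vector_derivative[OF bounded_linear_cnj deriv_a[of n t A]] by simp

lemma deriv_mode: "((\<lambda>t. of_real c * (a t n * cnj (a t n))) has_vector_derivative
     of_real c * (force t n * cnj (a t n)) + of_real c * (a t n * cnj (force t n))) (at t within A)"
  by (rule has_vector_derivative_eq_rhs[OF has_vector_derivative_mult_right[OF has_vector_derivative_mult[OF deriv_a deriv_cnj_a]]])
     (simp add: algebra_simps)

text \<open>Under the free flow plain and conjugated factors rotate in opposite directions, so the
  squared frequencies enter only through their alternating sum, which multiplies the term. The same
  holds for four factors in \<open>deriv_quad\<close>.\<close>

lemma deriv_bil: "((\<lambda>t. of_real c * bil l (a t) (a t) (n, m)) has_vector_derivative
     \<i> * (of_real (c * ((real_of_int n)\<^sup>2 - (real_of_int m)\<^sup>2)) * bil l (a t) (a t) (n, m))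
      + (of_real c * bil l (force t) (a t) (n, m) + of_real c * bil l (a t) (force t) (n, m))) (at t within A)"
proof -
  have "((\<lambda>t. of_real c * (l (n - m) * (a t m * cnj (a t n)))) has_vector_derivative
     of_real c * (l (n - m) * (a t m * (cnj (force t n) + \<i> * of_real ((real_of_int n)\<^sup>2) * cnj (a t n))
       + (force t m - \<i> * of_real ((real_of_int m)\<^sup>2) * a t m) * cnj (a t n)))) (at t within A)"
    by (intro has_vector_derivative_mult_right has_vector_derivative_mult deriv_a deriv_cnj_a)
  then show ?thesis
    unfolding bil_def prod.case by (simp add: algebra_simps)
qed

lemma deriv_quad: "((\<lambda>t. of_real c * quad (a t) (a t) (a t) (a t) x) has_vector_derivative
     - \<i> * (of_real (c * quad_phase x) * quad (a t) (a t) (a t) (a t) x)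
      + (of_real c * quad (force t) (a t) (a t) (a t) x + of_real c * quad (a t) (force t) (a t) (a t) x
       + of_real c * quad (a t) (a t) (force t) (a t) x + of_real c * quad (a t) (a t) (a t) (force t) x)) (at t within A)"
proof -
  obtain n p r where x: "x = (n, p, r)" by (cases x)
  define q where "q = n - p + r"
  have "((\<lambda>t. of_real c * ((a t p * cnj (a t r)) * (a t q * cnj (a t n)))) has_vector_derivative
     of_real c * ((a t p * cnj (a t r)) * (a t q * (cnj (force t n) + \<i> * of_real ((real_of_int n)\<^sup>2) * cnj (a t n))
          + (force t q - \<i> * of_real ((real_of_int q)\<^sup>2) * a t q) * cnj (a t n))
       + (a t p * (cnj (force t r) + \<i> * of_real ((real_of_int r)\<^sup>2) * cnj (a t r))
          + (force t p - \<i> * of_real ((real_of_int p)\<^sup>2) * a t p) * cnj (a t r)) * (a t q * cnj (a t n)))) (at t within A)"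
    by (intro has_vector_derivative_mult_right has_vector_derivative_mult deriv_a deriv_cnj_a)
  then show ?thesis
    unfolding quad_def quad_phase_def x prod.case q_def[symmetric] by (simp add: algebra_simps)
qed

text \<open>By \<open>K_phase\<close> and \<open>L_phase\<close> the squared frequencies produced by
  the free flow combine to \<open>quad_diff w\<close> and \<open>bil_diff w\<close>, which have
  order 2 s. Hence \<open>tsum_has_integral\<close> applies to each of the three series with bounds
  in terms of the H^s norm.\<close>

theorem mod_energy_has_integral:
  assumes "mod_weights s w K L C" "t0 \<le> t1"
  shows "((\<lambda>t. mod_energy_rate l K L (a t)) has_integral
    (mod_energy l w K L (a t1) - mod_energy l w K L (a t0))) {t0..t1}"
proof -
  interpret W: mod_weights s w K L C by fact
  obtain Z0 where Z0: "\<And>t. \<bar>t\<bar> \<le> max \<bar>t0\<bar> \<bar>t1\<bar> \<Longrightarrow> hs_sq s (a t) \<le> ennreal Z0"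
    using bdd by blast
  define Z1 where "Z1 = max 0 Z0"
  define P1 where "P1 = sqrt (sob_const * Z1)"
  have nn1: "Z1 \<ge> 0" "P1 \<ge> 0" using sob_const_nonneg by (auto simp: Z1_def P1_def)
  define P Z where "P = P1 + P1 ^ 3 + \<Lambda> * P1" and "Z = (1 + 18 * (3 powr s)\<^sup>2 * (P1 ^ 4 + \<Lambda>\<^sup>2)) * Z1"
  have nn: "P \<ge> 0" "Z \<ge> 0" using nn1 \<Lambda> by (auto simp: P_def Z_def)
  have s0: "s \<ge> 0" using s by simp
  have bd: "a t \<in> seq_bd s P Z" "force t \<in> seq_bd s P Z" if "t \<in> {t0..t1}" for t
  proof -
    have "hs_sq s (a t) \<le> ennreal Z1"
      by (rule order_trans[OF Z0]) (use that in \<open>auto simp: Z1_def intro!: ennreal_leI\<close>)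
    moreover then have "l1_norm (a t) \<le> ennreal P1"
      unfolding P1_def using hs_sq_mono[OF s, of "a t"] by (intro l1_norm_le_sqrt nn1) simp
    ultimately have "a t \<in> seq_bd s P1 Z1" by (simp add: seq_bd_def)
    from seq_bd_state[OF s0 order_refl nn1(2,1) this]
    show "a t \<in> seq_bd s P Z" "force t \<in> seq_bd s P Z" by (simp_all add: P_def Z_def)
  qed
  have wq: "\<bar>quad_diff w x\<bar> \<le> (4 * C) * quad_weight s x" for x
  proof (cases x)
    case (fields n p r)
    show ?thesis unfolding fields using W.w_quad[where n = n and p = p and r = r] by (simp add: quad_diff_def)
  qed
  have wb: "\<bar>bil_diff w x\<bar> \<le> (2 * C) * bil_weight s x" for x
  proof (cases x)
    case (Pair n m)
    show ?thesis unfolding Pair using W.w_bil[of n m] W.w_bil[of m n] by (simp add: bil_diff_def)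
  qed
  have C4: "4 * C \<ge> 0" "2 * C \<ge> 0" using W.C by auto
  define g1 where "g1 = (\<lambda>n t. complex_of_real (w n) * (a t n * cnj (a t n)))"
  define g1' where "g1' = (\<lambda>n t. complex_of_real (w n) * (force t n * cnj (a t n)) + complex_of_real (w n) * (a t n * cnj (force t n)))"
  define g2 where "g2 = (\<lambda>x t. complex_of_real (K x) * quad (a t) (a t) (a t) (a t) x)"
  define g2' where "g2' = (\<lambda>x t. - \<i> * (of_real (quad_diff w x) * quad (a t) (a t) (a t) (a t) x) + quad_var K (a t) (force t) x)"
  define g3 where "g3 = (\<lambda>x t. complex_of_real (L x) * bil l (a t) (a t) x)"
  define g3' where "g3' = (\<lambda>x t. \<i> * (of_real (bil_diff w x) * bil l (a t) (a t) x) + bil_var l L (a t) (force t) x)"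
  have cq: "continuous_on {t0..t1} (\<lambda>t. c * quad (f1 t) (f2 t) (f3 t) (f4 t) x)"
    if "\<And>n. continuous_on {t0..t1} (\<lambda>t. f1 t n)" "\<And>n. continuous_on {t0..t1} (\<lambda>t. f2 t n)"
       "\<And>n. continuous_on {t0..t1} (\<lambda>t. f3 t n)" "\<And>n. continuous_on {t0..t1} (\<lambda>t. f4 t n)"
    for c f1 f2 f3 f4 x
    by (cases x) (auto simp: quad_def intro!: continuous_intros that continuous_on_cnj)
  have cb: "continuous_on {t0..t1} (\<lambda>t. c * bil l (f1 t) (f2 t) x)"
    if "\<And>n. continuous_on {t0..t1} (\<lambda>t. f1 t n)" "\<And>n. continuous_on {t0..t1} (\<lambda>t. f2 t n)" for c f1 f2 x
    by (cases x) (auto simp: bil_def intro!: continuous_intros that continuous_on_cnj)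
  define B1 where "B1 = C * (2 * Z) + C * (2 * Z)"
  define B2 where "B2 = cmod (- \<i>) * (4 * C * (12 * 3 powr s * Z * P\<^sup>2)) + C * (48 * 3 powr s * Z * P\<^sup>2)"
  define B3 where "B3 = cmod \<i> * (2 * C * (2 * 2 powr s * \<Lambda> * Z)) + C * (4 * 2 powr s * \<Lambda> * Z)"
  note ca = cont_a cont_force
  have S1: "sum_bd (\<lambda>n. g1 n t) (C * (2 * Z))" "sum_bd (\<lambda>n. g1' n t) B1" if t: "t \<in> {t0..t1}" for t
    unfolding g1_def g1'_def B1_def
    using sum_bd_mode[OF nn(2) W.C W.w bd(1)[OF t] bd(1)[OF t]]
      sum_bd_add[OF sum_bd_mode[OF nn(2) W.C W.w bd(2)[OF t] bd(1)[OF t]] sum_bd_mode[OF nn(2) W.C W.w bd(1)[OF t] bd(2)[OF t]]]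
    by simp_all
  have S2: "sum_bd (\<lambda>x. g2 x t) (C * (12 * 3 powr s * Z * P\<^sup>2))"
      "sum_bd (\<lambda>x. of_real (quad_diff w x) * quad (a t) (a t) (a t) (a t) x) (4 * C * (12 * 3 powr s * Z * P\<^sup>2))"
      "sum_bd (quad_var K (a t) (force t)) (C * (48 * 3 powr s * Z * P\<^sup>2))"
    if t: "t \<in> {t0..t1}" for t
    unfolding g2_def by (intro sum_bd_quad sum_bd_quad_var nn s0 W.C C4 W.K_s wq bd t)+
  have S2': "sum_bd (\<lambda>x. g2' x t) B2"
    if t: "t \<in> {t0..t1}" for t
    unfolding g2'_def B2_def by (intro sum_bd_add sum_bd_cmult S2 t)
  have S3: "sum_bd (\<lambda>x. g3 x t) (C * (2 * 2 powr s * \<Lambda> * Z))"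
      "sum_bd (\<lambda>x. of_real (bil_diff w x) * bil l (a t) (a t) x) (2 * C * (2 * 2 powr s * \<Lambda> * Z))"
      "sum_bd (bil_var l L (a t) (force t)) (C * (4 * 2 powr s * \<Lambda> * Z))"
    if t: "t \<in> {t0..t1}" for t
    unfolding g3_def by (rule sum_bd_bil[where P = P] sum_bd_bil_var[where P = P]; intro nn s0 \<Lambda> l_summ W.C C4 W.L_s wb bd t)+
  have S3': "sum_bd (\<lambda>x. g3' x t) B3"
    if t: "t \<in> {t0..t1}" for t
    unfolding g3'_def B3_def by (intro sum_bd_add sum_bd_cmult S3 t)
  have I1: "((\<lambda>t. tsum (\<lambda>n. g1' n t)) has_integral (tsum (\<lambda>n. g1 n t1) - tsum (\<lambda>n. g1 n t0))) {t0..t1}"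
  proof (rule tsum_has_integral[OF assms(2)])
    show "(g1 n has_vector_derivative g1' n t) (at t within {t0..t1})" for n t
      unfolding g1_def g1'_def by (rule deriv_mode)
    show "continuous_on {t0..t1} (g1' n)" for n
      unfolding g1'_def by (intro continuous_intros ca continuous_on_cnj)
    show "summ (\<lambda>x. g1 x t)" if "t \<in> {t0..t1}" for t
      using sum_bd_summ[OF S1(1)[OF that]] .
    show "nsum (\<lambda>x. ennreal (cmod (g1' x t))) \<le> ennreal B1" if "t \<in> {t0..t1}" for t
      using S1(2)[OF that] by (simp only: sum_bd_def)
  qed
  have I2: "((\<lambda>t. tsum (\<lambda>x. g2' x t)) has_integral (tsum (\<lambda>x. g2 x t1) - tsum (\<lambda>x. g2 x t0))) {t0..t1}"
  proof (rule tsum_has_integral[OF assms(2)])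
    show "(g2 x has_vector_derivative g2' x t) (at t within {t0..t1})" for x t
      unfolding g2_def g2'_def W.K_phase[symmetric] quad_var_def by (rule deriv_quad)
    show "continuous_on {t0..t1} (g2' x)" for x
      unfolding g2'_def quad_var_def by (intro continuous_intros cq ca)
    show "summ (\<lambda>x. g2 x t)" if "t \<in> {t0..t1}" for t
      using sum_bd_summ[OF S2(1)[OF that]] .
    show "nsum (\<lambda>x. ennreal (cmod (g2' x t))) \<le> ennreal B2" if "t \<in> {t0..t1}" for t
      using S2'[OF that] by (simp only: sum_bd_def)
  qed
  have I3: "((\<lambda>t. tsum (\<lambda>x. g3' x t)) has_integral (tsum (\<lambda>x. g3 x t1) - tsum (\<lambda>x. g3 x t0))) {t0..t1}"
  proof (rule tsum_has_integral[OF assms(2)])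
    show "(g3 x has_vector_derivative g3' x t) (at t within {t0..t1})" for x t
    proof (cases x)
      case (Pair n m)
      show ?thesis
        unfolding g3_def g3'_def bil_var_def Pair bil_diff_def prod.case W.L_phase[symmetric] by (rule deriv_bil)
    qed
    show "continuous_on {t0..t1} (g3' x)" for x
      unfolding g3'_def bil_var_def by (intro continuous_intros cb ca)
    show "summ (\<lambda>x. g3 x t)" if "t \<in> {t0..t1}" for t
      using sum_bd_summ[OF S3(1)[OF that]] .
    show "nsum (\<lambda>x. ennreal (cmod (g3' x t))) \<le> ennreal B3" if "t \<in> {t0..t1}" for t
      using S3'[OF that] by (simp only: sum_bd_def)
  qed
  have "((\<lambda>t. tsum (\<lambda>n. g1' n t) + 1 / 2 * tsum (\<lambda>x. g2' x t) + tsum (\<lambda>x. g3' x t)) has_integral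
     (tsum (\<lambda>n. g1 n t1) - tsum (\<lambda>n. g1 n t0)) + 1 / 2 * (tsum (\<lambda>x. g2 x t1) - tsum (\<lambda>x. g2 x t0))
      + (tsum (\<lambda>x. g3 x t1) - tsum (\<lambda>x. g3 x t0))) {t0..t1}"
    by (intro has_integral_add has_integral_mult_right I1 I2 I3)
  also have "(tsum (\<lambda>n. g1 n t1) - tsum (\<lambda>n. g1 n t0)) + 1 / 2 * (tsum (\<lambda>x. g2 x t1) - tsum (\<lambda>x. g2 x t0))
      + (tsum (\<lambda>x. g3 x t1) - tsum (\<lambda>x. g3 x t0)) = mod_energy l w K L (a t1) - mod_energy l w K L (a t0)"
    unfolding mod_energy_def g1_def g2_def g3_def by (simp add: algebra_simps)
  finally show ?thesis
  proof (rule has_integral_eq[rotated])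
    fix t assume t: "t \<in> {t0..t1}"
    have f: "force t = (\<lambda>n. - \<i> * nls_rhs l (a t) n)" by (simp add: force_def fun_eq_iff)
    \<comment> \<open>At each time the derivative of the quadratic part cancels against the parts
      with \<open>quad_diff\<close> and \<open>bil_diff\<close>; the remainder is the rate.\<close>
    have c: "tsum (\<lambda>n. g1' n t)
      + 1 / 2 * tsum (\<lambda>x. - \<i> * (of_real (quad_diff w x) * quad (a t) (a t) (a t) (a t) x))
      + tsum (\<lambda>x. \<i> * (of_real (bil_diff w x) * bil l (a t) (a t) x)) = 0"
      unfolding g1'_def using W.resonance_cancel[OF l_sym l_summ \<Lambda> nn bd(1)[OF t] bd(2)[OF t] f] .
    have e2: "tsum (\<lambda>x. g2' x t) = tsum (\<lambda>x. - \<i> * (of_real (quad_diff w x) * quad (a t) (a t) (a t) (a t) x)) + tsum (quad_var K (a t) (force t))"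
      unfolding g2'_def
      by (rule Bochner_Integration.integral_add[OF sum_bd_summ[OF sum_bd_cmult[OF S2(2)[OF t]]] sum_bd_summ[OF S2(3)[OF t]]])
    have e3: "tsum (\<lambda>x. g3' x t) = tsum (\<lambda>x. \<i> * (of_real (bil_diff w x) * bil l (a t) (a t) x)) + tsum (bil_var l L (a t) (force t))"
      unfolding g3'_def
      by (rule Bochner_Integration.integral_add[OF sum_bd_summ[OF sum_bd_cmult[OF S3(2)[OF t]]] sum_bd_summ[OF S3(3)[OF t]]])
    have r: "mod_energy_rate l K L (a t) = 1 / 2 * tsum (quad_var K (a t) (force t)) + tsum (bil_var l L (a t) (force t))"
      by (simp only: mod_energy_rate_def Let_def f)
    show "tsum (\<lambda>n. g1' n t) + 1 / 2 * tsum (\<lambda>x. g2' x t) + tsum (\<lambda>x. g3' x t) = mod_energy_rate l K L (a t)"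
      using c unfolding e2 e3 r by (simp add: algebra_simps)
  qed
qed

end

text \<open>The real-valued counterpart of \<open>hs_sq\<close>. It is 0 when the sum diverges, so
  it carries information only together with finiteness of \<open>hs_sq\<close>.\<close>

definition hs_val :: "real \<Rightarrow> (int \<Rightarrow> complex) \<Rightarrow> real" where
  "hs_val \<sigma> b = tsum (\<lambda>n. (jw \<sigma> n * cmod (b n))\<^sup>2)"

lemma hs_val_nonneg: "hs_val \<sigma> b \<ge> 0"
  unfolding hs_val_def by (rule Bochner_Integration.integral_nonneg) simp

lemma hs_sq_eq_val:
  assumes "hs_sq \<sigma> b < \<infinity>"
  shows "summ (\<lambda>n. (jw \<sigma> n * cmod (b n))\<^sup>2)" "hs_sq \<sigma> b = ennreal (hs_val \<sigma> b)"
proof -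
  show s: "summ (\<lambda>n. (jw \<sigma> n * cmod (b n))\<^sup>2)"
    using assms unfolding summ_iff hs_sq_def by simp
  show "hs_sq \<sigma> b = ennreal (hs_val \<sigma> b)"
    unfolding hs_sq_def hs_val_def by (rule nn_integral_eq_integral[OF s]) simp
qed

text \<open>\<open>2 * s\<^sup>2\<close> is the constant of the multipliers in
  \<open>growth_weights\<close>; 6 is half of the 12 in \<open>quad_bound\<close>, because of the
  factor 1/2 in \<open>mod_energy\<close>.\<close>

definition corr_const :: "real \<Rightarrow> real \<Rightarrow> real \<Rightarrow> real" where
  "corr_const s \<Lambda> P = 2 * s\<^sup>2 * (6 * 3 powr (s - 1) * P\<^sup>2 + 2 * 2 powr (s - 1) * \<Lambda>)"

text \<open>The factor after \<open>2 * s\<^sup>2\<close> is that of \<open>Z'\<close> in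
  \<open>seq_bd_state\<close>, and \<open>P + P ^ 3 + \<Lambda> * P\<close> is \<open>P'\<close>
  there. The 24 is half of the 48 in \<open>sum_bd_quad_var\<close>, which stands for four
  slots.\<close>

definition rate_const :: "real \<Rightarrow> real \<Rightarrow> real \<Rightarrow> real" where
  "rate_const s \<Lambda> P = 2 * s\<^sup>2 * (1 + 18 * (3 powr (s - 1))\<^sup>2 * (P ^ 4 + \<Lambda>\<^sup>2))
     * (24 * 3 powr (s - 1) * (P + P ^ 3 + \<Lambda> * P)\<^sup>2 + 4 * 2 powr (s - 1) * \<Lambda>)"

text \<open>The base of the power is \<open>2 * E\<close> with \<open>E\<close> as in the proof of
  \<open>growth\<close>. If \<open>A\<close> bounds the square of the H^1 norm, then
  \<open>sqrt (sob_const * A)\<close> bounds the l^1 norm of the coefficients.\<close>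

definition growth_const :: "real \<Rightarrow> real \<Rightarrow> real \<Rightarrow> real" where
  "growth_const s \<Lambda> A = 2 + (2 * (2 * corr_const s \<Lambda> (sqrt (sob_const * A)) + rate_const s \<Lambda> (sqrt (sob_const * A)) + 1)) powr s"

lemma norm_half_add_le: "cmod x \<le> B \<Longrightarrow> cmod y \<le> C \<Longrightarrow> cmod (1 / 2 * x + y) \<le> 1 / 2 * B + C"
  by (rule order_trans[OF norm_triangle_ineq]) (simp add: norm_mult)

context nls_coeffs
begin

lemma hs_fin: "\<sigma> \<le> s \<Longrightarrow> hs_sq \<sigma> (a t) < \<infinity>"
proof -
  assume "\<sigma> \<le> s"
  obtain B where "hs_sq s (a t) \<le> ennreal B" using bdd[of "\<bar>t\<bar>"] by auto
  then have "hs_sq \<sigma> (a t) \<le> ennreal B" using hs_sq_mono[OF \<open>\<sigma> \<le> s\<close>] order_trans by blast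
  then show ?thesis using ennreal_less_top le_less_trans by (metis infinity_ennreal_def)
qed

lemma const_of_rate_zero:
  assumes W: "mod_weights s w K L C" and 0: "\<And>t. mod_energy_rate l K L (a t) = 0"
  shows "mod_energy l w K L (a t) = mod_energy l w K L (a 0)"
proof -
  have "mod_energy l w K L (a t1) = mod_energy l w K L (a t0)" if "t0 \<le> t1" for t0 t1
    using mod_energy_has_integral[OF W that] unfolding 0
    by (metis eq_iff_diff_eq_0 has_integral_0 has_integral_unique)
  from this[of 0 t] this[of t 0] show ?thesis by (cases "0 \<le> t") auto
qed

lemma mass_const: "hs_val 0 (a t) = hs_val 0 (a 0)"
proof -
  have W: "mod_weights s (\<lambda>_. 1) (\<lambda>_. 0) (\<lambda>_. 0) 1"
    by unfold_locales (use s jw_ge_1 in \<open>auto simp: quad_diff_def quad_weight_def bil_weight_def intro!: add_nonneg_nonneg split: prod.splits\<close>)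
  have e: "mod_energy l (\<lambda>_. 1) (\<lambda>_. 0) (\<lambda>_. 0) (a t) = of_real (hs_val 0 (a t))" for t
    by (simp add: mod_energy_def hs_val_def complex_norm_square[symmetric] del: of_real_power flip: integral_complex_of_real)
  have "mod_energy_rate l (\<lambda>_. 0) (\<lambda>_. 0) (a t) = 0" for t
    by (simp add: mod_energy_rate_def quad_var_def[abs_def] bil_var_def[abs_def] Let_def)
  from const_of_rate_zero[OF W this, of t] show ?thesis unfolding e by simp
qed

lemma energy_const: "mod_energy l (jw 2) (\<lambda>_. 1) (\<lambda>_. 1) (a t) = mod_energy l (jw 2) (\<lambda>_. 1) (\<lambda>_. 1) (a 0)"
proof (rule const_of_rate_zero)
  show "mod_weights s (jw 2) (\<lambda>_. 1) (\<lambda>_. 1) 1"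
  proof
    show "\<bar>1\<bar> \<le> 1 * quad_weight (s - 1) x" "\<bar>1\<bar> \<le> 1 * bil_weight (s - 1) y" for x y
      by (cases x; cases y; use jw_ge_1[of "2 * (s - 1)"] s in \<open>auto simp: quad_weight_def bil_weight_def intro!: add_increasing2 add_nonneg_nonneg\<close>)+
    show "\<bar>jw 2 n\<bar> \<le> 1 * jw (2 * s) n" for n using jw_mono[of 2 "2 * s" n] s by simp
    show "1 * quad_phase x = quad_diff (jw 2) x" for x
      by (cases x) (simp add: quad_phase_def quad_diff_def jw_2)
    show "1 * ((real_of_int n)\<^sup>2 - (real_of_int m)\<^sup>2) = jw 2 n - jw 2 m" for n m
      by (simp add: jw_2)
  qed (use s in auto)
  \<comment> \<open>The rate is shown to vanish at each time separately, so the bounds used for it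
    may depend on \<open>t\<close>.\<close>
  fix t
  define Z1 where "Z1 = hs_val s (a t)"
  have Z1: "hs_sq s (a t) = ennreal Z1" "Z1 \<ge> 0"
    using hs_sq_eq_val(2)[OF hs_fin] hs_val_nonneg by (auto simp: Z1_def)
  define P1 where "P1 = sqrt (sob_const * Z1)"
  have P1: "P1 \<ge> 0" using sob_const_nonneg Z1 by (auto simp: P1_def)
  have "l1_norm (a t) \<le> ennreal P1"
    unfolding P1_def using hs_sq_mono[OF s, of "a t"] Z1 by (intro l1_norm_le_sqrt) auto
  then have "a t \<in> seq_bd s P1 Z1" using Z1 by (simp add: seq_bd_def)
  from seq_bd_state[OF _ order_refl P1 Z1(2) this] s
  have b: "a t \<in> seq_bd s (P1 + P1 ^ 3 + \<Lambda> * P1) ((1 + 18 * (3 powr s)\<^sup>2 * (P1 ^ 4 + \<Lambda>\<^sup>2)) * Z1)"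
    "force t \<in> seq_bd s (P1 + P1 ^ 3 + \<Lambda> * P1) ((1 + 18 * (3 powr s)\<^sup>2 * (P1 ^ 4 + \<Lambda>\<^sup>2)) * Z1)" by auto
  show "mod_energy_rate l (\<lambda>_. 1) (\<lambda>_. 1) (a t) = 0"
    by (rule mod_energy_rate_canonical[OF l_sym l_summ _ \<Lambda> _ _ b(1) b(2)[unfolded force_def[abs_def]]])
       (use s P1 Z1 \<Lambda> in auto)
qed

text \<open>A bound in H^1 uniform in time, to be supplied by conservation of mass and energy. From
  here on the constants depend on the solution through \<open>A\<close> alone.\<close>

context
  fixes A :: real
  assumes A: "A \<ge> 0" and H1: "\<And>t. hs_sq 1 (a t) \<le> ennreal A"
begin

definition "P = sqrt (sob_const * A)"

lemma P_nonneg: "P \<ge> 0"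
  using sob_const_nonneg A by (simp add: P_def)

text \<open>\<open>2 * s\<^sup>2\<close> is the constant of the quartic quotient; as s \<ge> 1, it
  also covers the constants s of the bilinear quotient and 1 of the weight.\<close>

lemma growth_weights: "mod_weights s (jw (2 * s)) (quad_quot s) (bil_quot s) (2 * s\<^sup>2)"
proof
  have s2: "1 \<le> 2 * s\<^sup>2" "s \<le> 2 * s\<^sup>2"
    using s mult_mono[of 1 s 1 s] mult_mono[of 1 s s s] by (auto simp: power2_eq_square)
  show "\<bar>jw (2 * s) n\<bar> \<le> 2 * s\<^sup>2 * jw (2 * s) n" for n
    using mult_right_mono[OF s2(1), of "jw (2 * s) n"] by simp
  show "\<bar>quad_quot s x\<bar> \<le> 2 * s\<^sup>2 * quad_weight (s - 1) x" for x by (rule quad_quot_bound[OF s])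
  show "\<bar>bil_quot s x\<bar> \<le> 2 * s\<^sup>2 * bil_weight (s - 1) x" for x
  proof -
    have "bil_weight (s - 1) x \<ge> 0" by (cases x) (simp add: bil_weight_def)
    from mult_right_mono[OF s2(2) this] bil_quot_bound[OF s, of x] show ?thesis by linarith
  qed
qed (use s quad_quot_phase bil_quot_phase in auto)

text \<open>Here the gain of two powers pays off: the l^1 bound comes from H^1, and the Sobolev
  bound is taken in H^(s - 1) only.\<close>

lemma low_bd: "a t \<in> seq_bd (s - 1) P (hs_val (s - 1) (a t))"
  using l1_norm_le_sqrt[OF A H1] hs_sq_eq_val(2)[OF hs_fin, of "s - 1"]
  by (simp add: seq_bd_def P_def)

lemma corr_bound:
  "cmod (mod_energy l (jw (2 * s)) (quad_quot s) (bil_quot s) (a t) - of_real (hs_val s (a t)))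
     \<le> corr_const s \<Lambda> P * hs_val (s - 1) (a t)"
proof -
  interpret W: mod_weights s "jw (2 * s)" "quad_quot s" "bil_quot s" "2 * s\<^sup>2" by (rule growth_weights)
  define Z where "Z = hs_val (s - 1) (a t)"
  have Z: "Z \<ge> 0" by (simp add: Z_def hs_val_nonneg)
  have b: "a t \<in> seq_bd (s - 1) P Z" unfolding Z_def by (rule low_bd)
  have s0: "s - 1 \<ge> 0" using s by simp
  have m: "tsum (\<lambda>n. of_real (jw (2 * s) n) * (a t n * cnj (a t n))) = of_real (hs_val s (a t))"
  proof -
    have "of_real (jw (2 * s) n) * (a t n * cnj (a t n)) = complex_of_real ((jw s n * cmod (a t n))\<^sup>2)" for n
      unfolding jw_double complex_norm_square[symmetric] by (simp add: power_mult_distrib)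
    then show ?thesis by (simp add: hs_val_def del: of_real_power of_real_mult)
  qed
  have q: "cmod (tsum (\<lambda>x. of_real (quad_quot s x) * quad (a t) (a t) (a t) (a t) x)) \<le> 2 * s\<^sup>2 * (12 * 3 powr (s - 1) * Z * P\<^sup>2)"
    by (rule sum_bd_norm[OF sum_bd_quad[OF s0 P_nonneg Z W.C W.K b b b b]])
  have r: "cmod (tsum (\<lambda>x. of_real (bil_quot s x) * bil l (a t) (a t) x)) \<le> 2 * s\<^sup>2 * (2 * 2 powr (s - 1) * \<Lambda> * Z)"
    by (rule sum_bd_norm[OF sum_bd_bil[OF s0 \<Lambda> Z W.C W.L weighted_l1_le b b]]) simp
  have "cmod (mod_energy l (jw (2 * s)) (quad_quot s) (bil_quot s) (a t) - of_real (hs_val s (a t)))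
     = cmod (1 / 2 * tsum (\<lambda>x. of_real (quad_quot s x) * quad (a t) (a t) (a t) (a t) x) + tsum (\<lambda>x. of_real (bil_quot s x) * bil l (a t) (a t) x))"
    by (simp add: mod_energy_def m)
  also have "\<dots> \<le> 1 / 2 * (2 * s\<^sup>2 * (12 * 3 powr (s - 1) * Z * P\<^sup>2)) + 2 * s\<^sup>2 * (2 * 2 powr (s - 1) * \<Lambda> * Z)"
    by (rule norm_half_add_le[OF q r])
  also have "\<dots> = corr_const s \<Lambda> P * Z" by (simp add: corr_const_def algebra_simps)
  finally show ?thesis by (simp add: Z_def)
qed

lemma rate_bound:
  "cmod (mod_energy_rate l (quad_quot s) (bil_quot s) (a t)) \<le> rate_const s \<Lambda> P * hs_val (s - 1) (a t)"
proof -
  interpret W: mod_weights s "jw (2 * s)" "quad_quot s" "bil_quot s" "2 * s\<^sup>2" by (rule growth_weights)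
  define Z where "Z = hs_val (s - 1) (a t)"
  have Z: "Z \<ge> 0" by (simp add: Z_def hs_val_nonneg)
  have b: "a t \<in> seq_bd (s - 1) P Z" unfolding Z_def by (rule low_bd)
  have s0: "s - 1 \<ge> 0" using s by simp
  define P' Z' where "P' = P + P ^ 3 + \<Lambda> * P" and "Z' = (1 + 18 * (3 powr (s - 1))\<^sup>2 * (P ^ 4 + \<Lambda>\<^sup>2)) * Z"
  have nn: "P' \<ge> 0" "Z' \<ge> 0" using P_nonneg Z \<Lambda> by (auto simp: P'_def Z'_def)
  have b': "a t \<in> seq_bd (s - 1) P' Z'" "force t \<in> seq_bd (s - 1) P' Z'"
    unfolding P'_def Z'_def by (intro seq_bd_state s0 P_nonneg Z b; simp)+
  have q: "cmod (tsum (quad_var (quad_quot s) (a t) (force t))) \<le> 2 * s\<^sup>2 * (48 * 3 powr (s - 1) * Z' * P'\<^sup>2)"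
    by (rule sum_bd_norm[OF sum_bd_quad_var[OF s0 nn W.C W.K b']])
  have r: "cmod (tsum (bil_var l (bil_quot s) (a t) (force t))) \<le> 2 * s\<^sup>2 * (4 * 2 powr (s - 1) * \<Lambda> * Z')"
    by (rule sum_bd_norm[OF sum_bd_bil_var[OF s0 \<Lambda> nn(2) W.C W.L weighted_l1_le b']]) simp
  have "force t = (\<lambda>n. - \<i> * nls_rhs l (a t) n)" by (simp add: force_def fun_eq_iff)
  then have "cmod (mod_energy_rate l (quad_quot s) (bil_quot s) (a t))
     = cmod (1 / 2 * tsum (quad_var (quad_quot s) (a t) (force t)) + tsum (bil_var l (bil_quot s) (a t) (force t)))"
    by (simp only: mod_energy_rate_def Let_def)
  also have "\<dots> \<le> 1 / 2 * (2 * s\<^sup>2 * (48 * 3 powr (s - 1) * Z' * P'\<^sup>2)) + 2 * s\<^sup>2 * (4 * 2 powr (s - 1) * \<Lambda> * Z')"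
    by (rule norm_half_add_le[OF q r])
  also have "\<dots> = 2 * s\<^sup>2 * Z' * (24 * 3 powr (s - 1) * P'\<^sup>2 + 4 * 2 powr (s - 1) * \<Lambda>)" by (simp add: algebra_simps)
  also have "\<dots> = rate_const s \<Lambda> P * Z" by (simp add: rate_const_def Z'_def P'_def)
  finally show ?thesis by (simp add: Z_def)
qed

lemma consts_nonneg: "corr_const s \<Lambda> P \<ge> 0" "rate_const s \<Lambda> P \<ge> 0"
  using \<Lambda> by (auto simp: corr_const_def rate_const_def)

text \<open>Mass conservation replaces the L^2 norm at time \<open>t\<close> by that of the initial
  state, so the low-order term does not grow with time.\<close>

lemma interpolate:
  assumes "\<delta> > 0"
  shows "hs_val (s - 1) (a t) \<le> \<delta> * hs_val s (a t) + \<delta> powr (1 - s) * hs_val 0 (a 0)"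
proof -
  have "ennreal (hs_val (s - 1) (a t)) = hs_sq (s - 1) (a t)" using hs_sq_eq_val(2)[OF hs_fin] by simp
  also have "\<dots> \<le> ennreal \<delta> * hs_sq s (a t) + ennreal (\<delta> powr (1 - s)) * hs_sq 0 (a t)"
    by (rule hs_sq_interpolate[OF assms s])
  also have "\<dots> = ennreal (\<delta> * hs_val s (a t) + \<delta> powr (1 - s) * hs_val 0 (a t))"
    using hs_sq_eq_val(2)[OF hs_fin[of s t]] hs_sq_eq_val(2)[OF hs_fin[of 0 t]] assms s hs_val_nonneg
    by (simp add: ennreal_mult)
  finally show ?thesis unfolding mass_const[of t]
    using assms hs_val_nonneg by (subst (asm) ennreal_le_iff) auto
qed

text \<open>On [-T, T] the supremum \<open>Y\<close> of the squared norm exceeds the initial value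
  by at most \<open>D * Zs\<close>, where \<open>D\<close> is of order 1 + T and \<open>Zs\<close>
  bounds the squared H^(s - 1) norm. Interpolation with \<delta> = 1 / (2 D) splits
  \<open>D * Zs\<close> into half of \<open>Y\<close>, which is absorbed, and a multiple of D^s
  times the mass. So the squared norm grows at most like T^s.\<close>

theorem growth:
  shows "hs_val s (a t) \<le> growth_const s \<Lambda> A * (1 + \<bar>t\<bar>) powr s * hs_val s (a 0)"
proof -
  define T where "T = \<bar>t\<bar>"
  define c1 c2 where "c1 = corr_const s \<Lambda> P" and "c2 = rate_const s \<Lambda> P"
  \<comment> \<open>Chosen so that 2 c1 + c2 T \<le> E (1 + T): the corrections at the two end times
    cost 2 c1, the rate costs c2 per unit of time. The summand 1 gives
    \<open>E \<ge> 1\<close>.\<close>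
  define E where "E = 2 * c1 + c2 + 1"
  have c: "c1 \<ge> 0" "c2 \<ge> 0" "E \<ge> 1" using consts_nonneg by (auto simp: c1_def c2_def E_def)
  define D where "D = E * (1 + T)"
  have T: "T \<ge> 0" by (simp add: T_def)
  have D: "D \<ge> 1" "D > 0" using mult_mono[of 1 E 1 "1 + T"] c T by (auto simp: D_def)
  define \<delta> where "\<delta> = 1 / (2 * D)"
  have \<delta>: "\<delta> > 0" using D by (simp add: \<delta>_def)
  define X where "X = (\<lambda>t. hs_val s (a t))"
  define m where "m = hs_val 0 (a 0)"
  obtain B where B: "\<And>t. \<bar>t\<bar> \<le> T \<Longrightarrow> hs_sq s (a t) \<le> ennreal B" using bdd by blast
  have XB: "X t \<le> max 0 B" if "\<bar>t\<bar> \<le> T" for t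
  proof -
    have "ennreal (X t) \<le> ennreal B"
      using B[OF that] hs_sq_eq_val(2)[OF hs_fin[of s t]] by (simp add: X_def)
    also have "\<dots> \<le> ennreal (max 0 B)" by (rule ennreal_leI) simp
    finally show ?thesis by (subst (asm) ennreal_le_iff) auto
  qed
  define S where "S = {- T..T}"
  \<comment> \<open>Finite, because the solution is bounded in H^s on compact time intervals; the
    absorption of half of \<open>Y\<close> depends on this.\<close>
  define Y where "Y = (SUP t\<in>S. X t)"
  have bdd: "bdd_above (X ` S)" using XB by (auto simp: S_def intro!: bdd_aboveI[of _ "max 0 B"])
  have XY: "X t \<le> Y" if "t \<in> S" for t unfolding Y_def by (rule cSUP_upper[OF that bdd])
  have X0: "X t \<ge> 0" for t by (simp add: X_def hs_val_nonneg)
  have m0: "m \<ge> 0" by (simp add: m_def hs_val_nonneg)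
  define Zs where "Zs = \<delta> * Y + \<delta> powr (1 - s) * m"
  have Z: "hs_val (s - 1) (a \<tau>) \<le> Zs" if "\<tau> \<in> S" for \<tau>
    using interpolate[OF \<delta>, of \<tau>] mult_left_mono[OF XY[OF that] less_imp_le[OF \<delta>]]
    unfolding Zs_def X_def m_def by linarith
  have Zs0: "Zs \<ge> 0" using Z[of 0] hs_val_nonneg[of "s - 1" "a 0"] T by (simp add: S_def)
  define H where "H = (\<lambda>t. mod_energy l (jw (2 * s)) (quad_quot s) (bil_quot s) (a t))"
  have HX: "cmod (H \<tau> - of_real (X \<tau>)) \<le> c1 * Zs" if "\<tau> \<in> S" for \<tau>
    using corr_bound[of \<tau>] mult_left_mono[OF Z[OF that] c(1)] unfolding H_def X_def c1_def by linarith
  have Hdiff: "cmod (H t1 - H t0) \<le> c2 * Zs * (t1 - t0)" if "t0 \<le> t1" "t0 \<in> S" "t1 \<in> S" for t0 t1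
  proof -
    have "cmod (H t1 - H t0) \<le> c2 * Zs * measure lborel (cbox t0 t1)"
    proof (rule has_integral_bound)
      show "((\<lambda>t. mod_energy_rate l (quad_quot s) (bil_quot s) (a t)) has_integral H t1 - H t0) (cbox t0 t1)"
        unfolding H_def cbox_interval by (rule mod_energy_has_integral[OF growth_weights that(1)])
      show "cmod (mod_energy_rate l (quad_quot s) (bil_quot s) (a \<tau>)) \<le> c2 * Zs" if "\<tau> \<in> cbox t0 t1" for \<tau>
      proof -
        have "\<tau> \<in> S" using that \<open>t0 \<in> S\<close> \<open>t1 \<in> S\<close> by (auto simp: S_def)
        then show ?thesis
          using rate_bound[of \<tau>] mult_left_mono[OF Z c(2)] unfolding c2_def by (meson order_trans)
      qed
    qed (use c Zs0 in auto)
    then show ?thesis using that by simp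
  qed
  have X_le: "X \<tau> \<le> X 0 + D * Zs" if "\<tau> \<in> S" for \<tau>
  proof -
    have 0: "0 \<in> S" using T by (simp add: S_def)
    have "cmod (H \<tau> - H 0) \<le> c2 * Zs * \<bar>\<tau>\<bar>"
      using Hdiff[of 0 \<tau>] Hdiff[of \<tau> 0] that 0 by (cases "\<tau> \<ge> 0") (auto simp: norm_minus_commute)
    also have "\<dots> \<le> c2 * Zs * T"
      using that c Zs0 by (intro mult_left_mono) (auto simp: S_def)
    finally have 1: "cmod (H \<tau> - H 0) \<le> c2 * Zs * T" .
    have "cmod (of_real (X \<tau>) - of_real (X 0)) \<le> cmod (H \<tau> - of_real (X \<tau>)) + cmod (H \<tau> - H 0) + cmod (H 0 - of_real (X 0))"
      by norm
    also have "\<dots> \<le> c1 * Zs + c2 * Zs * T + c1 * Zs" using 1 HX[OF that] HX[OF 0] by linarith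
    also have "\<dots> = (2 * c1 + c2 * T) * Zs" by (simp add: algebra_simps)
    also have "\<dots> \<le> D * Zs"
    proof (rule mult_right_mono[OF _ Zs0])
      have "2 * c1 * T \<ge> 0" using c T by simp
      then show "2 * c1 + c2 * T \<le> D" using c T unfolding D_def E_def by (simp add: algebra_simps)
    qed
    finally have "cmod (of_real (X \<tau> - X 0)) \<le> D * Zs" by simp
    then show ?thesis unfolding norm_of_real by linarith
  qed
  have "Y \<le> X 0 + D * Zs"
    unfolding Y_def by (rule cSUP_least) (use X_le T in \<open>auto simp: S_def\<close>)
  \<comment> \<open>By the choice of \<delta>, D \<delta> = 1/2 and D \<delta>^(1 - s) = (2 D)^s /
    2.\<close>
  also have "D * Zs = Y / 2 + (2 * D) powr s * m / 2"
  proof -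
    have "\<delta> powr (1 - s) = (2 * D) powr (s - 1)"
      unfolding \<delta>_def powr_divide using D by (simp add: powr_divide powr_minus_divide powr_diff)
    moreover have "D * (2 * D) powr (s - 1) = (2 * D) powr s / 2"
      using powr_mult_base[of "2 * D" "s - 1"] D by simp
    ultimately show ?thesis using D unfolding Zs_def by (simp add: \<delta>_def algebra_simps)
  qed
  finally have "Y \<le> 2 * X 0 + (2 * D) powr s * m" by simp
  \<comment> \<open>The mass is traded for the squared H^s norm of the data, so that the final bound
    is linear in that norm.\<close>
  also have "m \<le> X 0"
  proof -
    have "ennreal m \<le> ennreal (X 0)"
      using hs_sq_mono[of 0 s "a 0"] s hs_sq_eq_val(2)[OF hs_fin[of s 0]] hs_sq_eq_val(2)[OF hs_fin[of 0 0]]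
      by (simp add: m_def X_def)
    then show ?thesis by (subst (asm) ennreal_le_iff) (use X0 in auto)
  qed
  finally have "Y \<le> 2 * X 0 + (2 * D) powr s * X 0" by (simp add: mult_left_mono)
  also have "\<dots> \<le> (2 + (2 * E) powr s) * (1 + T) powr s * X 0"
  proof -
    have "(2 * D) powr s = (2 * E) powr s * (1 + T) powr s"
      using c T by (simp add: D_def powr_mult mult.assoc)
    moreover have "1 \<le> (1 + T) powr s" using T s by (intro ge_one_powr_ge_zero) auto
    ultimately have "2 + (2 * D) powr s \<le> (2 + (2 * E) powr s) * (1 + T) powr s" by (simp add: algebra_simps)
    from mult_right_mono[OF this X0[of 0]] show ?thesis by (simp add: algebra_simps)
  qed
  finally have "Y \<le> (2 + (2 * E) powr s) * (1 + T) powr s * X 0" .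
  moreover have "X t \<le> Y" by (rule XY) (auto simp: S_def T_def)
  ultimately show ?thesis
    unfolding growth_const_def X_def T_def E_def c1_def c2_def P_def by linarith
qed

end

end

section \<open>Fourier series on the circle\<close>

text \<open>The circle as a closed interval; the identification of 0 with 2 pi concerns a null
  set.\<close>

abbreviation circ :: "real measure" where "circ \<equiv> restrict_space lborel {0..2 * pi}"

lemma space_circ: "space circ = {0..2 * pi}"
  by (simp add: space_restrict_space)

lemma finite_measure_circ: "finite_measure circ"
  by (rule finite_measureI) (simp add: space_circ emeasure_restrict_space)

interpretation circ: finite_measure circ by (rule finite_measure_circ)

lemma sigma_finite_circ: "sigma_finite_measure circ" by unfold_locales

lemma emeasure_circ: "emeasure circ {0..2 * pi} = ennreal (2 * pi)"
  by (simp add: emeasure_restrict_space)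

lemma measure_circ: "measure circ {0..2 * pi} = 2 * pi"
  by (simp add: measure_def emeasure_circ)

lemma circle_int_eq: "circle_int f = (\<integral>x. f x \<partial>circ)"
  unfolding circle_int_def set_lebesgue_integral_def by (subst integral_restrict_space) auto

lemma integrable_circ_iff: "integrable circ f \<longleftrightarrow> set_integrable lborel {0..2 * pi} f"
  for f :: "real \<Rightarrow> 'a::{banach, second_countable_topology}"
  unfolding set_integrable_def by (subst integrable_restrict_space) auto

lemma measurable_circ: "f \<in> borel_measurable borel \<Longrightarrow> f \<in> borel_measurable circ"
  by (intro measurable_restrict_space1) simp

lemma integrable_circ_bounded:
  fixes f :: "real \<Rightarrow> 'a::{banach, second_countable_topology}"
  assumes "f \<in> borel_measurable circ" "\<And>x. x \<in> {0..2 * pi} \<Longrightarrow> norm (f x) \<le> B"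
  shows "integrable circ f"
  by (rule circ.integrable_const_bound[of _ B]) (use assms in \<open>auto simp: space_circ\<close>)

definition ex :: "int \<Rightarrow> real \<Rightarrow> complex" where "ex n x = exp (\<i> * of_int n * of_real x)"

lemma ex_cis: "ex n x = cis (of_int n * x)"
  by (simp add: ex_def cis_conv_exp mult.assoc)

lemma norm_ex [simp]: "cmod (ex n x) = 1" by (simp add: ex_cis)

lemma ex_add: "ex (m + n) x = ex m x * ex n x"
  by (simp add: ex_cis cis_mult ring_distribs)

lemma ex_0 [simp]: "ex 0 x = 1" by (simp add: ex_def)

lemma cnj_ex: "cnj (ex n x) = ex (- n) x" by (simp add: ex_cis cis_cnj)

lemma ex_diff: "ex (m - n) x = ex m x * ex (- n) x"
  using ex_add[of m "- n"] by simp

lemma continuous_ex [continuous_intros]: "continuous_on A (ex n)"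
  unfolding ex_def[abs_def] by (intro continuous_intros)

lemma borel_ex [measurable]: "ex n \<in> borel_measurable borel"
  by (rule borel_measurable_continuous_onI) (rule continuous_ex)

lemma ex_circ [measurable]: "ex n \<in> borel_measurable circ"
  by (rule measurable_circ) simp

lemma ex_period: "ex n (x + 2 * pi) = ex n x"
proof -
  have "cis (of_int n * (x + 2 * pi)) = cis (of_int n * x) * cis (2 * pi * of_int n)"
    by (simp add: cis_mult algebra_simps)
  then show ?thesis unfolding ex_cis by simp
qed

lemma fourier_eq: "fourier f n = (\<integral>x. f x * ex (- n) x \<partial>circ)"
  by (simp add: fourier_def circle_int_eq ex_def)

lemma ex_deriv: "(ex n has_vector_derivative \<i> * of_int n * ex n x) (at x within A)"
proof -
  have "((\<lambda>x. exp (\<i> * of_int n * of_real x)) has_vector_derivative (\<i> * of_int n * exp (\<i> * of_int n * of_real x))) (at x within A)"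
    by (rule has_vector_derivative_real_field) (auto intro!: derivative_eq_intros)
  then show ?thesis by (simp add: ex_def[abs_def])
qed

lemma circ_FTC:
  fixes F :: "real \<Rightarrow> 'a::euclidean_space"
  assumes "\<And>x. x \<in> {0..2 * pi} \<Longrightarrow> (F has_vector_derivative f x) (at x within {0..2 * pi})"
    and "continuous_on {0..2 * pi} f"
  shows "(\<integral>x. f x \<partial>circ) = F (2 * pi) - F 0"
  using integral_FTC_Icc[of 0 "2 * pi" F f] assms
  by (subst integral_restrict_space) auto

lemma integral_ex: "(\<integral>x. ex n x \<partial>circ) = (if n = 0 then 2 * pi else 0)"
proof (cases "n = 0")
  case True
  then show ?thesis by (simp add: space_circ measure_circ scaleR_conv_of_real)
next
  case False
  have "(\<integral>x. \<i> * of_int n * ex n x \<partial>circ) = ex n (2 * pi) - ex n 0"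
    by (rule circ_FTC) (auto intro!: ex_deriv continuous_intros)
  also have "\<dots> = 0" using ex_period[of n 0] by simp
  finally show ?thesis using False by simp
qed

section \<open>Uniqueness of Fourier coefficients for integrable functions\<close>

definition annihilated :: "(real \<Rightarrow> complex) \<Rightarrow> bool" where
  "annihilated h \<longleftrightarrow> integrable circ h \<and> (\<forall>n. (\<integral>x. h x * ex n x \<partial>circ) = 0)"

lemma annihilated_ex: assumes "annihilated h" shows "annihilated (\<lambda>x. h x * ex m x)"
  unfolding annihilated_def
proof (intro conjI allI)
  show "integrable circ (\<lambda>x. h x * ex m x)"
    by (rule Bochner_Integration.integrable_bound[of _ h]) (use assms in \<open>auto simp: annihilated_def norm_mult\<close>)
  show "(\<integral>x. h x * ex m x * ex n x \<partial>circ) = 0" for n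
    using assms ex_add[of m n] by (simp add: annihilated_def mult.assoc flip: ex_add)
qed

lemma annihilated_add: "annihilated f \<Longrightarrow> annihilated g \<Longrightarrow> annihilated (\<lambda>x. f x + g x)"
proof -
  assume f: "annihilated f" and g: "annihilated g"
  have "integrable circ (\<lambda>x. f x * ex n x)" "integrable circ (\<lambda>x. g x * ex n x)" for n
    using annihilated_ex[OF f, of n] annihilated_ex[OF g, of n] by (simp_all add: annihilated_def)
  then show ?thesis using f g by (simp add: annihilated_def ring_distribs)
qed

lemma annihilated_cmult: "annihilated f \<Longrightarrow> annihilated (\<lambda>x. c * f x)"
  by (simp add: annihilated_def mult.assoc)

text \<open>On the unit circle a real linear form is a combination of z and its conjugate, that is
  of the characters 1 and -1, and multiplication by a character preserves the class. The induction
  runs over all \<open>h\<close>, so that a product of polynomials amounts to two multiplications in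
  turn.\<close>

lemma annihilated_polynomial:
  assumes "real_polynomial_function q" shows "annihilated h \<Longrightarrow> annihilated (\<lambda>x. h x * of_real (q (cis x)))"
  using assms
proof (induction q arbitrary: h rule: real_polynomial_function.induct)
  case (linear f)
  have c: "cis x = ex 1 x" "cnj (cis x) = ex (- 1) x" for x
    by (simp_all add: ex_cis cis_cnj)
  have lin: "f z = Re z * f 1 + Im z * f \<i>" for z
  proof -
    have "z = Re z *\<^sub>R 1 + Im z *\<^sub>R \<i>" by (simp add: complex_eq_iff)
    then have "f z = f (Re z *\<^sub>R 1 + Im z *\<^sub>R \<i>)" by simp
    also have "\<dots> = Re z * f 1 + Im z * f \<i>"
      using linear(1) by (simp add: linear_add linear_scale bounded_linear.linear)
    finally show ?thesis .
  qed
  have "h x * of_real (f (cis x)) = (of_real (f 1 / 2) + of_real (f \<i> / 2) / \<i>) * (h x * ex 1 x)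
     + (of_real (f 1 / 2) - of_real (f \<i> / 2) / \<i>) * (h x * ex (- 1) x)" for x
    unfolding c[symmetric] lin[of "cis x"] by (simp add: complex_eq_iff field_simps)
  then show ?case
    using linear(2) by (simp only:) (intro annihilated_add annihilated_cmult annihilated_ex)
next
  case (const c)
  then show ?case using annihilated_cmult[of h "of_real c"] by (simp add: mult.commute)
next
  case (add f g)
  then show ?case using annihilated_add by (simp add: ring_distribs)
next
  case (mult f g)
  then show ?case using mult.IH(2)[OF mult.IH(1)] by (simp add: mult.assoc)
qed

lemma continuous_cis: "continuous_on A cis"
  unfolding cis_conv_exp[abs_def] by (intro continuous_intros)

lemma borel_cis: "cis \<in> borel_measurable borel"
  by (rule borel_measurable_continuous_onI) (rule continuous_cis)

text \<open>Stone-Weierstrass on the unit circle of the complex plane; composition with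
  \<open>cis\<close> takes care of periodicity.\<close>

lemma annihilated_continuous:
  fixes \<psi> :: "complex \<Rightarrow> real"
  assumes h: "annihilated h" and c: "continuous_on UNIV \<psi>"
  shows "(\<integral>x. h x * of_real (\<psi> (cis x)) \<partial>circ) = 0"
proof -
  define B where "B = (\<integral>x. cmod (h x) \<partial>circ)"
  have ih: "integrable circ h" using h by (simp add: annihilated_def)
  have B: "B \<ge> 0" unfolding B_def by simp
  have m: "(\<lambda>x. complex_of_real (q (cis x))) \<in> borel_measurable circ" if "continuous_on UNIV q" for q :: "complex \<Rightarrow> real"
    by (intro measurable_circ borel_measurable_continuous_onI continuous_intros continuous_on_compose2[OF that continuous_cis]) auto
  obtain R where R: "\<And>z. z \<in> sphere 0 1 \<Longrightarrow> \<bar>\<psi> z\<bar> \<le> R"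
  proof -
    have "compact (\<psi> ` sphere 0 1)" by (intro compact_continuous_image continuous_on_subset[OF c]) auto
    then obtain a where "\<forall>y\<in>\<psi> ` sphere 0 1. norm y \<le> a" using compact_imp_bounded bounded_iff by metis
    then show ?thesis by (intro that[of a]) auto
  qed
  have ip: "integrable circ (\<lambda>x. h x * of_real (\<psi> (cis x)))"
  proof (rule Bochner_Integration.integrable_bound[of _ "\<lambda>x. R * cmod (h x)"])
    show "AE x in circ. cmod (h x * of_real (\<psi> (cis x))) \<le> norm (R * cmod (h x))"
    proof (rule AE_I2)
      fix x
      have "cmod (h x) * \<bar>\<psi> (cis x)\<bar> \<le> cmod (h x) * R" by (intro mult_left_mono R) auto
      also have "\<dots> \<le> \<bar>R * cmod (h x)\<bar>" by (metis abs_ge_self mult.commute)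
      finally show "cmod (h x * of_real (\<psi> (cis x))) \<le> norm (R * cmod (h x))" by (simp add: norm_mult)
    qed
  qed (use ih m[OF c] in auto)
  have "cmod (\<integral>x. h x * of_real (\<psi> (cis x)) \<partial>circ) \<le> e * B" if e0: "e > 0" for e
  proof -
    obtain q where q: "real_polynomial_function q" "\<And>z. z \<in> sphere 0 1 \<Longrightarrow> \<bar>\<psi> z - q z\<bar> < e"
      using Stone_Weierstrass_real_polynomial_function[OF compact_sphere continuous_on_subset[OF c subset_UNIV] e0] by metis
    have aq: "annihilated (\<lambda>x. h x * of_real (q (cis x)))" by (rule annihilated_polynomial[OF q(1) h])
    then have iq: "integrable circ (\<lambda>x. h x * of_real (q (cis x)))" "(\<integral>x. h x * of_real (q (cis x)) \<partial>circ) = 0"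
      by (auto simp: annihilated_def dest: spec[of _ 0])
    have "(\<integral>x. h x * of_real (\<psi> (cis x)) \<partial>circ) = (\<integral>x. h x * of_real (\<psi> (cis x)) - h x * of_real (q (cis x)) \<partial>circ)"
      using ip iq by simp
    also have "cmod \<dots> \<le> (\<integral>x. e * cmod (h x) \<partial>circ)"
    proof (rule Bochner_Integration.integral_norm_bound_integral)
      show "cmod (h x * of_real (\<psi> (cis x)) - h x * of_real (q (cis x))) \<le> e * cmod (h x)" for x
      proof -
        have "cmod (h x * of_real (\<psi> (cis x)) - h x * of_real (q (cis x))) = \<bar>\<psi> (cis x) - q (cis x)\<bar> * cmod (h x)"
          by (simp add: norm_mult mult.commute flip: right_diff_distrib of_real_diff)
        also have "\<dots> \<le> e * cmod (h x)" using q(2)[of "cis x"] by (intro mult_right_mono) auto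
        finally show ?thesis .
      qed
    qed (use ip iq ih in auto)
    also have "\<dots> = e * B" by (simp add: B_def)
    finally show ?thesis .
  qed
  note * = this
  have "cmod (\<integral>x. h x * of_real (\<psi> (cis x)) \<partial>circ) \<le> 0"
  proof (rule field_le_epsilon)
    fix e :: real assume "e > 0"
    have "e / (B + 1) * B \<le> e" using B \<open>e > 0\<close> by (simp add: field_simps)
    then show "cmod (\<integral>x. h x * of_real (\<psi> (cis x)) \<partial>circ) \<le> 0 + e"
      using *[of "e / (B + 1)"] B \<open>e > 0\<close> by simp
  qed
  then show ?thesis by simp
qed

text \<open>The indicator of a closed set is the pointwise limit of the continuous functions
  \<open>\<psi> k\<close>, which are bounded by 1, so dominated convergence applies.\<close>

lemma annihilated_closed:
  assumes h: "annihilated h" and A: "closed A" "A \<noteq> {}"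
  shows "(\<integral>x. h x * indicator A (cis x) \<partial>circ) = 0"
proof -
  define \<psi> where "\<psi> = (\<lambda>k z. max 0 (1 - real k * infdist z A))"
  have c: "continuous_on UNIV (\<psi> k)" for k
    unfolding \<psi>_def by (intro continuous_intros)
  have b: "\<bar>\<psi> k z\<bar> \<le> 1" for k z by (simp add: \<psi>_def infdist_nonneg)
  have ih: "integrable circ h" using h by (simp add: annihilated_def)
  have lim: "(\<lambda>k. \<psi> k z) \<longlonglongrightarrow> indicator A z" for z
  proof (cases "z \<in> A")
    case True
    then show ?thesis by (simp add: \<psi>_def)
  next
    case False
    then have "infdist z A > 0" using A by (metis in_closed_iff_infdist_zero infdist_nonneg less_le)
    then obtain N where N: "real N * infdist z A > 1" using reals_Archimedean3 by blast
    have "\<forall>\<^sub>F k in sequentially. \<psi> k z = indicator A z"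
      using eventually_ge_at_top[of N]
    proof eventually_elim
      case (elim k)
      have "real N * infdist z A \<le> real k * infdist z A" using elim by (intro mult_right_mono infdist_nonneg) auto
      then show ?case using N False by (simp add: \<psi>_def)
    qed
    then show ?thesis by (rule tendsto_eventually)
  qed
  have "(\<lambda>k. \<integral>x. h x * of_real (\<psi> k (cis x)) \<partial>circ) \<longlonglongrightarrow> (\<integral>x. h x * indicator A (cis x) \<partial>circ)"
  proof (rule integral_dominated_convergence[where w = "\<lambda>x. cmod (h x)"])
    have "(\<lambda>x. indicator A (cis x) :: complex) \<in> borel_measurable circ"
      using A by (intro measurable_circ measurable_compose[OF borel_cis]) auto
    then show "(\<lambda>x. h x * indicator A (cis x)) \<in> borel_measurable circ" using ih by auto
    show "(\<lambda>x. h x * of_real (\<psi> k (cis x))) \<in> borel_measurable circ" for k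
      by (intro borel_measurable_times borel_measurable_integrable[OF ih] measurable_circ
          borel_measurable_continuous_onI continuous_intros continuous_on_compose2[OF c continuous_cis]) auto
    show "integrable circ (\<lambda>x. cmod (h x))" using ih by auto
    show "AE x in circ. (\<lambda>k. h x * of_real (\<psi> k (cis x))) \<longlonglongrightarrow> h x * indicator A (cis x)"
    proof (rule AE_I2)
      fix x
      have "(\<lambda>k. complex_of_real (\<psi> k (cis x))) \<longlonglongrightarrow> of_real (indicator A (cis x))"
        by (intro tendsto_of_real lim)
      moreover have "complex_of_real (indicator A (cis x)) = indicator A (cis x)" by (simp add: indicator_def)
      ultimately show "(\<lambda>k. h x * of_real (\<psi> k (cis x))) \<longlonglongrightarrow> h x * indicator A (cis x)"
        by (auto intro: tendsto_mult_left)
    qed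
    show "AE x in circ. cmod (h x * of_real (\<psi> k (cis x))) \<le> cmod (h x)" for k
      using b by (auto simp: norm_mult intro!: AE_I2 mult_left_le)
  qed
  moreover have "(\<integral>x. h x * of_real (\<psi> k (cis x)) \<partial>circ) = 0" for k
    by (rule annihilated_continuous[OF h c])
  ultimately show ?thesis by (simp add: LIMSEQ_const_iff)
qed

lemma AE_circ_not_end: "AE x in circ. x \<noteq> 0 \<and> x \<noteq> 2 * pi"
proof -
  have "AE x in lborel. x \<noteq> 0 \<and> x \<noteq> 2 * pi"
    using AE_lborel_singleton[of 0] AE_lborel_singleton[of "2 * pi"] by eventually_elim auto
  then show ?thesis by (subst AE_restrict_space_iff) auto
qed

text \<open>Up to the null set of the two end points 0 and 2 pi, which \<open>cis\<close>
  identifies, an interval is the preimage of its image on the unit circle, and that image is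
  compact.\<close>

lemma annihilated_interval:
  assumes h: "annihilated h" shows "(\<integral>x. indicator {a..b} x *\<^sub>R h x \<partial>circ) = 0"
proof -
  define I where "I = {a..b} \<inter> {0..2 * pi}"
  have ih: "integrable circ h" using h by (simp add: annihilated_def)
  show ?thesis
  proof (cases "I = {}")
    case True
    have "(\<integral>x. indicator {a..b} x *\<^sub>R h x \<partial>circ) = (\<integral>x. 0 \<partial>circ)"
      by (rule Bochner_Integration.integral_cong) (use True in \<open>auto simp: I_def space_circ indicator_def\<close>)
    then show ?thesis by simp
  next
    case False
    have cl: "closed (cis ` I)"
      unfolding I_def by (intro compact_imp_closed compact_continuous_image continuous_cis compact_Int_closed) auto
    have "AE x in circ. indicator {a..b} x *\<^sub>R h x = h x * indicator (cis ` I) (cis x)"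
      using AE_circ_not_end AE_space
    proof eventually_elim
      case (elim x)
      have x: "0 < x" "x < 2 * pi" using elim by (auto simp: space_circ less_le)
      have "cis x \<in> cis ` I \<longleftrightarrow> x \<in> {a..b}"
      proof
        assume "cis x \<in> cis ` I"
        then obtain y where y: "y \<in> I" "cis x = cis y" by auto
        have "\<i> * complex_of_real x = \<i> * complex_of_real y"
          by (rule exp_complex_eqI) (use x y in \<open>auto simp: I_def cis_conv_exp abs_less_iff\<close>)
        then show "x \<in> {a..b}" using y by (auto simp: I_def)
      qed (use x in \<open>auto simp: I_def\<close>)
      then show ?case by (simp add: indicator_def)
    qed
    then have "(\<integral>x. indicator {a..b} x *\<^sub>R h x \<partial>circ) = (\<integral>x. h x * indicator (cis ` I) (cis x) \<partial>circ)"
    proof (rule integral_cong_AE[rotated 2])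
      show "(\<lambda>x. indicator {a..b} x *\<^sub>R h x) \<in> borel_measurable circ"
        by (rule borel_measurable_scaleR[OF measurable_circ borel_measurable_integrable[OF ih]]) auto
      have "(\<lambda>x. indicator (cis ` I) (cis x) :: complex) \<in> borel_measurable circ"
        using cl by (intro measurable_circ measurable_compose[OF borel_cis]) auto
      then show "(\<lambda>x. h x * indicator (cis ` I) (cis x)) \<in> borel_measurable circ"
        by (rule borel_measurable_times[OF borel_measurable_integrable[OF ih]])
    qed
    then show ?thesis using annihilated_closed[OF h cl] False by simp
  qed
qed

text \<open>The Borel sets over which \<open>h\<close> integrates to 0 contain the intervals and are
  closed under complements and countable disjoint unions; hence they are all Borel sets.\<close>

lemma annihilated_AE_zero:
  assumes h: "annihilated h" shows "AE x in circ. h x = 0"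
proof -
  have ih: "integrable circ h" using h by (simp add: annihilated_def)
  have iB: "integrable circ (\<lambda>x. indicator B x *\<^sub>R h x)" if "B \<in> sets borel" for B
  proof (rule Bochner_Integration.integrable_bound[OF ih])
    show "(\<lambda>x. indicator B x *\<^sub>R h x) \<in> borel_measurable circ"
      by (rule borel_measurable_scaleR[OF measurable_circ borel_measurable_integrable[OF ih]]) (use that in auto)
  qed (auto simp: indicator_def)
  have *: "(\<integral>x. indicator B x *\<^sub>R h x \<partial>circ) = 0" if "B \<in> sets borel" for B
    using that
  proof (induction rule: borel_set_induct)
    case (interval a b)
    then show ?case using annihilated_interval[OF h] by auto
  next
    case empty
    then show ?case by simp
  next
    case (compl A)
    have "(\<lambda>x. indicator (- A) x *\<^sub>R h x) = (\<lambda>x. h x - indicator A x *\<^sub>R h x)"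
      by (auto simp: indicator_def)
    moreover have "(\<integral>x. h x \<partial>circ) = 0" using h by (auto simp: annihilated_def dest: spec[of _ 0])
    ultimately show ?case using compl iB[of A] ih by simp
  next
    case (union A)
    have "(\<integral>x. indicator (\<Union>(range A)) x *\<^sub>R h x \<partial>circ) = set_lebesgue_integral circ (\<Union>i. A i \<inter> {0..2 * pi}) h"
      unfolding set_lebesgue_integral_def
      by (rule Bochner_Integration.integral_cong) (auto simp: space_circ indicator_def)
    also have "\<dots> = (\<Sum>i. set_lebesgue_integral circ (A i \<inter> {0..2 * pi}) h)"
    proof (rule lebesgue_integral_countable_add)
      show "A i \<inter> {0..2 * pi} \<in> sets circ" for i using union by (auto simp: sets_restrict_space)
      show "\<And>i j. i \<noteq> j \<Longrightarrow> (A i \<inter> {0..2 * pi}) \<inter> (A j \<inter> {0..2 * pi}) = {}"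
        using union by (auto simp: disjoint_family_on_def)
      have "(\<Union>i. A i \<inter> {0..2 * pi}) = {0..2 * pi} \<inter> (\<Union>i. A i)" by auto
      then have "(\<Union>i. A i \<inter> {0..2 * pi}) \<in> sets circ" using union by (auto simp: sets_restrict_space)
      then show "set_integrable circ (\<Union>i. A i \<inter> {0..2 * pi}) h"
        using ih unfolding set_integrable_def by (rule integrable_mult_indicator)
    qed
    also have "(\<lambda>i. set_lebesgue_integral circ (A i \<inter> {0..2 * pi}) h) = (\<lambda>i. \<integral>x. indicator (A i) x *\<^sub>R h x \<partial>circ)"
      unfolding set_lebesgue_integral_def
      by (intro ext Bochner_Integration.integral_cong) (auto simp: space_circ indicator_def)
    finally show ?case using union by simp
  qed
  show ?thesis
  proof (rule circ.density_zero[OF ih])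
    fix A assume "A \<in> sets circ"
    then obtain B where B: "B \<in> sets borel" "A = {0..2 * pi} \<inter> B" by (auto simp: sets_restrict_space)
    have "set_lebesgue_integral circ A h = (\<integral>x. indicator B x *\<^sub>R h x \<partial>circ)"
      unfolding set_lebesgue_integral_def
      by (rule Bochner_Integration.integral_cong) (use B in \<open>auto simp: space_circ indicator_def\<close>)
    then show "set_lebesgue_integral circ A h = 0" using *[OF B(1)] by simp
  qed
qed

lemma fourier_unique:
  assumes "integrable circ f" "integrable circ g" "\<And>n. fourier f n = fourier g n"
  shows "AE x in circ. f x = g x"
proof -
  have m: "integrable circ (\<lambda>x. f x * ex n x)" if "integrable circ f" for f n
    by (rule Bochner_Integration.integrable_bound[OF that]) (use that in \<open>auto simp: norm_mult\<close>)
  have "annihilated (\<lambda>x. f x - g x)"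
    unfolding annihilated_def
  proof (intro conjI allI)
    show "(\<integral>x. (f x - g x) * ex n x \<partial>circ) = 0" for n
      using assms(3)[of "- n"] m[OF assms(1), of n] m[OF assms(2), of n]
      by (simp add: fourier_eq left_diff_distrib)
  qed (use assms in auto)
  from annihilated_AE_zero[OF this] show ?thesis by eventually_elim simp
qed

lemma cmod_le_one_plus_sq: "cmod z \<le> 1 + (cmod z)\<^sup>2"
proof -
  have "2 * cmod z \<le> 1 + (cmod z)\<^sup>2" using sum_squares_bound[of "cmod z" 1] by simp
  then show ?thesis using norm_ge_zero[of z] by linarith
qed

lemma L2_circleD:
  assumes "f \<in> L2_circle"
  shows "f \<in> borel_measurable borel" "integrable circ (\<lambda>x. (cmod (f x))\<^sup>2)" "integrable circ f"
proof -
  show m: "f \<in> borel_measurable borel" and i: "integrable circ (\<lambda>x. (cmod (f x))\<^sup>2)"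
    using assms by (auto simp: L2_circle_def integrable_circ_iff)
  show "integrable circ f"
  proof (rule Bochner_Integration.integrable_bound[of _ "\<lambda>x. 1 + (cmod (f x))\<^sup>2"])
    show "AE x in circ. cmod (f x) \<le> norm (1 + (cmod (f x))\<^sup>2)"
      using cmod_le_one_plus_sq by (auto intro!: AE_I2 order_trans[OF _ abs_ge_self])
  qed (use i m in \<open>auto intro: measurable_circ\<close>)
qed

lemma borel_measurable_cnj [measurable (raw)]:
  "f \<in> borel_measurable M \<Longrightarrow> (\<lambda>x. cnj (f x)) \<in> borel_measurable M"
  by (rule measurable_compose[OF _ borel_measurable_continuous_onI]) (auto intro!: continuous_intros)

lemma integrable_mult_ex: "integrable circ f \<Longrightarrow> integrable circ (\<lambda>x. f x * ex n x)"
  by (rule Bochner_Integration.integrable_bound) (auto simp: norm_mult)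

section \<open>Absolutely convergent Fourier series and their products\<close>

definition ser :: "(int \<Rightarrow> complex) \<Rightarrow> real \<Rightarrow> complex" where
  "ser c x = tsum (\<lambda>n. c n * ex n x)"

lemma summ_ser: "summ c \<Longrightarrow> summ (\<lambda>n. c n * ex n x)"
  by (rule Bochner_Integration.integrable_bound[of _ c]) (auto simp: norm_mult)

lemma norm_ser_le: "summ c \<Longrightarrow> cmod (ser c x) \<le> tsum (\<lambda>n. cmod (c n))"
  unfolding ser_def using integral_norm_bound[of "count_space UNIV" "\<lambda>n. c n * ex n x"] by (simp add: norm_mult)

text \<open>Stated for bounded \<open>G\<close> over any countable index set, so that it serves
  single series in \<open>ex n\<close>, conjugated series in \<open>ex (- n)\<close> and the double
  series of |f|^2.\<close>

lemma circ_swap: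
  fixes G :: "'q::countable \<Rightarrow> real \<Rightarrow> complex" and g :: "real \<Rightarrow> complex"
  assumes c: "summ c" and g: "integrable circ g" and G: "\<And>q. G q \<in> borel_measurable borel" "\<And>q x. cmod (G q x) \<le> 1"
  shows "(\<integral>x. g x * tsum (\<lambda>q. c q * G q x) \<partial>circ) = tsum (\<lambda>q. c q * (\<integral>x. g x * G q x \<partial>circ))"
    and "integrable circ (\<lambda>x. g x * tsum (\<lambda>q. c q * G q x))"
proof -
  define f where "f = (\<lambda>q x. c q * (g x * G q x))"
  have m: "f q \<in> borel_measurable circ" for q
    unfolding f_def using borel_measurable_integrable[OF g] measurable_circ[OF G(1)] by auto
  have "(\<integral>\<^sup>+x. \<integral>\<^sup>+q. ennreal (cmod (f q x)) \<partial>count_space UNIV \<partial>circ)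
     \<le> (\<integral>\<^sup>+x. \<integral>\<^sup>+q. ennreal (cmod (c q)) * ennreal (cmod (g x)) \<partial>count_space UNIV \<partial>circ)"
  proof (intro nn_integral_mono)
    fix x q
    have "cmod (c q) * (cmod (g x) * cmod (G q x)) \<le> cmod (c q) * (cmod (g x) * 1)"
      by (intro mult_left_mono G) auto
    then show "ennreal (cmod (f q x)) \<le> ennreal (cmod (c q)) * ennreal (cmod (g x))"
      by (simp add: f_def norm_mult ennreal_leI flip: ennreal_mult)
  qed
  also have "\<dots> = nsum (\<lambda>q. ennreal (cmod (c q))) * (\<integral>\<^sup>+x. ennreal (cmod (g x)) \<partial>circ)"
    using g by (simp add: nn_integral_multc nn_integral_cmult)
  also have "\<dots> < \<infinity>"
    using c g by (simp add: integrable_iff_bounded ennreal_mult_less_top)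
  finally have bd: "(\<integral>\<^sup>+x. \<integral>\<^sup>+q. ennreal (cmod (f q x)) \<partial>count_space UNIV \<partial>circ) < \<infinity>" .
  have e: "tsum (\<lambda>q. f q x) = g x * tsum (\<lambda>q. c q * G q x)" for x
  proof -
    have "(\<lambda>q. f q x) = (\<lambda>q. g x * (c q * G q x))" by (auto simp: f_def)
    then show ?thesis by simp
  qed
  show "integrable circ (\<lambda>x. g x * tsum (\<lambda>q. c q * G q x))"
    using integrable_tsum[OF sigma_finite_circ m bd] by (simp add: e)
  show "(\<integral>x. g x * tsum (\<lambda>q. c q * G q x) \<partial>circ) = tsum (\<lambda>q. c q * (\<integral>x. g x * G q x \<partial>circ))"
    using integral_tsum[OF sigma_finite_circ m bd] by (simp add: e) (simp add: f_def)
qed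

lemma integrable_ser: "summ c \<Longrightarrow> integrable circ (ser c)"
  using circ_swap(2)[of c "\<lambda>_. 1" ex] by (simp add: ser_def[abs_def])

lemma fourier_ser:
  fixes c :: "int \<Rightarrow> complex" assumes "summ c" shows "fourier (ser c) m = 2 * pi * c m"
proof -
  have "fourier (ser c) m = (\<integral>x. ex (- m) x * ser c x \<partial>circ)" by (simp add: fourier_eq mult.commute)
  also have "\<dots> = tsum (\<lambda>n. c n * (\<integral>x. ex (- m) x * ex n x \<partial>circ))"
    unfolding ser_def by (rule circ_swap) (auto simp: assms intro!: integrable_circ_bounded[where B = 1])
  also have "\<dots> = tsum (\<lambda>n. (2 * pi * c m) * of_bool (n = m))"
    by (intro arg_cong[of _ _ tsum] ext) (auto simp: integral_ex simp flip: ex_add)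
  also have "\<dots> = 2 * pi * c m"
  proof -
    have "tsum (\<lambda>n. of_bool (n = m) :: complex) = 1"
      using lebesgue_integral_count_space_finite_support[of UNIV "\<lambda>n. of_bool (n = m) :: complex"] by simp
    then show ?thesis by simp
  qed
  finally show ?thesis .
qed

text \<open>Normalised so that f is the sum of \<open>coef f n * ex n\<close>; products of functions
  then become convolutions without factors of 2 pi.\<close>

definition coef :: "(real \<Rightarrow> complex) \<Rightarrow> int \<Rightarrow> complex" where "coef f n = fourier f n / (2 * pi)"

lemma fourier_coef: "fourier f n = 2 * pi * coef f n"
  by (simp add: coef_def)

lemma fourier_inversion:
  assumes "integrable circ f" "summ (coef f)" shows "AE x in circ. f x = ser (coef f) x"
  by (rule fourier_unique[OF assms(1) integrable_ser[OF assms(2)]]) (unfold fourier_ser[OF assms(2)], rule fourier_coef)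

lemma fourier_cong_AE:
  assumes "AE x in circ. f x = g x" "f \<in> borel_measurable circ" "g \<in> borel_measurable circ"
  shows "fourier f n = fourier g n"
  unfolding fourier_eq by (rule integral_cong_AE) (use assms in auto)

text \<open>Only \<open>f\<close> is expanded into its series and integrated term by term against
  \<open>g\<close>. Integrability of \<open>g\<close> is enough, which allows \<open>g\<close> to be
  the nonlinearity or a weak derivative.\<close>

lemma parseval_cnj:
  assumes "integrable circ f" "summ (coef f)" "integrable circ g"
  shows "(\<integral>x. g x * cnj (f x) \<partial>circ) = 2 * pi * tsum (\<lambda>n. coef g n * cnj (coef f n))"
    and "integrable circ (\<lambda>x. g x * cnj (f x))"
proof -
  have c: "summ (\<lambda>n. cnj (coef f n))" using assms(2) by simp
  have cs: "cnj (ser (coef f) x) = tsum (\<lambda>n. cnj (coef f n) * ex (- n) x)" for x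
    by (simp add: ser_def cnj_ex flip: integral_cnj')
  have e: "(\<integral>x. g x * cnj (ser (coef f) x) \<partial>circ) = tsum (\<lambda>n. cnj (coef f n) * (\<integral>x. g x * ex (- n) x \<partial>circ))"
    and i: "integrable circ (\<lambda>x. g x * cnj (ser (coef f) x))"
    unfolding cs by (rule circ_swap[OF c assms(3)]; simp)+
  have m: "(\<lambda>x. g x * cnj (f x)) \<in> borel_measurable circ"
    using assms(1,3) by (intro borel_measurable_times borel_measurable_cnj) auto
  have ae: "AE x in circ. g x * cnj (f x) = g x * cnj (ser (coef f) x)"
    using fourier_inversion[OF assms(1,2)] by eventually_elim simp
  have "(\<integral>x. g x * cnj (f x) \<partial>circ) = (\<integral>x. g x * cnj (ser (coef f) x) \<partial>circ)"
    by (rule integral_cong_AE[OF m _ ae]) (use i in auto)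
  also have "\<dots> = tsum (\<lambda>n. 2 * pi * (coef g n * cnj (coef f n)))"
    unfolding e fourier_eq[symmetric] fourier_coef by (simp add: ac_simps)
  finally show "(\<integral>x. g x * cnj (f x) \<partial>circ) = 2 * pi * tsum (\<lambda>n. coef g n * cnj (coef f n))" by simp
  show "integrable circ (\<lambda>x. g x * cnj (f x))"
    using i ae m by (subst integrable_cong_AE[OF m _ ae]) auto
qed

lemma tsum_times:
  fixes u :: "'a::countable \<Rightarrow> complex" and v :: "'b::countable \<Rightarrow> complex"
  assumes "summ u" "summ v"
  shows "summ (\<lambda>(p, r). u p * v r)" "tsum (\<lambda>(p, r). u p * v r) = tsum u * tsum v"
proof -
  have "nsum (\<lambda>x. ennreal (cmod (case x of (p, r) \<Rightarrow> u p * v r)))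
     = nsum (\<lambda>(p, r). ennreal (cmod (u p)) * ennreal (cmod (v r)))"
    by (rule nn_integral_cong) (auto simp: norm_mult ennreal_mult)
  also have "\<dots> < \<infinity>"
    using assms unfolding nn_sum2 by (simp add: summ_iff ennreal_mult_less_top)
  finally show s: "summ (\<lambda>(p, r). u p * v r)" by (simp add: summ_iff)
  show "tsum (\<lambda>(p, r). u p * v r) = tsum u * tsum v"
    by (subst tsum_pair(1)[OF s]) simp
qed

text \<open>|f|^2 is written as an absolutely convergent double series, and the third factor,
  multiplied by a character, is integrated against it term by term.\<close>

lemma coef_cubic:
  assumes f: "integrable circ f" "summ (coef f)"
  shows "coef (\<lambda>x. of_real ((cmod (f x))\<^sup>2) * f x) n = cub (coef f) (coef f) (coef f) n"
    and "integrable circ (\<lambda>x. of_real ((cmod (f x))\<^sup>2) * f x)"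
proof -
  define c where "c = (\<lambda>(p, r). coef f p * cnj (coef f r))"
  define G where "G = (\<lambda>(p, r). ex (p - r))"
  have c: "summ c" unfolding c_def by (rule tsum_times) (use f in auto)
  have sq: "complex_of_real ((cmod (ser (coef f) x))\<^sup>2) = tsum (\<lambda>q. c q * G q x)" for x
  proof -
    have "complex_of_real ((cmod (ser (coef f) x))\<^sup>2) = ser (coef f) x * cnj (ser (coef f) x)"
      by (rule complex_norm_square)
    also have "cnj (ser (coef f) x) = tsum (\<lambda>n. cnj (coef f n * ex n x))"
      by (simp add: ser_def flip: integral_cnj')
    also have "ser (coef f) x * \<dots> = tsum (\<lambda>(p, r). (coef f p * ex p x) * cnj (coef f r * ex r x))"
      unfolding ser_def
      by (rule tsum_times(2)[symmetric]) (use summ_ser[OF f(2), of x] in \<open>simp_all del: complex_cnj_mult\<close>)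
    also have "(\<lambda>(p, r). (coef f p * ex p x) * cnj (coef f r * ex r x)) = (\<lambda>q. c q * G q x)"
      by (auto simp: c_def G_def cnj_ex ex_diff)
    finally show ?thesis .
  qed
  have G: "G q \<in> borel_measurable borel" "cmod (G q x) \<le> 1" for q x
    by (cases q; simp add: G_def)+
  have ae: "AE x in circ. of_real ((cmod (f x))\<^sup>2) * f x = f x * tsum (\<lambda>q. c q * G q x)"
    using fourier_inversion[OF f] by eventually_elim (simp add: mult.commute flip: sq)
  have i: "integrable circ (\<lambda>x. f x * tsum (\<lambda>q. c q * G q x))"
    by (rule circ_swap(2)[OF c f(1) G])
  have m: "(\<lambda>x. of_real ((cmod (f x))\<^sup>2) * f x) \<in> borel_measurable circ"
    using f(1) by auto
  show "integrable circ (\<lambda>x. of_real ((cmod (f x))\<^sup>2) * f x)"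
    using i by (subst integrable_cong_AE[OF m _ ae]) auto
  have "fourier (\<lambda>x. of_real ((cmod (f x))\<^sup>2) * f x) n = fourier (\<lambda>x. f x * tsum (\<lambda>q. c q * G q x)) n"
    by (rule fourier_cong_AE[OF ae m]) (use i in auto)
  also have "\<dots> = (\<integral>x. (f x * ex (- n) x) * tsum (\<lambda>q. c q * G q x) \<partial>circ)"
    unfolding fourier_eq by (simp add: ac_simps)
  also have "\<dots> = tsum (\<lambda>q. c q * (\<integral>x. f x * ex (- n) x * G q x \<partial>circ))"
    by (rule circ_swap(1)[OF c integrable_mult_ex[OF f(1)] G])
  also have "\<dots> = tsum (\<lambda>q. 2 * pi * (case q of (p, r) \<Rightarrow> coef f p * cnj (coef f r) * coef f (n - p + r)))"
  proof (intro arg_cong[of _ _ tsum] ext)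
    fix q :: "int \<times> int"
    obtain p r where q: "q = (p, r)" by (cases q)
    have "(\<integral>x. f x * ex (- n) x * G q x \<partial>circ) = fourier f (n - p + r)"
      unfolding fourier_eq by (intro Bochner_Integration.integral_cong) (simp_all add: q G_def mult.assoc algebra_simps flip: ex_add)
    then show "c q * (\<integral>x. f x * ex (- n) x * G q x \<partial>circ)
        = 2 * pi * (case q of (p, r) \<Rightarrow> coef f p * cnj (coef f r) * coef f (n - p + r))"
      by (simp add: q c_def fourier_coef)
  qed
  also have "\<dots> = 2 * pi * cub (coef f) (coef f) (coef f) n" by (simp add: cub_def)
  finally show "coef (\<lambda>x. of_real ((cmod (f x))\<^sup>2) * f x) n = cub (coef f) (coef f) (coef f) n"
    by (simp add: coef_def)
qed

lemma coef_potential: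
  assumes f: "integrable circ f" "summ (coef f)" and g: "integrable circ g"
  shows "coef (\<lambda>x. g x * f x) n = lin (coef g) (coef f) n" and "integrable circ (\<lambda>x. g x * f x)"
proof -
  have ae: "AE x in circ. g x * f x = g x * ser (coef f) x"
    using fourier_inversion[OF f] by eventually_elim simp
  have i: "integrable circ (\<lambda>x. g x * ser (coef f) x)"
    unfolding ser_def by (rule circ_swap(2)[OF f(2) g]) auto
  have m: "(\<lambda>x. g x * f x) \<in> borel_measurable circ"
    using f(1) g by auto
  show "integrable circ (\<lambda>x. g x * f x)"
    using i by (subst integrable_cong_AE[OF m _ ae]) auto
  have "fourier (\<lambda>x. g x * f x) n = fourier (\<lambda>x. g x * ser (coef f) x) n"
    by (rule fourier_cong_AE[OF ae m]) (use i in auto)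
  also have "\<dots> = (\<integral>x. (g x * ex (- n) x) * ser (coef f) x \<partial>circ)"
    unfolding fourier_eq by (simp add: ac_simps)
  also have "\<dots> = tsum (\<lambda>m. coef f m * (\<integral>x. g x * ex (- n) x * ex m x \<partial>circ))"
    unfolding ser_def by (rule circ_swap(1)[OF f(2) integrable_mult_ex[OF g]]) auto
  also have "\<dots> = tsum (\<lambda>m. 2 * pi * (coef g (n - m) * coef f m))"
  proof (intro arg_cong[of _ _ tsum] ext)
    fix m
    have "(\<integral>x. g x * ex (- n) x * ex m x \<partial>circ) = fourier g (n - m)"
      unfolding fourier_eq by (intro Bochner_Integration.integral_cong) (simp_all add: mult.assoc algebra_simps flip: ex_add)
    then show "coef f m * (\<integral>x. g x * ex (- n) x * ex m x \<partial>circ) = 2 * pi * (coef g (n - m) * coef f m)"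
      by (simp add: fourier_coef)
  qed
  also have "\<dots> = 2 * pi * lin (coef g) (coef f) n" by (simp add: lin_def)
  finally show "coef (\<lambda>x. g x * f x) n = lin (coef g) (coef f) n"
    by (simp add: coef_def)
qed

lemma coef_add:
  assumes "integrable circ f" "integrable circ g" shows "coef (\<lambda>x. f x + g x) n = coef f n + coef g n"
  using integrable_mult_ex[OF assms(1)] integrable_mult_ex[OF assms(2)]
  by (simp add: coef_def fourier_eq ring_distribs add_divide_distrib)

lemma coef_diff:
  assumes "integrable circ f" "integrable circ g" shows "coef (\<lambda>x. f x - g x) n = coef f n - coef g n"
  using integrable_mult_ex[OF assms(1)] integrable_mult_ex[OF assms(2)]
  by (simp add: coef_def fourier_eq ring_distribs diff_divide_distrib left_diff_distrib)

lemma coef_nonlin: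
  assumes f: "integrable circ f" "summ (coef f)" and lam: "integrable circ (\<lambda>x. complex_of_real (lam x))"
  shows "coef (nonlin lam f) = nls_rhs (coef (\<lambda>x. of_real (lam x))) (coef f)" and "integrable circ (nonlin lam f)"
proof -
  note 1 = coef_cubic[OF f] and 2 = coef_potential[OF f lam]
  show "coef (nonlin lam f) = nls_rhs (coef (\<lambda>x. of_real (lam x))) (coef f)"
    unfolding nonlin_def[abs_def] by (rule ext) (simp only: coef_add[OF 1(2) 2(2)] 1(1) 2(1) nls_rhs_def)
  show "integrable circ (nonlin lam f)"
    unfolding nonlin_def[abs_def] by (intro Bochner_Integration.integrable_add 1 2)
qed

section \<open>Weak derivatives and the energy\<close>

lemma tsum_bound_finite:
  assumes "\<And>F. finite F \<Longrightarrow> (\<Sum>x\<in>F. f x) \<le> B" "\<And>x. f x \<ge> 0"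
  shows "summ f" "tsum f \<le> (B::real)"
proof -
  have s: "f summable_on UNIV"
    by (rule nonneg_bdd_above_summable_on) (use assms in \<open>auto intro!: bdd_aboveI\<close>)
  then show "summ f" using summ_iff_summable_on[of f] assms(2) by simp
  then have "tsum f = infsum f UNIV" by (rule tsum_eq_infsum)
  also have "\<dots> \<le> B" by (rule infsum_le_finite_sums[OF s]) (use assms in auto)
  finally show "tsum f \<le> B" .
qed

section \<open>Bessel's inequality and the Riesz-Fischer theorem\<close>

definition trig :: "int set \<Rightarrow> (int \<Rightarrow> complex) \<Rightarrow> real \<Rightarrow> complex" where
  "trig I c x = (\<Sum>n\<in>I. c n * ex n x)"

lemma trig_borel [measurable]: "trig I c \<in> borel_measurable borel"
  unfolding trig_def[abs_def] by measurable

lemma integrable_trig: "integrable circ (trig I c)"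
  unfolding trig_def[abs_def]
  by (intro Bochner_Integration.integrable_sum Bochner_Integration.integrable_mult_right integrable_circ_bounded[where B = 1]) auto

lemma fourier_trig:
  fixes c :: "int \<Rightarrow> complex"
  assumes I: "finite I" shows "fourier (trig I c) m = (if m \<in> I then 2 * pi * c m else 0)"
proof -
  have i: "integrable circ (ex n)" for n by (intro integrable_circ_bounded[where B = 1]) auto
  have "fourier (trig I c) m = (\<integral>x. (\<Sum>n\<in>I. c n * ex (n - m) x) \<partial>circ)"
    unfolding fourier_eq trig_def by (simp add: sum_distrib_right mult.assoc flip: ex_add)
  also have "\<dots> = (\<Sum>n\<in>I. \<integral>x. c n * ex (n - m) x \<partial>circ)"
    by (rule Bochner_Integration.integral_sum) (use i in auto)
  also have "\<dots> = (\<Sum>n\<in>I. if n = m then 2 * pi * c m else 0)"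
    by (rule sum.cong) (auto simp: integral_ex)
  finally show ?thesis using I by simp
qed

lemma integral_mult_cnj_trig:
  assumes "integrable circ g"
  shows "(\<integral>x. g x * cnj (trig I c x) \<partial>circ) = (\<Sum>n\<in>I. cnj (c n) * fourier g n)"
proof -
  have "(\<integral>x. g x * cnj (trig I c x) \<partial>circ) = (\<integral>x. (\<Sum>n\<in>I. cnj (c n) * (g x * ex (- n) x)) \<partial>circ)"
    by (simp add: trig_def sum_distrib_left cnj_ex mult.left_commute)
  also have "\<dots> = (\<Sum>n\<in>I. \<integral>x. cnj (c n) * (g x * ex (- n) x) \<partial>circ)"
    by (rule Bochner_Integration.integral_sum) (use integrable_mult_ex[OF assms] in auto)
  finally show ?thesis by (simp add: fourier_eq)
qed

lemma norm_trig_sq: "finite I \<Longrightarrow> (\<integral>x. (cmod (trig I c x))\<^sup>2 \<partial>circ) = 2 * pi * (\<Sum>n\<in>I. (cmod (c n))\<^sup>2)"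
proof -
  assume I: "finite I"
  have "complex_of_real (\<integral>x. (cmod (trig I c x))\<^sup>2 \<partial>circ) = (\<integral>x. trig I c x * cnj (trig I c x) \<partial>circ)"
    unfolding complex_norm_square[symmetric] by (rule integral_complex_of_real[symmetric])
  also have "\<dots> = (\<Sum>n\<in>I. cnj (c n) * fourier (trig I c) n)" by (rule integral_mult_cnj_trig[OF integrable_trig])
  also have "\<dots> = (\<Sum>n\<in>I. 2 * pi * complex_of_real ((cmod (c n))\<^sup>2))"
    by (rule sum.cong) (use I in \<open>auto simp: fourier_trig complex_norm_square simp del: of_real_power\<close>)
  also have "\<dots> = complex_of_real (2 * pi * (\<Sum>n\<in>I. (cmod (c n))\<^sup>2))"
    by (simp add: sum_distrib_left)
  finally show ?thesis by (simp only: of_real_eq_iff)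
qed

lemma integrable_trig_sq: "integrable circ (\<lambda>x. (cmod (trig I c x))\<^sup>2)"
proof (rule integrable_circ_bounded)
  show "norm ((cmod (trig I c x))\<^sup>2) \<le> (\<Sum>n\<in>I. cmod (c n))\<^sup>2" for x
    unfolding trig_def by (simp, intro power_mono sum_norm_le) (auto simp: norm_mult)
qed (auto intro!: borel_measurable_power borel_measurable_norm measurable_circ)

lemma bessel:
  assumes g: "integrable circ g" "integrable circ (\<lambda>x. (cmod (g x))\<^sup>2)" and I: "finite I"
  shows "(\<Sum>n\<in>I. (cmod (coef g n))\<^sup>2) \<le> (\<integral>x. (cmod (g x))\<^sup>2 \<partial>circ) / (2 * pi)"
proof -
  define t where "t = trig I (coef g)"
  have it: "integrable circ (\<lambda>x. (cmod (t x))\<^sup>2)"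
    unfolding t_def by (rule integrable_trig_sq)
  have ig: "integrable circ (\<lambda>x. g x * cnj (t x))"
  proof (rule Bochner_Integration.integrable_bound[of _ "\<lambda>x. (cmod (g x))\<^sup>2 + (cmod (t x))\<^sup>2"])
    show "AE x in circ. cmod (g x * cnj (t x)) \<le> norm ((cmod (g x))\<^sup>2 + (cmod (t x))\<^sup>2)"
    proof (rule AE_I2)
      fix x
      have "2 * (cmod (g x) * cmod (t x)) \<le> (cmod (g x))\<^sup>2 + (cmod (t x))\<^sup>2"
        using sum_squares_bound[of "cmod (g x)" "cmod (t x)"] by simp
      moreover have "0 \<le> cmod (g x) * cmod (t x)" by simp
      ultimately have "cmod (g x) * cmod (t x) \<le> (cmod (g x))\<^sup>2 + (cmod (t x))\<^sup>2" by linarith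
      then show "cmod (g x * cnj (t x)) \<le> norm ((cmod (g x))\<^sup>2 + (cmod (t x))\<^sup>2)"
        by (simp add: norm_mult)
    qed
    show "(\<lambda>x. g x * cnj (t x)) \<in> borel_measurable circ"
      by (rule borel_measurable_times[OF borel_measurable_integrable[OF g(1)] borel_measurable_cnj[OF measurable_circ]])
        (simp add: t_def)
  qed (use g it in auto)
  define q where "q = (\<lambda>x. g x * cnj (t x))"
  have pw: "(cmod (g x - t x))\<^sup>2 = (cmod (g x))\<^sup>2 - 2 * Re (q x) + (cmod (t x))\<^sup>2" for x
    unfolding q_def cmod_power2 by (simp add: power2_eq_square algebra_simps)
  have "0 \<le> (\<integral>x. (cmod (g x - t x))\<^sup>2 \<partial>circ)" by simp
  also have "\<dots> = (\<integral>x. (cmod (g x))\<^sup>2 \<partial>circ) - 2 * Re (\<integral>x. q x \<partial>circ) + (\<integral>x. (cmod (t x))\<^sup>2 \<partial>circ)"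
    unfolding pw using g(2) ig[folded q_def] it by simp
  also have "(\<integral>x. q x \<partial>circ) = (\<Sum>n\<in>I. 2 * pi * complex_of_real ((cmod (coef g n))\<^sup>2))"
    unfolding q_def t_def integral_mult_cnj_trig[OF g(1)]
    by (rule sum.cong) (auto simp: fourier_coef complex_norm_square simp del: of_real_power)
  also have "\<dots> = complex_of_real (2 * pi * (\<Sum>n\<in>I. (cmod (coef g n))\<^sup>2))"
    by (simp add: sum_distrib_left)
  also have "(\<integral>x. (cmod (t x))\<^sup>2 \<partial>circ) = 2 * pi * (\<Sum>n\<in>I. (cmod (coef g n))\<^sup>2)"
    unfolding t_def by (rule norm_trig_sq[OF I])
  finally show ?thesis by (simp add: field_simps)
qed

text \<open>From |h| \<le> e/2 + |h|^2/(2 e), integrated over an interval of length 2 pi; the two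
  terms give pi e and e/2.\<close>

lemma L1_le_L2:
  assumes "integrable circ (\<lambda>x. (cmod (h x))\<^sup>2)" "h \<in> borel_measurable circ" "e > 0" "(\<integral>x. (cmod (h x))\<^sup>2 \<partial>circ) \<le> e\<^sup>2"
  shows "(\<integral>x. cmod (h x) \<partial>circ) \<le> (pi + 1 / 2) * e"
proof -
  have "(\<integral>x. cmod (h x) \<partial>circ) \<le> (\<integral>x. e / 2 + (cmod (h x))\<^sup>2 / (2 * e) \<partial>circ)"
  proof (rule integral_mono')
    fix x
    have "2 * e * cmod (h x) \<le> e\<^sup>2 + (cmod (h x))\<^sup>2" by (rule sum_squares_bound)
    then show "cmod (h x) \<le> e / 2 + (cmod (h x))\<^sup>2 / (2 * e)"
      using assms(3) by (simp add: field_simps power2_eq_square)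
  qed (use assms in auto)
  also have "\<dots> = pi * e + (\<integral>x. (cmod (h x))\<^sup>2 \<partial>circ) / (2 * e)"
    using assms(1) by (simp add: space_circ measure_circ)
  also have "\<dots> \<le> pi * e + e\<^sup>2 / (2 * e)"
    using assms(3,4) by (intro add_left_mono divide_right_mono) auto
  also have "\<dots> = (pi + 1 / 2) * e" using assms(3) by (simp add: field_simps power2_eq_square)
  finally show ?thesis .
qed

text \<open>\<open>grad\<close> is a choice, so the energy is meaningful only if a weak derivative
  exists; this theorem supplies it. Partial sums are taken along finite index sets that exhaust the
  coefficients so fast that later partial sums differ from the k-th by at most 2^(-k) in L^2. The
  differences are then summable in L^1, whence convergence almost everywhere, and Fatou's lemma
  carries the L^2 bounds to the limit.\<close>

theorem riesz_fischer:
  assumes c: "summ (\<lambda>n. (cmod (c n))\<^sup>2)"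
  obtains g where "g \<in> L2_circle" "\<And>n. coef g n = c n"
proof -
  define b where "b = (\<lambda>n. (cmod (c n))\<^sup>2)"
  have bs: "b summable_on UNIV" using c summ_iff_summable_on[of b] by (simp add: b_def)
  have "\<exists>F. finite F \<and> (\<forall>G. finite G \<and> G \<inter> F = {} \<longrightarrow> sum b G \<le> e)" if e0: "e > 0" for e
  proof -
    obtain F where F: "finite F" "sum b F > infsum b UNIV - e"
    proof -
      have "(sum b \<longlongrightarrow> infsum b UNIV) (finite_subsets_at_top UNIV)"
        using bs by (simp add: infsum_tendsto)
      then have "\<forall>\<^sub>F F in finite_subsets_at_top UNIV. sum b F > infsum b UNIV - e"
        using e0 by (intro order_tendstoD(1)) auto
      then show ?thesis using that by (auto simp: eventually_finite_subsets_at_top intro: that)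
    qed
    have "sum b G \<le> e" if "finite G" "G \<inter> F = {}" for G
    proof -
      have "sum b (F \<union> G) \<le> infsum b UNIV"
        by (rule finite_sum_le_infsum[OF bs]) (use F that in \<open>auto simp: b_def\<close>)
      moreover have "sum b (F \<union> G) = sum b F + sum b G"
        by (rule sum.union_disjoint) (use F that in auto)
      ultimately show ?thesis using F by simp
    qed
    then show ?thesis using F by blast
  qed
  then have "\<forall>k. \<exists>F. finite F \<and> (\<forall>G. finite G \<and> G \<inter> F = {} \<longrightarrow> sum b G \<le> (1 / 4) ^ k / (2 * pi))" by simp
  then obtain F where F: "\<And>k. finite (F k)" "\<And>k G. finite G \<Longrightarrow> G \<inter> F k = {} \<Longrightarrow> sum b G \<le> (1 / 4) ^ k / (2 * pi)"
    by metis
  \<comment> \<open>Cumulative unions make the index sets increase, so a difference of later partial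
    sums has all its frequencies outside \<open>F k\<close>.\<close>
  define J where "J = (\<lambda>k. \<Union>i\<le>k. F i)"
  have J: "finite (J k)" "J k \<subseteq> J (Suc k)" "F k \<subseteq> J k" for k
    using F by (auto simp: J_def intro: le_SucI)
  have Jm: "J k \<subseteq> J m" if "k \<le> m" for k m using that by (fastforce simp: J_def)
  define u where "u = (\<lambda>k. trig (J k) c)"
  have u_diff: "u m x - u k x = trig (J m - J k) c x" if "k \<le> m" for k m x
    using sum.subset_diff[OF Jm[OF that] J(1)[of m], of "\<lambda>n. c n * ex n x"] by (simp add: u_def trig_def)
  have u_bd: "(\<integral>x. (cmod (u m x - u k x))\<^sup>2 \<partial>circ) \<le> (1 / 4) ^ k" if "k \<le> m" for k m
  proof -
    have "sum b (J m - J k) \<le> (1 / 4) ^ k / (2 * pi)"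
      by (rule F(2)) (use J(1)[of m] J(3)[of k] in auto)
    then show ?thesis
      unfolding u_diff[OF that] using norm_trig_sq[of "J m - J k" c] J(1) by (simp add: b_def field_simps)
  qed
  have um: "u k \<in> borel_measurable borel" for k by (simp add: u_def)
  have u_i2: "integrable circ (\<lambda>x. (cmod (u m x - u k x))\<^sup>2)" if "k \<le> m" for k m
    unfolding u_diff[OF that] by (rule integrable_trig_sq)
  have l1: "(\<integral>x. cmod (u (Suc k) x - u k x) \<partial>circ) \<le> (pi + 1 / 2) * (1 / 2) ^ k" for k
  proof (rule L1_le_L2)
    have "((1 / 2) ^ k)\<^sup>2 = (1 / 4 :: real) ^ k" by (simp add: power2_eq_square flip: power_mult_distrib)
    then show "(\<integral>x. (cmod (u (Suc k) x - u k x))\<^sup>2 \<partial>circ) \<le> ((1 / 2) ^ k)\<^sup>2" using u_bd[of k "Suc k"] by simp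
  qed (use u_i2[of k "Suc k"] um in \<open>auto intro!: measurable_circ\<close>)
  have conv: "AE x in circ. convergent (\<lambda>k. u k x)"
  proof -
    have "(\<integral>\<^sup>+x. (\<Sum>k. ennreal (cmod (u (Suc k) x - u k x))) \<partial>circ) = (\<Sum>k. \<integral>\<^sup>+x. ennreal (cmod (u (Suc k) x - u k x)) \<partial>circ)"
      using um by (intro nn_integral_suminf) (auto intro!: measurable_circ)
    also have "\<dots> \<le> (\<Sum>k. ennreal ((pi + 1 / 2) * (1 / 2) ^ k))"
    proof (intro suminf_le summableI)
      fix k
      have "integrable circ (\<lambda>x. u (Suc k) x - u k x)"
        unfolding u_def by (intro Bochner_Integration.integrable_diff integrable_trig)
      then show "(\<integral>\<^sup>+x. ennreal (cmod (u (Suc k) x - u k x)) \<partial>circ) \<le> ennreal ((pi + 1 / 2) * (1 / 2) ^ k)"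
        using l1[of k] by (subst nn_integral_eq_integral) (auto intro!: ennreal_leI)
    qed
    also have "\<dots> < \<infinity>"
    proof -
      have "summable (\<lambda>k. (pi + 1 / 2) * (1 / 2) ^ k)" by (intro summable_mult summable_geometric) auto
      then show ?thesis by (subst suminf_ennreal2) auto
    qed
    finally have "(\<integral>\<^sup>+x. (\<Sum>k. ennreal (cmod (u (Suc k) x - u k x))) \<partial>circ) \<noteq> \<infinity>" by simp
    then have "AE x in circ. (\<Sum>k. ennreal (cmod (u (Suc k) x - u k x))) \<noteq> \<infinity>"
      using um by (intro nn_integral_PInf_AE) (auto intro!: measurable_circ)
    then show ?thesis
    proof eventually_elim
      case (elim x)
      then have "summable (\<lambda>k. cmod (u (Suc k) x - u k x))" by (intro summable_suminf_not_top) auto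
      then have "summable (\<lambda>k. u (Suc k) x - u k x)" by (rule summable_norm_cancel)
      from tendsto_add[OF summable_LIMSEQ[OF this] tendsto_const[of "u 0 x"]]
      have "(\<lambda>n. u n x) \<longlonglongrightarrow> (\<Sum>k. u (Suc k) x - u k x) + u 0 x"
        by (simp add: sum_lessThan_telescope[of "\<lambda>n. u n x"])
      then show ?case by (rule convergentI)
    qed
  qed
  \<comment> \<open>The limit is formed at every point. Where the sequence diverges,
    \<open>lim\<close> still depends on the sequence alone, which keeps \<open>g\<close>
    periodic.\<close>
  define g where "g = (\<lambda>x. lim (\<lambda>k. u k x))"
  have gm: "g \<in> borel_measurable borel" unfolding g_def using um by measurable
  have lim: "AE x in circ. (\<lambda>k. u k x) \<longlonglongrightarrow> g x"
    using conv by eventually_elim (simp add: g_def convergent_LIMSEQ_iff)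
  have fat: "(\<integral>\<^sup>+x. ennreal ((cmod (g x - u k x))\<^sup>2) \<partial>circ) \<le> ennreal ((1 / 4) ^ k)" for k
  proof -
    have "(\<integral>\<^sup>+x. ennreal ((cmod (g x - u k x))\<^sup>2) \<partial>circ) = (\<integral>\<^sup>+x. liminf (\<lambda>m. ennreal ((cmod (u m x - u k x))\<^sup>2)) \<partial>circ)"
    proof (rule nn_integral_cong_AE)
      show "AE x in circ. ennreal ((cmod (g x - u k x))\<^sup>2) = liminf (\<lambda>m. ennreal ((cmod (u m x - u k x))\<^sup>2))"
        using lim
      proof eventually_elim
        case (elim x)
        then have "(\<lambda>m. ennreal ((cmod (u m x - u k x))\<^sup>2)) \<longlonglongrightarrow> ennreal ((cmod (g x - u k x))\<^sup>2)"
          by (intro tendsto_intros)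
        then show ?case by (rule lim_imp_Liminf[OF trivial_limit_sequentially, symmetric])
      qed
    qed
    also have "\<dots> \<le> liminf (\<lambda>m. \<integral>\<^sup>+x. ennreal ((cmod (u m x - u k x))\<^sup>2) \<partial>circ)"
      using um by (intro nn_integral_liminf) (auto intro!: measurable_circ)
    also have "\<dots> \<le> ennreal ((1 / 4) ^ k)"
    proof (rule Liminf_le)
      show "\<forall>\<^sub>F m in sequentially. (\<integral>\<^sup>+x. ennreal ((cmod (u m x - u k x))\<^sup>2) \<partial>circ) \<le> ennreal ((1 / 4) ^ k)"
        using eventually_ge_at_top[of k]
      proof eventually_elim
        case (elim m)
        then show ?case using u_i2[of k m] u_bd[of k m] by (subst nn_integral_eq_integral) (auto intro!: ennreal_leI)
      qed
    qed simp
    finally show ?thesis .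
  qed
  have gi: "integrable circ (\<lambda>x. (cmod (g x - u k x))\<^sup>2)" for k
  proof (rule integrableI_bounded)
    show "(\<lambda>x. (cmod (g x - u k x))\<^sup>2) \<in> borel_measurable circ" using gm um by (auto intro!: measurable_circ)
    show "(\<integral>\<^sup>+x. ennreal (norm ((cmod (g x - u k x))\<^sup>2)) \<partial>circ) < \<infinity>"
      using fat[of k] by (simp add: le_less_trans)
  qed
  have gb: "(\<integral>x. (cmod (g x - u k x))\<^sup>2 \<partial>circ) \<le> (1 / 4) ^ k" for k
    using fat[of k] nn_integral_eq_integral[OF gi[of k]] by simp
  have gL2: "g \<in> L2_circle"
  proof -
    have "circle_fun g"
      unfolding circle_fun_def g_def u_def trig_def by (simp add: ex_period)
    moreover have "integrable circ (\<lambda>x. (cmod (g x))\<^sup>2)"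
    proof (rule Bochner_Integration.integrable_bound[of _ "\<lambda>x. 2 * (cmod (g x - u 0 x))\<^sup>2 + 2 * (cmod (u 0 x))\<^sup>2"])
      show "AE x in circ. norm ((cmod (g x))\<^sup>2) \<le> norm (2 * (cmod (g x - u 0 x))\<^sup>2 + 2 * (cmod (u 0 x))\<^sup>2)"
      proof (rule AE_I2)
        fix x
        have "cmod (g x) \<le> cmod (g x - u 0 x) + cmod (u 0 x)" by norm
        then have "(cmod (g x))\<^sup>2 \<le> (cmod (g x - u 0 x) + cmod (u 0 x))\<^sup>2" by (intro power_mono) auto
        also have "\<dots> \<le> 2 * (cmod (g x - u 0 x))\<^sup>2 + 2 * (cmod (u 0 x))\<^sup>2"
          using sum_squares_bound[of "cmod (g x - u 0 x)" "cmod (u 0 x)"] by (simp add: power2_sum)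
        finally show "norm ((cmod (g x))\<^sup>2) \<le> norm (2 * (cmod (g x - u 0 x))\<^sup>2 + 2 * (cmod (u 0 x))\<^sup>2)" by simp
      qed
    qed (use gi[of 0] integrable_trig_sq gm in \<open>auto simp: u_def intro!: measurable_circ\<close>)
    ultimately show ?thesis using gm by (simp add: L2_circle_def integrable_circ_iff)
  qed
  have "coef g n = c n" for n
  proof -
    \<comment> \<open>A nonzero coefficient cannot stay in the tails: once the tail bound is below
      |c n|^2, the index must belong to \<open>F k\<close>.\<close>
    obtain N where N: "n \<in> J N \<or> c n = 0"
    proof (cases "c n = 0")
      case False
      have "(\<lambda>k. (1 / 4 :: real) ^ k / (2 * pi)) \<longlonglongrightarrow> 0 / (2 * pi)"
        by (intro tendsto_divide LIMSEQ_power_zero tendsto_const) auto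
      then have "\<forall>\<^sub>F k in sequentially. (1 / 4 :: real) ^ k / (2 * pi) < b n"
        by (rule order_tendstoD(2)) (use False in \<open>simp add: b_def\<close>)
      then obtain k where "(1 / 4 :: real) ^ k / (2 * pi) < b n" by (auto simp: eventually_sequentially)
      then have "n \<in> F k" using F(2)[of "{n}" k] by fastforce
      then show ?thesis using that J(3) by blast
    qed auto
    have cu: "fourier (u k) n = 2 * pi * c n" if "k \<ge> N" for k
      using N Jm[OF that] J(1)[of k] by (auto simp: u_def fourier_trig)
    have ig: "integrable circ g" by (rule L2_circleD(3)[OF gL2])
    have iu: "integrable circ (u k)" for k by (simp add: u_def integrable_trig)
    have dist: "cmod (fourier g n - fourier (u k) n) \<le> (pi + 1 / 2) * (1 / 2) ^ k" for k
    proof -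
      have "fourier g n - fourier (u k) n = (\<integral>x. (g x - u k x) * ex (- n) x \<partial>circ)"
        using integrable_mult_ex[OF ig] integrable_mult_ex[OF iu] by (simp add: fourier_eq left_diff_distrib)
      also have "cmod \<dots> \<le> (\<integral>x. cmod ((g x - u k x) * ex (- n) x) \<partial>circ)" by (rule integral_norm_bound)
      also have "\<dots> = (\<integral>x. cmod (g x - u k x) \<partial>circ)" by (simp add: norm_mult)
      also have "\<dots> \<le> (pi + 1 / 2) * (1 / 2) ^ k"
      proof (rule L1_le_L2)
        have "((1 / 2) ^ k)\<^sup>2 = (1 / 4 :: real) ^ k" by (simp add: power2_eq_square flip: power_mult_distrib)
        then show "(\<integral>x. (cmod (g x - u k x))\<^sup>2 \<partial>circ) \<le> ((1 / 2) ^ k)\<^sup>2" using gb[of k] by simp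
      qed (use gi um gm in \<open>auto intro!: measurable_circ\<close>)
      finally show ?thesis .
    qed
    have "cmod (fourier g n - 2 * pi * c n) \<le> 0"
    proof (rule LIMSEQ_le_const)
      have "(\<lambda>k. (pi + 1 / 2) * (1 / 2 :: real) ^ k) \<longlonglongrightarrow> (pi + 1 / 2) * 0"
        by (intro tendsto_mult LIMSEQ_power_zero tendsto_const) auto
      then show "(\<lambda>k. (pi + 1 / 2) * (1 / 2 :: real) ^ k) \<longlonglongrightarrow> 0" by simp
      show "\<exists>K. \<forall>k\<ge>K. cmod (fourier g n - 2 * pi * c n) \<le> (pi + 1 / 2) * (1 / 2) ^ k"
        using dist cu by (metis (no_types))
    qed
    then show ?thesis by (simp add: coef_def)
  qed
  with gL2 show ?thesis using that by blast
qed

section \<open>Smooth periodic functions and the decay of their coefficients\<close>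

lemma smooth_circle_deriv: assumes "smooth_circle g" shows "smooth_circle (deriv g)"
proof -
  have e: "(deriv ^^ k) (deriv g) = (deriv ^^ Suc k) g" for k by (simp only: funpow_Suc_right o_apply)
  have p: "deriv g (x + 2 * pi) = deriv g x" for x
  proof -
    have "(\<lambda>y. g (y + 2 * pi)) = g" using assms by (auto simp: smooth_circle_def circle_fun_def)
    then show ?thesis by (simp add: deriv_def DERIV_shift)
  qed
  show ?thesis
    unfolding smooth_circle_def circle_fun_def e using assms p unfolding smooth_circle_def by blast
qed

lemma smooth_circle_iter: "smooth_circle g \<Longrightarrow> smooth_circle ((deriv ^^ k) g)"
  by (induction k) (auto intro: smooth_circle_deriv)

lemma smooth_circle_DERIV: "smooth_circle g \<Longrightarrow> (g has_real_derivative deriv g x) (at x)"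
proof -
  assume "smooth_circle g"
  then have "(deriv ^^ 0) g differentiable at x" unfolding smooth_circle_def by blast
  then show ?thesis using DERIV_deriv_iff_real_differentiable[of g x] by simp
qed

lemma smooth_circle_continuous: "smooth_circle g \<Longrightarrow> continuous_on A g"
  using smooth_circle_DERIV DERIV_isCont continuous_at_imp_continuous_on by blast

lemma smooth_circle_bounded: assumes "smooth_circle g" obtains B where "B \<ge> 0" "\<And>x. x \<in> {0..2 * pi} \<Longrightarrow> \<bar>g x\<bar> \<le> B"
proof -
  have "compact (g ` {0..2 * pi})"
    by (intro compact_continuous_image smooth_circle_continuous assms) auto
  then obtain B where "\<forall>y\<in>g ` {0..2 * pi}. norm y \<le> B" using compact_imp_bounded bounded_iff by metis
  then show ?thesis using that[of "max 0 B"] by force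
qed

lemma smooth_circle_borel: "smooth_circle g \<Longrightarrow> g \<in> borel_measurable borel"
  by (intro borel_measurable_continuous_onI smooth_circle_continuous)

lemma smooth_circle_integrable:
  assumes "smooth_circle g" shows "integrable circ (\<lambda>x. complex_of_real (g x))"
proof -
  obtain B where "\<And>x. x \<in> {0..2 * pi} \<Longrightarrow> \<bar>g x\<bar> \<le> B" using smooth_circle_bounded[OF assms] by blast
  moreover have [measurable]: "g \<in> borel_measurable borel" by (rule smooth_circle_borel[OF assms])
  have "(\<lambda>x. complex_of_real (g x)) \<in> borel_measurable borel" by measurable
  ultimately show ?thesis
    by (intro integrable_circ_bounded[where B = B] measurable_circ) auto
qed

text \<open>Integration by parts, with boundary terms that cancel by periodicity.\<close>

lemma coef_deriv:
  assumes g: "smooth_circle g"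
  shows "coef (\<lambda>x. of_real (deriv g x)) n = \<i> * of_int n * coef (\<lambda>x. of_real (g x)) n"
proof -
  note g' = smooth_circle_deriv[OF g]
  have "(\<integral>x. of_real (g x) * (\<i> * of_int (- n) * ex (- n) x) + of_real (deriv g x) * ex (- n) x \<partial>circ)
     = of_real (g (2 * pi)) * ex (- n) (2 * pi) - of_real (g 0) * ex (- n) 0"
  proof (rule circ_FTC)
    fix x
    have "((\<lambda>x. complex_of_real (g x)) has_vector_derivative of_real (deriv g x)) (at x within {0..2 * pi})"
      using smooth_circle_DERIV[OF g, of x] has_vector_derivative_of_real has_vector_derivative_at_within
      by (fastforce simp: has_real_derivative_iff_has_vector_derivative)
    from has_vector_derivative_mult[OF this ex_deriv[of "- n"]]
    show "((\<lambda>x. of_real (g x) * ex (- n) x) has_vector_derivative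
        of_real (g x) * (\<i> * of_int (- n) * ex (- n) x) + of_real (deriv g x) * ex (- n) x) (at x within {0..2 * pi})" .
  qed (intro continuous_intros smooth_circle_continuous g g')
  also have "g (2 * pi) = g 0" using g by (auto simp: smooth_circle_def circle_fun_def dest: spec[of _ 0])
  also have "ex (- n) (2 * pi) = ex (- n) 0" using ex_period[of "- n" 0] by simp
  also have "(\<integral>x. of_real (g x) * (\<i> * of_int (- n) * ex (- n) x) + of_real (deriv g x) * ex (- n) x \<partial>circ)
    = (\<integral>x. (\<i> * of_int (- n)) * (of_real (g x) * ex (- n) x) + of_real (deriv g x) * ex (- n) x \<partial>circ)"
    by (simp add: mult.left_commute mult.assoc)
  also have "\<dots> = (\<i> * of_int (- n)) * fourier (\<lambda>x. of_real (g x)) n + fourier (\<lambda>x. of_real (deriv g x)) n"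
    unfolding fourier_eq
    using integrable_mult_ex[OF smooth_circle_integrable[OF g], of "- n"]
      integrable_mult_ex[OF smooth_circle_integrable[OF g'], of "- n"] by simp
  finally show ?thesis by (simp add: coef_def)
qed

lemma coef_bounded: assumes "integrable circ f" shows "cmod (coef f n) \<le> (\<integral>x. cmod (f x) \<partial>circ)"
proof -
  have "cmod (fourier f n) \<le> (\<integral>x. cmod (f x * ex (- n) x) \<partial>circ)"
    unfolding fourier_eq by (rule integral_norm_bound)
  moreover have "cmod (coef f n) \<le> cmod (fourier f n)"
    using pi_gt3 by (simp add: coef_def norm_divide divide_le_eq mult_le_cancel_left1)
  ultimately show ?thesis by (simp add: norm_mult)
qed

lemma coef_smooth_iter:
  "smooth_circle g \<Longrightarrow> coef (\<lambda>x. of_real ((deriv ^^ k) g x)) n = (\<i> * of_int n) ^ k * coef (\<lambda>x. of_real (g x)) n"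
  by (induction k) (simp_all add: coef_deriv[OF smooth_circle_iter])

text \<open>Two derivatives more than the order of the weight leave the summable bound
  1/\<langle>n\<rangle>^2. The undifferentiated function enters through \<open>B 0\<close> because
  derivatives say nothing about the frequency 0.\<close>

lemma weighted_l1_smooth:
  assumes g: "smooth_circle g" shows "weighted_l1 \<sigma> (coef (\<lambda>x. of_real (g x))) < \<infinity>"
proof -
  define c where "c = coef (\<lambda>x. of_real (g x))"
  define k where "k = nat \<lceil>\<sigma>\<rceil> + 2"
  have k: "\<sigma> + 2 \<le> real k" by (simp add: k_def) linarith
  define B where "B = (\<lambda>k. \<integral>x. cmod (of_real ((deriv ^^ k) g x)) \<partial>circ)"
  have cb: "\<bar>real_of_int n\<bar> ^ j * cmod (c n) \<le> B j" for n j
  proof -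
    have "cmod (coef (\<lambda>x. of_real ((deriv ^^ j) g x)) n) \<le> B j"
      unfolding B_def by (intro coef_bounded smooth_circle_integrable smooth_circle_iter g)
    then show ?thesis by (simp add: coef_smooth_iter[OF g] c_def norm_mult norm_power)
  qed
  have "jw \<sigma> n * cmod (c n) \<le> 2 ^ k * (B 0 + B k) * (1 / (japanese n)\<^sup>2)" for n
  proof -
    have j: "japanese n \<le> 1 + \<bar>real_of_int n\<bar>"
      by (rule power2_le_imp_le) (auto simp: japanese_sq power2_sum)
    have "japanese n \<le> 2 * max 1 \<bar>real_of_int n\<bar>" using j by linarith
    then have "japanese n ^ k \<le> (2 * max 1 \<bar>real_of_int n\<bar>) ^ k" by (intro power_mono) auto
    also have "\<dots> = 2 ^ k * max 1 \<bar>real_of_int n\<bar> ^ k" by (rule power_mult_distrib)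
    also have "\<dots> \<le> 2 ^ k * (1 + \<bar>real_of_int n\<bar> ^ k)"
      by (intro mult_left_mono) (auto simp: max_def)
    finally have 1: "japanese n ^ k \<le> 2 ^ k * (1 + \<bar>real_of_int n\<bar> ^ k)" .
    have "jw \<sigma> n * (japanese n)\<^sup>2 = jw (\<sigma> + 2) n" by (simp add: powr_add)
    also have "\<dots> \<le> jw (real k) n" by (rule jw_mono[OF k])
    also have "\<dots> = japanese n ^ k" by (simp add: powr_realpow)
    finally have "jw \<sigma> n * (japanese n)\<^sup>2 \<le> 2 ^ k * (1 + \<bar>real_of_int n\<bar> ^ k)" using 1 by linarith
    then have "jw \<sigma> n * (japanese n)\<^sup>2 * cmod (c n) \<le> 2 ^ k * (1 + \<bar>real_of_int n\<bar> ^ k) * cmod (c n)"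
      by (rule mult_right_mono) simp
    also have "\<dots> = 2 ^ k * (\<bar>real_of_int n\<bar> ^ 0 * cmod (c n) + \<bar>real_of_int n\<bar> ^ k * cmod (c n))" by (simp add: algebra_simps)
    also have "\<dots> \<le> 2 ^ k * (B 0 + B k)" by (intro mult_left_mono add_mono cb) auto
    finally show ?thesis by (simp add: field_simps)
  qed
  then have "weighted_l1 \<sigma> c \<le> nsum (\<lambda>n. ennreal (2 ^ k * (B 0 + B k) * (1 / (japanese n)\<^sup>2)))"
    unfolding weighted_l1_def by (intro nn_integral_mono ennreal_leI)
  also have "\<dots> \<le> nsum (\<lambda>n. ennreal (norm (2 ^ k * (B 0 + B k) * (1 / (japanese n)\<^sup>2))))"
    by (intro nn_integral_mono ennreal_leI) (simp only: real_norm_def abs_ge_self)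
  also have "\<dots> < \<infinity>"
    using Bochner_Integration.integrable_mult_right[OF summ_inverse_japanese_sq, of "2 ^ k * (B 0 + B k)"]
    unfolding summ_iff by simp
  finally show ?thesis by (simp add: c_def)
qed

lemma summ_coef_smooth: assumes "smooth_circle g" shows "summ (coef (\<lambda>x. of_real (g x)))"
proof -
  have "weighted_l1 0 (coef (\<lambda>x. of_real (g x))) < \<infinity>" by (rule weighted_l1_smooth[OF assms])
  then show ?thesis by (simp add: summ_iff weighted_l1_def)
qed

lemma coef_real_minus: "coef (\<lambda>x. of_real (g x)) (- n) = cnj (coef (\<lambda>x. of_real (g x)) n)"
  unfolding coef_def fourier_eq by (simp add: cnj_ex flip: integral_cnj')

section \<open>Sobolev norms in terms of coefficients\<close>

lemma Hs_norm_eq: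
  assumes "hs_sq s (coef f) < \<infinity>" shows "Hs_norm s f = 2 * pi * sqrt (hs_val s (coef f))"
proof -
  have e: "(cmod (fourier f n))\<^sup>2 * japanese n powr (2 * s) = (2 * pi)\<^sup>2 * (jw s n * cmod (coef f n))\<^sup>2" for n
    unfolding jw_double fourier_coef by (simp add: norm_mult power_mult_distrib)
  have s: "summ (\<lambda>n. (2 * pi)\<^sup>2 * (jw s n * cmod (coef f n))\<^sup>2)"
    using hs_sq_eq_val(1)[OF assms] by simp
  have "Hs_norm s f = sqrt (tsum (\<lambda>n. (2 * pi)\<^sup>2 * (jw s n * cmod (coef f n))\<^sup>2))"
    unfolding Hs_norm_def e using tsum_eq_infsum[OF s] by simp
  also have "\<dots> = 2 * pi * sqrt (hs_val s (coef f))"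
    by (simp add: hs_val_def real_sqrt_mult)
  finally show ?thesis .
qed

lemma HsD:
  assumes f: "f \<in> Hs s"
  shows "integrable circ f" "f \<in> borel_measurable borel" "hs_sq s (coef f) = ennreal (hs_val s (coef f))"
    "Hs_norm s f = 2 * pi * sqrt (hs_val s (coef f))"
proof -
  show "integrable circ f" "f \<in> borel_measurable borel" using f L2_circleD by (auto simp: Hs_def)
  have "(\<lambda>n. (cmod (fourier f n))\<^sup>2 * japanese n powr (2 * s)) summable_on UNIV"
    using f by (simp add: Hs_def)
  then have "summ (\<lambda>n. (2 * pi)\<^sup>2 * (jw s n * cmod (coef f n))\<^sup>2)"
    unfolding jw_double fourier_coef norm_mult power_mult_distrib by (subst summ_iff_summable_on) (auto simp: ac_simps)
  then have "summ (\<lambda>n. (jw s n * cmod (coef f n))\<^sup>2)" by simp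
  then have fin: "hs_sq s (coef f) < \<infinity>" unfolding hs_sq_def summ_iff by simp
  then show "hs_sq s (coef f) = ennreal (hs_val s (coef f))" by (rule hs_sq_eq_val(2))
  show "Hs_norm s f = 2 * pi * sqrt (hs_val s (coef f))" by (rule Hs_norm_eq[OF fin])
qed

lemma Hs_seq_bd:
  assumes "f \<in> Hs s" "s \<ge> 1"
  shows "coef f \<in> seq_bd s (sqrt (sob_const * hs_val s (coef f))) (hs_val s (coef f))" "summ (coef f)"
proof -
  have "hs_sq 1 (coef f) \<le> ennreal (hs_val s (coef f))"
    using hs_sq_mono[OF assms(2)] HsD(3)[OF assms(1)] by metis
  then have l: "l1_norm (coef f) \<le> ennreal (sqrt (sob_const * hs_val s (coef f)))"
    by (rule l1_norm_le_sqrt[OF hs_val_nonneg])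
  then show "coef f \<in> seq_bd s (sqrt (sob_const * hs_val s (coef f))) (hs_val s (coef f))"
    using HsD(3)[OF assms(1)] by (simp add: seq_bd_def)
  show "summ (coef f)" using l unfolding summ_iff l1_norm_def by (simp add: le_less_trans)
qed

section \<open>Weak derivatives and their coefficients\<close>

lemma trig_smooth: "smooth_circle (\<lambda>x. a * cos (of_int n * x) + b * sin (of_int n * x))"
proof -
  have d: "((\<lambda>x. a * cos (of_int n * x) + b * sin (of_int n * x)) has_real_derivative
      (b * of_int n) * cos (of_int n * x) + (- a * of_int n) * sin (of_int n * x)) (at x)" for a b x
    by (auto intro!: derivative_eq_intros)
  \<comment> \<open>The span of cosine and sine at one frequency is closed under derivation, so all
    iterated derivatives stay in a family of known shape.\<close>
  have form: "\<exists>a' b'. (deriv ^^ k) (\<lambda>x. a * cos (of_int n * x) + b * sin (of_int n * x)) = (\<lambda>x. a' * cos (of_int n * x) + b' * sin (of_int n * x))" for k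
  proof (induction k)
    case (Suc k)
    then obtain a' b' where e: "(deriv ^^ k) (\<lambda>x. a * cos (of_int n * x) + b * sin (of_int n * x)) = (\<lambda>x. a' * cos (of_int n * x) + b' * sin (of_int n * x))" by blast
    have "deriv (\<lambda>x. a' * cos (of_int n * x) + b' * sin (of_int n * x)) = (\<lambda>x. (b' * of_int n) * cos (of_int n * x) + (- a' * of_int n) * sin (of_int n * x))"
      using DERIV_imp_deriv[OF d] by blast
    then have "(deriv ^^ Suc k) (\<lambda>x. a * cos (of_int n * x) + b * sin (of_int n * x)) = (\<lambda>x. (b' * of_int n) * cos (of_int n * x) + (- a' * of_int n) * sin (of_int n * x))"
      by (simp add: e)
    then show ?case by blast
  qed auto
  have df: "(\<lambda>x. a' * cos (of_int n * x) + b' * sin (of_int n * x)) differentiable (at x)" for a' b' x :: real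
    using d real_differentiable_def by blast
  have "(deriv ^^ k) (\<lambda>x. a * cos (of_int n * x) + b * sin (of_int n * x)) differentiable (at x)" for k x
  proof -
    obtain a' b' where "(deriv ^^ k) (\<lambda>x. a * cos (of_int n * x) + b * sin (of_int n * x))
        = (\<lambda>x. a' * cos (of_int n * x) + b' * sin (of_int n * x))" using form[of k] by blast
    then show ?thesis using df[of a' b' x] by simp
  qed
  moreover have "circle_fun (\<lambda>x. a * cos (of_int n * x) + b * sin (of_int n * x))"
  proof -
    have "cos (of_int n * (x + 2 * pi)) = cos (of_int n * x)" "sin (of_int n * (x + 2 * pi)) = sin (of_int n * x)" for x
      using ex_period[of n x] by (auto simp: ex_cis complex_eq_iff)
    then show ?thesis by (simp add: circle_fun_def)
  qed
  ultimately show ?thesis unfolding smooth_circle_def by blast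
qed

text \<open>Test functions are real, so the character is split into cosine and sine, which are
  tested separately.\<close>

lemma weak_deriv_coef:
  assumes f: "integrable circ f" and g: "weak_deriv f g"
  shows "coef g n = \<i> * of_int n * coef f n"
proof -
  have ig: "integrable circ g" using g L2_circleD by (auto simp: weak_deriv_def)
  have cs: "(\<integral>x. f x * of_real (deriv \<phi> x) \<partial>circ) = - (\<integral>x. g x * of_real (\<phi> x) \<partial>circ)" if "smooth_circle \<phi>" for \<phi>
    using g that unfolding weak_deriv_def circle_int_eq by blast
  define C S where "C = (\<lambda>x. cos (of_int n * x) :: real)" and "S = (\<lambda>x. sin (of_int n * x) :: real)"
  have smooth: "smooth_circle C" "smooth_circle S"
    using trig_smooth[of 1 n 0] trig_smooth[of 0 n 1] by (simp_all add: C_def S_def)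
  have d: "deriv C x = - of_int n * S x" "deriv S x = of_int n * C x" for x
    unfolding C_def S_def by (rule DERIV_imp_deriv; auto intro!: derivative_eq_intros)+
  have e: "ex (- n) x = of_real (C x) - \<i> * of_real (S x)" for x
    by (simp add: ex_cis C_def S_def complex_eq_iff)
  have i: "integrable circ (\<lambda>x. h x * of_real (\<phi> x))" if "integrable circ h" "\<phi> \<in> {C, S}" for h :: "real \<Rightarrow> complex" and \<phi>
  proof (rule Bochner_Integration.integrable_bound[OF that(1)])
    show "(\<lambda>x. h x * of_real (\<phi> x)) \<in> borel_measurable circ"
    proof (rule borel_measurable_times[OF borel_measurable_integrable[OF that(1)]])
      show "(\<lambda>x. complex_of_real (\<phi> x)) \<in> borel_measurable circ"
        using that(2) smooth smooth_circle_integrable borel_measurable_integrable by blast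
    qed
    show "AE x in circ. cmod (h x * of_real (\<phi> x)) \<le> cmod (h x)"
      using that(2) by (auto simp: norm_mult C_def S_def intro!: AE_I2 mult_left_le)
  qed
  have F: "fourier h n = (\<integral>x. h x * of_real (C x) \<partial>circ) - \<i> * (\<integral>x. h x * of_real (S x) \<partial>circ)" if "integrable circ h" for h
  proof -
    have "fourier h n = (\<integral>x. h x * of_real (C x) - \<i> * (h x * of_real (S x)) \<partial>circ)"
      unfolding fourier_eq e by (simp add: algebra_simps)
    then show ?thesis using i[OF that] by simp
  qed
  have 1: "(\<integral>x. g x * of_real (C x) \<partial>circ) = of_int n * (\<integral>x. f x * of_real (S x) \<partial>circ)"
    using cs[OF smooth(1)] unfolding d by (simp add: mult.left_commute)
  have 2: "(\<integral>x. g x * of_real (S x) \<partial>circ) = - of_int n * (\<integral>x. f x * of_real (C x) \<partial>circ)"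
    using cs[OF smooth(2)] unfolding d by (simp add: mult.left_commute)
  have "fourier g n = \<i> * of_int n * fourier f n"
    unfolding F[OF ig] F[OF f] 1 2 by (simp add: algebra_simps)
  then show ?thesis by (simp add: coef_def)
qed

text \<open>Riesz-Fischer gives a function whose coefficients are i n times those of
  \<open>f\<close>, and Parseval against smooth functions shows that it satisfies the defining
  identity.\<close>

lemma weak_deriv_exists:
  assumes f: "f \<in> Hs s" and s: "s \<ge> 1" shows "\<exists>g. weak_deriv f g"
proof -
  have fi: "integrable circ f" by (rule HsD(1)[OF f])
  have "hs_sq 1 (coef f) < \<infinity>"
    using hs_sq_mono[OF s, of "coef f"] HsD(3)[OF f] by (simp add: le_less_trans)
  then have s1: "summ (\<lambda>n. (jw 1 n * cmod (coef f n))\<^sup>2)" by (rule hs_sq_eq_val(1))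
  have "summ (\<lambda>n. (cmod (\<i> * of_int n * coef f n))\<^sup>2)"
  proof (rule Bochner_Integration.integrable_bound[OF s1])
    show "AE n in count_space UNIV. norm ((cmod (\<i> * of_int n * coef f n))\<^sup>2) \<le> norm ((jw 1 n * cmod (coef f n))\<^sup>2)"
    proof (rule AE_I2)
      fix n
      have "(real_of_int n)\<^sup>2 * (cmod (coef f n))\<^sup>2 \<le> (japanese n)\<^sup>2 * (cmod (coef f n))\<^sup>2"
        by (intro mult_right_mono) (auto simp: japanese_sq)
      then show "norm ((cmod (\<i> * of_int n * coef f n))\<^sup>2) \<le> norm ((jw 1 n * cmod (coef f n))\<^sup>2)"
        by (simp add: norm_mult power_mult_distrib)
    qed
  qed auto
  then obtain g where g: "g \<in> L2_circle" "\<And>n. coef g n = \<i> * of_int n * coef f n"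
    by (rule riesz_fischer) (use that in blast)
  have ig: "integrable circ g" by (rule L2_circleD(3)[OF g(1)])
  have "circle_int (\<lambda>x. f x * of_real (deriv \<phi> x)) = - circle_int (\<lambda>x. g x * of_real (\<phi> x))" if \<phi>: "smooth_circle \<phi>" for \<phi>
  proof -
    note \<phi>' = smooth_circle_deriv[OF \<phi>]
    have "circle_int (\<lambda>x. f x * of_real (deriv \<phi> x)) = 2 * pi * tsum (\<lambda>n. coef f n * cnj (coef (\<lambda>x. of_real (deriv \<phi> x)) n))"
      using parseval_cnj(1)[OF smooth_circle_integrable[OF \<phi>'] summ_coef_smooth[OF \<phi>'] fi] by (simp add: circle_int_eq)
    also have "(\<lambda>n. coef f n * cnj (coef (\<lambda>x. of_real (deriv \<phi> x)) n)) = (\<lambda>n. - (coef g n * cnj (coef (\<lambda>x. of_real (\<phi> x)) n)))"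
      by (simp add: coef_deriv[OF \<phi>] g(2) fun_eq_iff)
    also have "2 * pi * tsum \<dots> = - (2 * pi * tsum (\<lambda>n. coef g n * cnj (coef (\<lambda>x. of_real (\<phi> x)) n)))" by simp
    also have "\<dots> = - circle_int (\<lambda>x. g x * of_real (\<phi> x))"
      using parseval_cnj(1)[OF smooth_circle_integrable[OF \<phi>] summ_coef_smooth[OF \<phi>] ig] by (simp add: circle_int_eq)
    finally show ?thesis .
  qed
  then have "weak_deriv f g" using g(1) by (simp add: weak_deriv_def)
  then show ?thesis by blast
qed

text \<open>Bessel's inequality gives this direction, the one in which the energy of the data
  controls the modified energy.\<close>

lemma grad_bessel:
  assumes f: "f \<in> Hs s" and s: "s \<ge> 1"
  shows "summ (\<lambda>n. (real_of_int n)\<^sup>2 * (cmod (coef f n))\<^sup>2)"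
    "tsum (\<lambda>n. (real_of_int n)\<^sup>2 * (cmod (coef f n))\<^sup>2) \<le> circle_int (\<lambda>x. (cmod (grad f x))\<^sup>2) / (2 * pi)"
proof -
  have w: "weak_deriv f (grad f)"
    unfolding grad_def using weak_deriv_exists[OF f s] by (rule someI_ex)
  then have L2: "grad f \<in> L2_circle" by (simp add: weak_deriv_def)
  have e: "(real_of_int n)\<^sup>2 * (cmod (coef f n))\<^sup>2 = (cmod (coef (grad f) n))\<^sup>2" for n
    by (simp add: weak_deriv_coef[OF HsD(1)[OF f] w] norm_mult power_mult_distrib)
  have "(\<Sum>n\<in>F. (real_of_int n)\<^sup>2 * (cmod (coef f n))\<^sup>2) \<le> circle_int (\<lambda>x. (cmod (grad f x))\<^sup>2) / (2 * pi)" if "finite F" for F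
    unfolding e circle_int_eq by (rule bessel[OF L2_circleD(3,2)[OF L2] that])
  from tsum_bound_finite[OF this]
  show "summ (\<lambda>n. (real_of_int n)\<^sup>2 * (cmod (coef f n))\<^sup>2)"
    "tsum (\<lambda>n. (real_of_int n)\<^sup>2 * (cmod (coef f n))\<^sup>2) \<le> circle_int (\<lambda>x. (cmod (grad f x))\<^sup>2) / (2 * pi)" by auto
qed

lemma mass_eq:
  assumes f: "f \<in> Hs s" and s: "s \<ge> 1" shows "mass f = 2 * pi * hs_val 0 (coef f)"
proof -
  have "complex_of_real (mass f) = (\<integral>x. f x * cnj (f x) \<partial>circ)"
    unfolding mass_def circle_int_eq complex_norm_square[symmetric] by (rule integral_complex_of_real[symmetric])
  also have "\<dots> = 2 * pi * tsum (\<lambda>n. coef f n * cnj (coef f n))"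
    by (rule parseval_cnj(1)[OF HsD(1)[OF f] Hs_seq_bd(2)[OF f s] HsD(1)[OF f]])
  also have "tsum (\<lambda>n. coef f n * cnj (coef f n)) = complex_of_real (hs_val 0 (coef f))"
    unfolding complex_norm_square[symmetric] hs_val_def by (simp del: of_real_power)
  finally have "complex_of_real (mass f) = complex_of_real (2 * pi * hs_val 0 (coef f))" by simp
  then show ?thesis by (simp only: of_real_eq_iff)
qed

section \<open>The energy in terms of coefficients\<close>

context
  fixes lam :: "real \<Rightarrow> real" and s :: real and f :: "real \<Rightarrow> complex"
  assumes lam: "smooth_circle lam" and f: "f \<in> Hs s" and s: "s \<ge> 1"
begin

text \<open>The quadrilinear form is the pairing of the coefficients of |f|^2 f with those of f, to
  which Parseval applies.\<close>

lemma quartic_eq: "tsum (quad (coef f) (coef f) (coef f) (coef f)) = of_real (circle_int (\<lambda>x. (cmod (f x)) ^ 4) / (2 * pi))"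
proof -
  note fi = HsD(1)[OF f] and sc = Hs_seq_bd(2)[OF f s] and bd = Hs_seq_bd(1)[OF f s]
  have "\<bar>1\<bar> \<le> 1 * quad_weight s x" for x
    using jw_ge_1[of "2 * s"] s by (cases x) (auto simp: quad_weight_def intro!: add_increasing2 add_nonneg_nonneg)
  then have "sum_bd (\<lambda>x. of_real 1 * quad (coef f) (coef f) (coef f) (coef f) x) (1 * (12 * 3 powr s * hs_val s (coef f) * (sqrt (sob_const * hs_val s (coef f)))\<^sup>2))"
    using s sob_const_nonneg hs_val_nonneg bd by (intro sum_bd_quad) auto
  then have sq: "summ (quad (coef f) (coef f) (coef f) (coef f))" using sum_bd_summ by fastforce
  have "tsum (quad (coef f) (coef f) (coef f) (coef f)) = tsum (\<lambda>n. cub (coef f) (coef f) (coef f) n * cnj (coef f n))"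
    using tsum_quad_cub(1)[of "\<lambda>_. 1" "coef f" "coef f"] sq by (simp add: split_def)
  also have "\<dots> = tsum (\<lambda>n. coef (\<lambda>x. of_real ((cmod (f x))\<^sup>2) * f x) n * cnj (coef f n))"
    by (simp only: coef_cubic(1)[OF fi sc])
  also have "2 * pi * \<dots> = (\<integral>x. of_real ((cmod (f x))\<^sup>2) * f x * cnj (f x) \<partial>circ)"
    by (rule parseval_cnj(1)[OF fi sc coef_cubic(2)[OF fi sc], symmetric])
  also have "\<dots> = (\<integral>x. complex_of_real ((cmod (f x)) ^ 4) \<partial>circ)"
  proof (rule Bochner_Integration.integral_cong)
    fix x
    have "of_real ((cmod (f x))\<^sup>2) * f x * cnj (f x) = complex_of_real ((cmod (f x))\<^sup>2) * (f x * cnj (f x))" by simp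
    then show "of_real ((cmod (f x))\<^sup>2) * f x * cnj (f x) = complex_of_real ((cmod (f x)) ^ 4)"
      unfolding complex_norm_square[symmetric] by (simp flip: power_add)
  qed simp
  also have "\<dots> = of_real (circle_int (\<lambda>x. (cmod (f x)) ^ 4))"
    unfolding circle_int_eq by (rule integral_complex_of_real)
  finally show ?thesis by (simp add: field_simps)
qed

lemma potential_eq: "tsum (bil (coef (\<lambda>x. of_real (lam x))) (coef f) (coef f)) = of_real (circle_int (\<lambda>x. lam x * (cmod (f x))\<^sup>2) / (2 * pi))"
proof -
  define l where "l = coef (\<lambda>x. complex_of_real (lam x))"
  note fi = HsD(1)[OF f] and sc = Hs_seq_bd(2)[OF f s] and bd = Hs_seq_bd(1)[OF f s] and li = smooth_circle_integrable[OF lam]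
  obtain \<Lambda> where \<Lambda>: "weighted_l1 s l = ennreal \<Lambda>" "\<Lambda> \<ge> 0"
    using weighted_l1_smooth[OF lam, of s] by (cases "weighted_l1 s l") (auto simp: l_def)
  have "\<bar>1\<bar> \<le> 1 * bil_weight s x" for x
    using jw_ge_1[of "2 * s"] s by (cases x) (auto simp: bil_weight_def intro!: add_increasing2 add_nonneg_nonneg)
  then have "sum_bd (\<lambda>x. of_real 1 * bil l (coef f) (coef f) x) (1 * (2 * 2 powr s * \<Lambda> * hs_val s (coef f)))"
    using s hs_val_nonneg bd \<Lambda> by (intro sum_bd_bil) auto
  then have sq: "summ (bil l (coef f) (coef f))" using sum_bd_summ by fastforce
  have "tsum (bil l (coef f) (coef f)) = tsum (\<lambda>n. lin l (coef f) n * cnj (coef f n))"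
    using tsum_bil_lin(1)[of "\<lambda>_. 1" l "coef f" "coef f"] sq by (simp add: split_def)
  also have "\<dots> = tsum (\<lambda>n. coef (\<lambda>x. of_real (lam x) * f x) n * cnj (coef f n))"
    by (simp only: coef_potential(1)[OF fi sc li] l_def)
  also have "2 * pi * \<dots> = (\<integral>x. of_real (lam x) * f x * cnj (f x) \<partial>circ)"
    by (rule parseval_cnj(1)[OF fi sc coef_potential(2)[OF fi sc li], symmetric])
  also have "\<dots> = (\<integral>x. complex_of_real (lam x * (cmod (f x))\<^sup>2) \<partial>circ)"
  proof (rule Bochner_Integration.integral_cong)
    fix x
    have "of_real (lam x) * f x * cnj (f x) = complex_of_real (lam x) * (f x * cnj (f x))" by simp
    then show "of_real (lam x) * f x * cnj (f x) = complex_of_real (lam x * (cmod (f x))\<^sup>2)"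
      unfolding complex_norm_square[symmetric] by simp
  qed simp
  also have "\<dots> = of_real (circle_int (\<lambda>x. lam x * (cmod (f x))\<^sup>2))"
    unfolding circle_int_eq by (rule integral_complex_of_real)
  finally show ?thesis by (simp add: field_simps l_def)
qed

lemma kinetic_eq:
  "tsum (\<lambda>n. of_real (jw 2 n) * (coef f n * cnj (coef f n))) = complex_of_real (hs_val 1 (coef f))"
  "hs_val 1 (coef f) = hs_val 0 (coef f) + tsum (\<lambda>n. (real_of_int n)\<^sup>2 * (cmod (coef f n))\<^sup>2)"
proof -
  have "of_real (jw 2 n) * (coef f n * cnj (coef f n)) = complex_of_real ((jw 1 n * cmod (coef f n))\<^sup>2)" for n
    unfolding complex_norm_square[symmetric] using jw_double[of 1 n] by (simp add: power_mult_distrib)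
  then show "tsum (\<lambda>n. of_real (jw 2 n) * (coef f n * cnj (coef f n))) = complex_of_real (hs_val 1 (coef f))"
    by (simp add: hs_val_def del: of_real_power of_real_mult)
  have 0: "summ (\<lambda>n. (jw 0 n * cmod (coef f n))\<^sup>2)"
    using hs_sq_mono[of 0 s "coef f"] s HsD(3)[OF f] by (intro hs_sq_eq_val(1)) (simp add: le_less_trans)
  have "(jw 1 n * cmod (coef f n))\<^sup>2 = (jw 0 n * cmod (coef f n))\<^sup>2 + (real_of_int n)\<^sup>2 * (cmod (coef f n))\<^sup>2" for n
    by (simp add: power_mult_distrib japanese_sq algebra_simps)
  then show "hs_val 1 (coef f) = hs_val 0 (coef f) + tsum (\<lambda>n. (real_of_int n)\<^sup>2 * (cmod (coef f n))\<^sup>2)"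
    using 0 grad_bessel(1)[OF f s] by (simp add: hs_val_def)
qed

lemma mod_energy_eq:
  "mod_energy (coef (\<lambda>x. of_real (lam x))) (jw 2) (\<lambda>_. 1) (\<lambda>_. 1) (coef f) = of_real (hs_val 1 (coef f)
     + circle_int (\<lambda>x. (cmod (f x)) ^ 4) / (4 * pi) + circle_int (\<lambda>x. lam x * (cmod (f x))\<^sup>2) / (2 * pi))"
  unfolding mod_energy_def kinetic_eq(1) using quartic_eq potential_eq by simp

text \<open>The weight 1 + n^2 contributes the mass and at most twice the kinetic energy, whence the
  combination mass + 2 energy.\<close>

lemma mod_energy_le_energy:
  "Re (mod_energy (coef (\<lambda>x. of_real (lam x))) (jw 2) (\<lambda>_. 1) (\<lambda>_. 1) (coef f)) \<le> (mass f + 2 * energy lam f) / (2 * pi)"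
proof -
  have "hs_val 1 (coef f) \<le> mass f / (2 * pi) + circle_int (\<lambda>x. (cmod (grad f x))\<^sup>2) / (2 * pi)"
    unfolding kinetic_eq(2) using grad_bessel(2)[OF f s] mass_eq[OF f s] by simp
  moreover have "(mass f + 2 * energy lam f) / (2 * pi) = mass f / (2 * pi) + circle_int (\<lambda>x. (cmod (grad f x))\<^sup>2) / (2 * pi)
      + circle_int (\<lambda>x. (cmod (f x)) ^ 4) / (4 * pi) + circle_int (\<lambda>x. lam x * (cmod (f x))\<^sup>2) / (2 * pi)"
    unfolding energy_def by (simp add: field_simps)
  ultimately show ?thesis unfolding mod_energy_eq by simp
qed

text \<open>The quartic part is non-negative, the nonlinearity being defocusing, and the potential
  part is at least - B times the mass. This restores coercivity although the energy may be
  negative.\<close>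

lemma h1_le_mod_energy:
  assumes "\<And>x. x \<in> {0..2 * pi} \<Longrightarrow> \<bar>lam x\<bar> \<le> B"
  shows "hs_val 1 (coef f) \<le> Re (mod_energy (coef (\<lambda>x. of_real (lam x))) (jw 2) (\<lambda>_. 1) (\<lambda>_. 1) (coef f)) + B * mass f / (2 * pi)"
proof -
  have L2: "integrable circ (\<lambda>x. (cmod (f x))\<^sup>2)" using f L2_circleD(2) by (auto simp: Hs_def)
  have "0 \<le> circle_int (\<lambda>x. (cmod (f x)) ^ 4)" unfolding circle_int_eq by simp
  moreover have "- (B * mass f) \<le> circle_int (\<lambda>x. lam x * (cmod (f x))\<^sup>2)"
  proof -
    have "(\<integral>x. - B * (cmod (f x))\<^sup>2 \<partial>circ) \<le> (\<integral>x. lam x * (cmod (f x))\<^sup>2 \<partial>circ)"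
    proof (rule integral_mono_AE)
      show "integrable circ (\<lambda>x. lam x * (cmod (f x))\<^sup>2)"
      proof (rule Bochner_Integration.integrable_bound[of _ "\<lambda>x. B * (cmod (f x))\<^sup>2"])
        show "AE x in circ. norm (lam x * (cmod (f x))\<^sup>2) \<le> norm (B * (cmod (f x))\<^sup>2)"
          using assms by (intro AE_I2) (force simp: space_circ abs_mult intro!: mult_right_mono)
        have [measurable]: "lam \<in> borel_measurable borel" "f \<in> borel_measurable borel"
          by (rule smooth_circle_borel[OF lam], rule HsD(2)[OF f])
        show "(\<lambda>x. lam x * (cmod (f x))\<^sup>2) \<in> borel_measurable circ"
          by (rule measurable_circ) measurable
      qed (use L2 in auto)
      show "AE x in circ. - B * (cmod (f x))\<^sup>2 \<le> lam x * (cmod (f x))\<^sup>2"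
        using assms by (intro AE_I2 mult_right_mono) (force simp: space_circ abs_le_iff)+
    qed (use L2 in auto)
    then show ?thesis by (simp add: mass_def circle_int_eq)
  qed
  ultimately show ?thesis unfolding mod_energy_eq by (simp add: field_simps)
qed

end

section \<open>From Duhamel's formula to Fourier coefficients\<close>

definition phase :: "real \<Rightarrow> int \<Rightarrow> complex" where
  "phase t n = exp (- (\<i> * of_real t * (of_int n)\<^sup>2))"

lemma norm_phase [simp]: "cmod (phase t n) = 1"
  by (simp add: phase_def)

lemma phase_add: "phase (t + r) n = phase t n * phase r n"
  by (simp add: phase_def algebra_simps flip: exp_add)

lemma phase_minus: "phase t n * phase (- t) n = 1"
  by (simp add: phase_def flip: exp_add)

lemma phase_deriv: "((\<lambda>t. phase t n) has_vector_derivative - \<i> * (of_int n)\<^sup>2 * phase t n) (at t within A)"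
proof -
  have "((\<lambda>t. exp (- (\<i> * of_real t * (of_int n)\<^sup>2))) has_vector_derivative (- \<i> * (of_int n)\<^sup>2 * exp (- (\<i> * of_real t * (of_int n)\<^sup>2)))) (at t within A)"
    by (rule has_vector_derivative_real_field) (auto intro!: derivative_eq_intros)
  then show ?thesis by (simp add: phase_def[abs_def])
qed

lemma continuous_phase: "continuous_on A (\<lambda>t. phase (f t) n)" if "continuous_on A f"
  unfolding phase_def using that by (intro continuous_intros)

lemma free_group_eq:
  assumes "summ (coef f)" shows "free_group t f x = ser (\<lambda>n. phase t n * coef f n) x"
proof -
  have "summ (\<lambda>n. phase t n * coef f n)"
    by (rule Bochner_Integration.integrable_bound[OF assms]) (auto simp: norm_mult)
  note s = summ_ser[OF this, of x]
  have s': "(\<lambda>n. phase t n * fourier f n * ex n x) = (\<lambda>n. (2 * pi) * (phase t n * coef f n * ex n x))"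
    by (auto simp: fourier_coef)
  have "(\<Sum>\<^sub>\<infinity>n. phase t n * fourier f n * ex n x) = tsum (\<lambda>n. (2 * pi) * (phase t n * coef f n * ex n x))"
    unfolding s' using s by (intro tsum_eq_infsum[symmetric]) simp
  then show ?thesis by (simp add: free_group_def ser_def phase_def ex_def)
qed

text \<open>The oriented integral becomes a sign times an integral over a finite measure, the form
  to which Fubini for sums applies.\<close>

lemma interval_integral_measure:
  fixes f :: "real \<Rightarrow> complex"
  shows "(LBINT y=ereal 0..ereal t. f y)
     = (if 0 \<le> t then 1 else - 1) * (\<integral>y. f y \<partial>restrict_space lborel {min 0 t<..<max 0 t})"
proof -
  have "(\<integral>y. f y \<partial>restrict_space lborel {min 0 t<..<max 0 t}) = (LINT y:{min 0 t<..<max 0 t}|lborel. f y)"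
    unfolding set_lebesgue_integral_def by (subst integral_restrict_space) auto
  then show ?thesis
    by (auto simp: interval_lebesgue_integral_def einterval_eq min_def max_def)
qed

locale nls_sol =
  fixes lam :: "real \<Rightarrow> real" and s :: real and \<Phi> :: "real \<Rightarrow> complex" and u :: "real \<Rightarrow> real \<Rightarrow> complex"
  assumes lam: "smooth_circle lam" and s: "s \<ge> 1" and \<Phi>: "\<Phi> \<in> Hs s" and sol: "nls_solution lam s \<Phi> u"
begin

definition "l = coef (\<lambda>x. complex_of_real (lam x))"

definition "a t = coef (u t)"

lemma u_Hs: "u t \<in> Hs s"
  using sol by (simp add: nls_solution_def Hs_continuous_def)

lemma u_int: "integrable circ (u t)" and u_summ: "summ (a t)"
  using HsD(1)[OF u_Hs] Hs_seq_bd(2)[OF u_Hs s] by (auto simp: a_def)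

lemma a_diff: "coef (\<lambda>x. u t x - u t0 x) = (\<lambda>n. a t n - a t0 n)"
  using coef_diff[OF u_int u_int] by (auto simp: a_def)

lemma diff_fin: "hs_sq s (\<lambda>n. a t n - a t0 n) < \<infinity>"
proof -
  have "hs_sq s (\<lambda>n. a t n + - a t0 n) \<le> 2 * (hs_sq s (a t) + hs_sq s (\<lambda>n. - a t0 n))" by (rule hs_sq_add)
  also have "hs_sq s (\<lambda>n. - a t0 n) = hs_sq s (a t0)" by (simp add: hs_sq_def)
  also have "2 * (hs_sq s (a t) + hs_sq s (a t0)) < \<infinity>"
    using HsD(3)[OF u_Hs] by (simp add: a_def ennreal_mult_less_top)
  finally show ?thesis by simp
qed

lemma diff_tendsto: "((\<lambda>t. hs_val s (\<lambda>n. a t n - a t0 n)) \<longlongrightarrow> 0) (at t0)"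
proof -
  have "((\<lambda>t. Hs_norm s (\<lambda>x. u t x - u t0 x)) \<longlongrightarrow> 0) (at t0)"
    using sol by (simp add: nls_solution_def Hs_continuous_def)
  then have "((\<lambda>t. (Hs_norm s (\<lambda>x. u t x - u t0 x))\<^sup>2 / (2 * pi)\<^sup>2) \<longlongrightarrow> 0\<^sup>2 / (2 * pi)\<^sup>2) (at t0)"
    by (intro tendsto_intros) auto
  moreover have "(Hs_norm s (\<lambda>x. u t x - u t0 x))\<^sup>2 / (2 * pi)\<^sup>2 = hs_val s (\<lambda>n. a t n - a t0 n)" for t
    using Hs_norm_eq[of s "\<lambda>x. u t x - u t0 x"] diff_fin[of t t0] hs_val_nonneg
    by (simp add: a_diff power_mult_distrib)
  ultimately show ?thesis by simp
qed

text \<open>Continuity at \<open>t0\<close> makes the squared norm of the difference less than 1;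
  the factor 2 is that of the square of a sum.\<close>

lemma locally_bounded: "\<exists>\<delta>>0. \<forall>t\<in>ball t0 \<delta>. hs_val s (a t) \<le> 2 * (1 + hs_val s (a t0))"
proof -
  have "\<forall>\<^sub>F t in at t0. hs_val s (\<lambda>n. a t n - a t0 n) < 1"
    by (rule order_tendstoD(2)[OF diff_tendsto]) simp
  then obtain \<delta> where \<delta>: "\<delta> > 0" "\<And>t. t \<noteq> t0 \<Longrightarrow> dist t t0 < \<delta> \<Longrightarrow> hs_val s (\<lambda>n. a t n - a t0 n) < 1"
    by (auto simp: eventually_at)
  have "hs_val s (a t) \<le> 2 * (1 + hs_val s (a t0))" if "t \<in> ball t0 \<delta>" for t
  proof (cases "t = t0")
    case True then show ?thesis using hs_val_nonneg[of s "a t0"] by simp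
  next
    case False
    have "ennreal (hs_val s (a t)) = hs_sq s (\<lambda>n. (a t n - a t0 n) + a t0 n)"
      using HsD(3)[OF u_Hs] by (simp add: a_def)
    also have "\<dots> \<le> 2 * (hs_sq s (\<lambda>n. a t n - a t0 n) + hs_sq s (a t0))" by (rule hs_sq_add)
    also have "\<dots> = ennreal (2 * (hs_val s (\<lambda>n. a t n - a t0 n) + hs_val s (a t0)))"
      using HsD(3)[OF u_Hs[of t0]] hs_sq_eq_val(2)[OF diff_fin[of t t0]] hs_val_nonneg by (simp add: a_def ennreal_mult)
    also have "\<dots> \<le> ennreal (2 * (1 + hs_val s (a t0)))"
      using \<delta>(2)[OF False] that by (intro ennreal_leI) (auto simp: dist_commute less_imp_le)
    finally show ?thesis using hs_val_nonneg[of s "a t0"] by (subst (asm) ennreal_le_iff) auto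
  qed
  then show ?thesis using \<delta>(1) by blast
qed

lemma bounded_on_compact: "\<exists>B. \<forall>t. \<bar>t\<bar> \<le> T \<longrightarrow> hs_val s (a t) \<le> B"
proof -
  obtain \<delta> where \<delta>: "\<And>t0. \<delta> t0 > 0" "\<And>t0 t. t \<in> ball t0 (\<delta> t0) \<Longrightarrow> hs_val s (a t) \<le> 2 * (1 + hs_val s (a t0))"
    using locally_bounded by metis
  have "compact {- T..T}" by simp
  then obtain F where F: "F \<subseteq> {- T..T}" "finite F" "{- T..T} \<subseteq> (\<Union>t0\<in>F. ball t0 (\<delta> t0))"
    by (rule compactE_image[of _ "{- T..T}" "\<lambda>t0. ball t0 (\<delta> t0)"]) (use \<delta>(1) in auto)
  have "hs_val s (a t) \<le> (\<Sum>t0\<in>F. 2 * (1 + hs_val s (a t0)))" if "\<bar>t\<bar> \<le> T" for t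
  proof -
    have "t \<in> {- T..T}" using that by auto
    then obtain t0 where t0: "t0 \<in> F" "t \<in> ball t0 (\<delta> t0)" using F(3) by blast
    have "2 * (1 + hs_val s (a t0)) \<le> (\<Sum>t0\<in>F. 2 * (1 + hs_val s (a t0)))"
      by (rule member_le_sum[OF t0(1) _ F(2)]) (simp add: hs_val_nonneg add_nonneg_nonneg)
    then show ?thesis using \<delta>(2)[OF t0(2)] by linarith
  qed
  then show ?thesis by blast
qed

definition "R t = sqrt (sob_const * hs_val s (a t))"

lemma l1_le_R: "l1_norm (a t) \<le> ennreal (R t)"
  using Hs_seq_bd(1)[OF u_Hs[of t] s] by (simp add: seq_bd_def R_def a_def)

lemma norm_ser_le_l1:
  assumes "l1_norm c \<le> ennreal B" "B \<ge> 0" shows "summ c" "cmod (ser c x) \<le> B"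
proof -
  show c: "summ c" using norm_tsum_le(2)[of c B] assms by (simp add: l1_norm_def)
  show "cmod (ser c x) \<le> B"
    using norm_ser_le[OF c, of x] norm_tsum_le(3)[of c B] assms by (simp add: l1_norm_def)
qed

lemma R_nonneg: "R t \<ge> 0"
  using sob_const_nonneg hs_val_nonneg by (simp add: R_def)

lemma AE_u: "AE x in circ. u t x = ser (a t) x"
  unfolding a_def by (rule fourier_inversion[OF u_int]) (use u_summ in \<open>simp add: a_def\<close>)

lemma AE_u_bounded: "AE x in circ. cmod (u t x) \<le> R t"
  using AE_u[of t] by eventually_elim (simp add: norm_ser_le_l1(2)[OF l1_le_R R_nonneg])

lemma AE_u_diff: "AE x in circ. cmod (u t x - u t0 x) \<le> sqrt (sob_const * hs_val s (\<lambda>n. a t n - a t0 n))"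
proof -
  define D where "D = sqrt (sob_const * hs_val s (\<lambda>n. a t n - a t0 n))"
  have D: "D \<ge> 0" using sob_const_nonneg hs_val_nonneg by (simp add: D_def)
  have "hs_sq 1 (\<lambda>n. a t n - a t0 n) \<le> ennreal (hs_val s (\<lambda>n. a t n - a t0 n))"
    using hs_sq_mono[OF s] hs_sq_eq_val(2)[OF diff_fin[of t t0]] by metis
  then have "l1_norm (\<lambda>n. a t n - a t0 n) \<le> ennreal D"
    unfolding D_def by (rule l1_norm_le_sqrt[OF hs_val_nonneg])
  note b = norm_ser_le_l1(2)[OF this D]
  have e: "ser (a t) x - ser (a t0) x = ser (\<lambda>n. a t n - a t0 n) x" for x
    unfolding ser_def using summ_ser[OF u_summ, of t x] summ_ser[OF u_summ, of t0 x] by (simp add: left_diff_distrib)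
  show ?thesis
    using AE_u[of t] AE_u[of t0] by eventually_elim (use b in \<open>simp add: D_def e\<close>)
qed

lemma lam_int: "integrable circ (\<lambda>x. complex_of_real (lam x))"
  by (rule smooth_circle_integrable[OF lam])

definition "N t = nls_rhs l (a t)"

lemma N_eq: "coef (nonlin lam (u t)) = N t"
  unfolding N_def l_def a_def by (rule coef_nonlin(1)[OF u_int _ lam_int]) (use u_summ in \<open>simp add: a_def\<close>)

lemma nonlin_int: "integrable circ (nonlin lam (u t))"
  by (rule coef_nonlin(2)[OF u_int _ lam_int]) (use u_summ in \<open>simp add: a_def\<close>)

lemma l_weighted: obtains \<Lambda> where "\<Lambda> \<ge> 0" "weighted_l1 s l = ennreal \<Lambda>"
  using weighted_l1_smooth[OF lam, of s] by (cases "weighted_l1 s l") (auto simp: l_def)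

lemma N_l1: "\<exists>B\<ge>0. \<forall>t. \<bar>t\<bar> \<le> T \<longrightarrow> l1_norm (N t) \<le> ennreal B"
proof -
  obtain \<Lambda> where \<Lambda>: "\<Lambda> \<ge> 0" "weighted_l1 s l = ennreal \<Lambda>" by (rule l_weighted)
  have l: "l1_norm l \<le> ennreal \<Lambda>"
    using l1_norm_le_weighted[of s l] s \<Lambda>(2) by (simp add: weighted_l1_def)
  obtain B0 where B0: "\<And>t. \<bar>t\<bar> \<le> T \<Longrightarrow> hs_val s (a t) \<le> B0" using bounded_on_compact by blast
  define P where "P = sqrt (sob_const * max 0 B0)"
  have P: "P \<ge> 0" using sob_const_nonneg by (simp add: P_def)
  have "l1_norm (N t) \<le> ennreal (P ^ 3 + \<Lambda> * P)" if "\<bar>t\<bar> \<le> T" for t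
  proof -
    have "R t \<le> P"
      unfolding R_def P_def by (intro real_sqrt_le_mono mult_left_mono sob_const_nonneg) (use B0[OF that] in auto)
    then have "l1_norm (a t) \<le> ennreal P" using l1_le_R[of t] ennreal_leI order_trans by blast
    then show ?thesis unfolding N_def by (intro l1_nls_rhs P \<Lambda> l)
  qed
  moreover have "P ^ 3 + \<Lambda> * P \<ge> 0" using P \<Lambda> by simp
  ultimately show ?thesis by blast
qed

text \<open>The three factors are exchanged one at a time.\<close>

lemma cubic_diff_le:
  assumes "cmod z \<le> r" "cmod w \<le> r"
  shows "cmod (of_real ((cmod z)\<^sup>2) * z - of_real ((cmod w)\<^sup>2) * w) \<le> 3 * r\<^sup>2 * cmod (z - w)"
proof -
  have "of_real ((cmod z)\<^sup>2) * z - of_real ((cmod w)\<^sup>2) * w = (z - w) * (cnj z * z) + (w * z) * cnj (z - w) + (w * cnj w) * (z - w)"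
    unfolding complex_norm_square by (simp add: algebra_simps)
  also have "cmod \<dots> \<le> cmod (z - w) * (cmod z * cmod z) + (cmod w * cmod z) * cmod (z - w) + (cmod w * cmod w) * cmod (z - w)"
    by (intro norm_triangle_le add_mono) (simp_all only: norm_mult complex_mod_cnj order_refl)
  also have "\<dots> \<le> cmod (z - w) * (r * r) + (r * r) * cmod (z - w) + (r * r) * cmod (z - w)"
  proof -
    have r: "0 \<le> r" using assms norm_ge_zero order_trans by blast
    show ?thesis by (intro add_mono mult_left_mono mult_right_mono mult_mono assms) (use r in auto)
  qed
  finally show ?thesis by (simp add: power2_eq_square algebra_simps)
qed

text \<open>The estimate is made for functions of x and not for coefficients: by the embedding, u(t)
  tends to u(t0) uniformly up to null sets, and the nonlinearity is Lipschitz on bounded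
  sets.\<close>

lemma N_continuous: "continuous_on UNIV (\<lambda>t. N t n)"
proof -
  have "isCont (\<lambda>t. N t n) t0" for t0
  proof -
    obtain B where B: "B \<ge> 0" "\<And>x. x \<in> {0..2 * pi} \<Longrightarrow> \<bar>lam x\<bar> \<le> B" using smooth_circle_bounded[OF lam] by blast
    obtain B0 where B0: "\<And>t. \<bar>t\<bar> \<le> \<bar>t0\<bar> + 1 \<Longrightarrow> hs_val s (a t) \<le> B0" using bounded_on_compact by blast
    define P where "P = sqrt (sob_const * B0)"
    have RP: "R t \<le> P" if "\<bar>t\<bar> \<le> \<bar>t0\<bar> + 1" for t
      unfolding R_def P_def by (intro real_sqrt_le_mono mult_left_mono sob_const_nonneg B0 that)
    define D where "D = (\<lambda>t. sqrt (sob_const * hs_val s (\<lambda>n. a t n - a t0 n)))"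
    have D: "(D \<longlongrightarrow> sqrt (sob_const * 0)) (at t0)"
      unfolding D_def by (intro tendsto_intros diff_tendsto)
    have le: "cmod (N t n - N t0 n) \<le> (3 * P\<^sup>2 + B) * D t * (2 * pi)" if t: "\<bar>t\<bar> \<le> \<bar>t0\<bar> + 1" for t
    proof -
      have "N t n - N t0 n = coef (\<lambda>x. nonlin lam (u t) x - nonlin lam (u t0) x) n"
        by (simp add: coef_diff[OF nonlin_int nonlin_int] N_eq)
      also have "cmod \<dots> \<le> (\<integral>x. cmod (nonlin lam (u t) x - nonlin lam (u t0) x) \<partial>circ)"
        by (rule coef_bounded) (intro Bochner_Integration.integrable_diff nonlin_int)
      also have "\<dots> \<le> (\<integral>x. (3 * P\<^sup>2 + B) * D t \<partial>circ)"
      proof (rule integral_mono_AE)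
        show "AE x in circ. cmod (nonlin lam (u t) x - nonlin lam (u t0) x) \<le> (3 * P\<^sup>2 + B) * D t"
          using AE_u_bounded[of t] AE_u_bounded[of t0] AE_u_diff[of t t0] AE_space
        proof eventually_elim
          case (elim x)
          have x: "x \<in> {0..2 * pi}" using elim by (simp add: space_circ)
          have uP: "cmod (u t x) \<le> P" "cmod (u t0 x) \<le> P" using elim RP[OF t] RP[of t0] by auto
          have dD: "cmod (u t x - u t0 x) \<le> D t" using elim by (simp add: D_def)
          have "nonlin lam (u t) x - nonlin lam (u t0) x
             = (of_real ((cmod (u t x))\<^sup>2) * u t x - of_real ((cmod (u t0 x))\<^sup>2) * u t0 x) + of_real (lam x) * (u t x - u t0 x)"
            by (simp add: nonlin_def algebra_simps)
          also have "cmod \<dots> \<le> 3 * P\<^sup>2 * cmod (u t x - u t0 x) + \<bar>lam x\<bar> * cmod (u t x - u t0 x)"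
            by (intro norm_triangle_le add_mono cubic_diff_le uP) (simp add: norm_mult)
          also have "\<dots> \<le> 3 * P\<^sup>2 * D t + B * D t"
            by (intro add_mono mult_left_mono mult_mono dD B x) (use B in auto)
          finally show ?case by (simp add: algebra_simps)
        qed
      qed (use nonlin_int in auto)
      also have "\<dots> = (3 * P\<^sup>2 + B) * D t * (2 * pi)" by (simp add: space_circ measure_circ)
      finally show ?thesis .
    qed
    have "((\<lambda>t. N t n - N t0 n) \<longlongrightarrow> 0) (at t0)"
    proof (rule Lim_null_comparison)
      show "\<forall>\<^sub>F t in at t0. norm (N t n - N t0 n) \<le> (3 * P\<^sup>2 + B) * D t * (2 * pi)"
        unfolding eventually_at
        by (rule exI[of _ 1]) (auto simp: dist_real_def intro!: le)
      have "((\<lambda>t. (3 * P\<^sup>2 + B) * D t * (2 * pi)) \<longlongrightarrow> (3 * P\<^sup>2 + B) * sqrt (sob_const * 0) * (2 * pi)) (at t0)"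
        by (intro tendsto_intros D)
      then show "((\<lambda>t. (3 * P\<^sup>2 + B) * D t * (2 * pi)) \<longlongrightarrow> 0) (at t0)" by simp
    qed
    then show ?thesis by (simp add: isCont_def LIM_zero_iff)
  qed
  then show ?thesis by (simp add: continuous_at_imp_continuous_on)
qed

text \<open>In Duhamel's formula the time integral is taken pointwise in x, and equality holds
  almost everywhere. Exchanging the time integral with the Fourier sum exhibits the right-hand side
  as an absolutely convergent series \<open>ser d\<close>, whose coefficients are known.\<close>

lemma duhamel_coef:
  "a t n = phase t n * (coef \<Phi> n - \<i> * (LBINT y=ereal 0..ereal t. phase (- y) n * N y n))"
proof -
  define J where "J = {min 0 t<..<max 0 t}"
  define M where "M = restrict_space lborel J"
  define \<sigma> :: complex where "\<sigma> = (if 0 \<le> t then 1 else - 1)"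
  have spM: "space M = J" by (simp add: M_def space_restrict_space J_def)
  interpret M: finite_measure M
    by (rule finite_measureI) (auto simp: M_def J_def space_restrict_space emeasure_restrict_space)
  have sfM: "sigma_finite_measure M" by unfold_locales
  have ii: "(LBINT y=ereal 0..ereal t. f y) = \<sigma> * (\<integral>y. f y \<partial>M)" for f
    unfolding interval_integral_measure by (simp add: \<sigma>_def M_def J_def)
  obtain B where B: "B \<ge> 0" "\<And>y. \<bar>y\<bar> \<le> \<bar>t\<bar> \<Longrightarrow> l1_norm (N y) \<le> ennreal B" using N_l1 by blast
  have Jt: "\<bar>y\<bar> \<le> \<bar>t\<bar>" if "y \<in> J" for y using that by (auto simp: J_def)
  define F where "F = (\<lambda>x m y. phase (t - y) m * N y m * ex m x)"
  have cont: "continuous_on UNIV (F x m)" for x m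
    unfolding F_def by (intro continuous_intros continuous_phase N_continuous)
  have meas: "F x m \<in> borel_measurable M" for x m
    unfolding M_def by (intro measurable_restrict_space1) (use borel_measurable_continuous_onI[OF cont] in simp)
  have bd: "(\<integral>\<^sup>+y. \<integral>\<^sup>+m. ennreal (cmod (F x m y)) \<partial>count_space UNIV \<partial>M) < \<infinity>" for x
  proof -
    have "(\<integral>\<^sup>+y. \<integral>\<^sup>+m. ennreal (cmod (F x m y)) \<partial>count_space UNIV \<partial>M) \<le> (\<integral>\<^sup>+y. ennreal B \<partial>M)"
    proof (rule nn_integral_mono)
      fix y assume "y \<in> space M"
      then show "nsum (\<lambda>m. ennreal (cmod (F x m y))) \<le> ennreal B"
        using B(2)[OF Jt, of y] by (simp add: spM F_def norm_mult l1_norm_def)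
    qed
    also have "\<dots> < \<infinity>" by (simp add: ennreal_mult_less_top M.emeasure_eq_measure)
    finally show ?thesis .
  qed
  define c where "c = (\<lambda>m. \<integral>y. phase (t - y) m * N y m \<partial>M)"
  have cF: "(\<integral>y. F x m y \<partial>M) = c m * ex m x" for x m
    by (simp add: F_def c_def)
  have c: "summ c"
    using summ_integral[OF sfM meas bd, of 0] unfolding cF by (simp add: ex_def)
  have I: "(\<integral>y. free_group (t - y) (nonlin lam (u y)) x \<partial>M) = ser c x" for x
  proof -
    have "(\<integral>y. free_group (t - y) (nonlin lam (u y)) x \<partial>M) = (\<integral>y. tsum (\<lambda>m. F x m y) \<partial>M)"
    proof (rule Bochner_Integration.integral_cong)
      fix y assume "y \<in> space M"
      then have "l1_norm (N y) \<le> ennreal B" using B(2)[OF Jt, of y] by (simp add: spM)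
      then have "summ (coef (nonlin lam (u y)))"
        unfolding N_eq by (rule norm_ser_le_l1(1)) (rule B)
      then show "free_group (t - y) (nonlin lam (u y)) x = tsum (\<lambda>m. F x m y)"
        by (simp add: free_group_eq N_eq ser_def F_def)
    qed simp
    also have "\<dots> = tsum (\<lambda>m. \<integral>y. F x m y \<partial>M)" by (rule integral_tsum[OF sfM meas bd])
    finally show ?thesis by (simp add: cF ser_def)
  qed
  define d where "d = (\<lambda>m. phase t m * coef \<Phi> m - \<i> * (\<sigma> * c m))"
  have p\<Phi>: "summ (\<lambda>m. phase t m * coef \<Phi> m)"
    by (rule Bochner_Integration.integrable_bound[OF Hs_seq_bd(2)[OF \<Phi> s]]) (auto simp: norm_mult)
  have d: "summ d" unfolding d_def using p\<Phi> c by simp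
  have ser_d: "ser d x = ser (\<lambda>m. phase t m * coef \<Phi> m) x - \<i> * (\<sigma> * ser c x)" for x
  proof -
    have "(\<lambda>m. d m * ex m x) = (\<lambda>m. phase t m * coef \<Phi> m * ex m x - \<i> * (\<sigma> * (c m * ex m x)))"
      by (auto simp: d_def algebra_simps)
    then show ?thesis unfolding ser_def using summ_ser[OF p\<Phi>, of x] summ_ser[OF c, of x] by simp
  qed
  have "AE x in lborel. u t x = ser d x"
    using sol[unfolded nls_solution_def, THEN conjunct2, rule_format, of t]
  proof eventually_elim
    case (elim x)
    then show ?case unfolding ii I ser_d free_group_eq[OF Hs_seq_bd(2)[OF \<Phi> s]] .
  qed
  then have "AE x in circ. u t x = ser d x"
    by (subst AE_restrict_space_iff) auto
  then have "fourier (u t) n = fourier (ser d) n"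
    by (rule fourier_cong_AE) (use u_int integrable_ser[OF d] in auto)
  then have "a t n = d n" by (simp add: a_def coef_def fourier_ser[OF d])
  also have "\<sigma> * c n = phase t n * (LBINT y=ereal 0..ereal t. phase (- y) n * N y n)"
  proof -
    have "c n = (\<integral>y. phase t n * (phase (- y) n * N y n) \<partial>M)"
      unfolding c_def by (rule Bochner_Integration.integral_cong) (use phase_add[of t] in \<open>simp_all add: mult.assoc flip: phase_add\<close>)
    then show ?thesis unfolding ii by simp
  qed
  then have "d n = phase t n * (coef \<Phi> n - \<i> * (LBINT y=ereal 0..ereal t. phase (- y) n * N y n))"
    unfolding d_def by (simp add: algebra_simps)
  finally show ?thesis .
qed

lemma a_0: "a 0 = coef \<Phi>"
  by (rule ext) (simp add: duhamel_coef phase_def)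

text \<open>With the free multiplier factored out, time enters only through the upper limit of an
  integral with continuous integrand. So each coefficient is differentiable, even though u need not
  be differentiable as a map into H^s.\<close>

lemma a_deriv: "((\<lambda>t. a t n) has_vector_derivative - \<i> * (of_real ((real_of_int n)\<^sup>2) * a t n + N t n)) (at t)"
proof -
  define W where "W = (\<lambda>t. coef \<Phi> n - \<i> * (LBINT y=ereal 0..ereal t. phase (- y) n * N y n))"
  \<comment> \<open>Makes \<open>t\<close> an interior point of an interval that also contains 0, so
    that the derivative within it is two-sided.\<close>
  define r where "r = \<bar>t\<bar> + 1"
  have cont: "continuous_on {- r..r} (\<lambda>y. phase (- y) n * N y n)"
    by (intro continuous_intros continuous_phase continuous_on_subset[OF N_continuous]) auto
  have "((\<lambda>t. LBINT y=ereal 0..ereal t. phase (- y) n * N y n) has_vector_derivative phase (- t) n * N t n) (at t within {- r..r})"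
    by (rule interval_integral_FTC2[OF _ _ cont]) (auto simp: r_def)
  then have "((\<lambda>t. LBINT y=ereal 0..ereal t. phase (- y) n * N y n) has_vector_derivative phase (- t) n * N t n) (at t)"
    by (subst (asm) at_within_Icc_at) (auto simp: r_def)
  then have W: "(W has_vector_derivative - \<i> * (phase (- t) n * N t n)) (at t)"
    unfolding W_def by (auto intro!: derivative_eq_intros)
  have "((\<lambda>t. phase t n * W t) has_vector_derivative
      phase t n * (- \<i> * (phase (- t) n * N t n)) + (- \<i> * (of_int n)\<^sup>2 * phase t n) * W t) (at t)"
    by (rule has_vector_derivative_mult[OF phase_deriv W])
  moreover have a: "a t n = phase t n * W t" for t by (simp add: duhamel_coef W_def)
  moreover have "phase t n * (- \<i> * (phase (- t) n * N t n)) + (- \<i> * (of_int n)\<^sup>2 * phase t n) * W t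
     = - \<i> * (of_real ((real_of_int n)\<^sup>2) * (phase t n * W t) + (phase t n * phase (- t) n) * N t n)"
    by (simp add: algebra_simps)
  ultimately show ?thesis unfolding a by (simp add: phase_minus)
qed

lemma nls_coeffs:
  assumes "\<Lambda> \<ge> 0" "weighted_l1 s l = ennreal \<Lambda>" shows "nls_coeffs l s a \<Lambda>"
proof
  show "\<exists>B. \<forall>t. \<bar>t\<bar> \<le> T \<longrightarrow> hs_sq s (a t) \<le> ennreal B" for T
  proof -
    obtain B where "\<And>t. \<bar>t\<bar> \<le> T \<Longrightarrow> hs_val s (a t) \<le> B" using bounded_on_compact by blast
    then have "hs_sq s (a t) \<le> ennreal B" if "\<bar>t\<bar> \<le> T" for t
      using HsD(3)[OF u_Hs[of t]] ennreal_leI that by (simp add: a_def)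
    then show ?thesis by blast
  qed
  show "l (- k) = cnj (l k)" for k unfolding l_def by (rule coef_real_minus)
qed (use s assms a_deriv N_continuous in \<open>auto simp: N_def\<close>)

end

section \<open>The constant and the final estimate\<close>

lemma continuous_growth_const:
  assumes "s \<ge> 1" "\<Lambda> \<ge> 0" shows "continuous_on {0..} (growth_const s \<Lambda>)"
proof -
  define b where "b = (\<lambda>P. 2 * (2 * corr_const s \<Lambda> P + rate_const s \<Lambda> P + 1))"
  have c: "continuous_on UNIV b"
    unfolding b_def corr_const_def rate_const_def by (intro continuous_intros)
  \<comment> \<open>Continuity of a real power is obtained from a base that stays away from
    0.\<close>
  have nz: "b P \<noteq> 0" if "P \<ge> 0" for P
  proof -
    have "corr_const s \<Lambda> P \<ge> 0" "rate_const s \<Lambda> P \<ge> 0"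
      using assms by (auto simp: corr_const_def rate_const_def)
    then have "b P > 0" unfolding b_def by simp
    then show ?thesis by simp
  qed
  have "continuous_on {0..} (\<lambda>A. 2 + b (sqrt (sob_const * A)) powr s)"
  proof (intro continuous_intros ballI)
    show "continuous_on {0..} (\<lambda>A. b (sqrt (sob_const * A)))"
      by (rule continuous_on_compose2[OF c]) (auto intro!: continuous_intros)
    show "b (sqrt (sob_const * A)) \<noteq> 0" if "A \<in> {0..}" for A
      using that sob_const_nonneg by (intro nz) auto
  qed
  then show ?thesis by (simp add: growth_const_def[abs_def] b_def)
qed

lemma growth_const_pos: "growth_const s \<Lambda> A > 0"
  by (simp add: growth_const_def add_pos_nonneg)

text \<open>Conservation turns energy and mass of the data into the H^1 bound \<open>A\<close> for
  all times: coercivity is applied at time t, the comparison with the energy at time 0. Absolute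
  values keep \<open>A\<close> non-negative, as the energy may be negative. The exponent s / 2
  arises because \<open>growth\<close> concerns the squared norm.\<close>

lemma (in nls_sol) sobolev_growth:
  assumes \<Lambda>: "\<Lambda> \<ge> 0" "weighted_l1 s l = ennreal \<Lambda>"
    and B: "B \<ge> 0" "\<And>x. x \<in> {0..2 * pi} \<Longrightarrow> \<bar>lam x\<bar> \<le> B"
  shows "Hs_norm s (u t) \<le> sqrt (growth_const s \<Lambda> (\<bar>energy lam \<Phi>\<bar> + (1 + B) * \<bar>mass \<Phi>\<bar>)) * (1 + \<bar>t\<bar>) powr (s / 2) * Hs_norm s \<Phi>"
proof -
  interpret C: nls_coeffs l s a \<Lambda> by (rule nls_coeffs[OF \<Lambda>])
  define A where "A = \<bar>energy lam \<Phi>\<bar> + (1 + B) * \<bar>mass \<Phi>\<bar>"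
  define ME where "ME = (\<lambda>t. Re (mod_energy l (jw 2) (\<lambda>_. 1) (\<lambda>_. 1) (a t)))"
  have m: "mass (u t) = mass \<Phi>" for t
    using mass_eq[OF u_Hs[of t] s] mass_eq[OF \<Phi> s] C.mass_const[of t] by (simp add: a_def[symmetric] a_0)
  have h1: "hs_val 1 (a t) \<le> A" for t
  proof -
    have "hs_val 1 (a t) \<le> ME t + B * mass (u t) / (2 * pi)"
      using h1_le_mod_energy[OF lam u_Hs s B(2)] by (simp add: ME_def a_def l_def)
    also have "ME t = ME 0" unfolding ME_def by (simp only: C.energy_const[of t])
    also have "ME 0 \<le> (mass \<Phi> + 2 * energy lam \<Phi>) / (2 * pi)"
      using mod_energy_le_energy[OF lam \<Phi> s] by (simp add: ME_def a_0 l_def)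
    also have "(mass \<Phi> + 2 * energy lam \<Phi>) / (2 * pi) + B * mass (u t) / (2 * pi) = (2 * energy lam \<Phi> + (1 + B) * mass \<Phi>) / (2 * pi)"
      unfolding m by (simp add: field_simps)
    \<comment> \<open>The denominator 2 pi is replaced by 2 and the mass term doubled, so that the
      factors 2 cancel.\<close>
    also have "\<dots> \<le> (2 * \<bar>energy lam \<Phi>\<bar> + 2 * ((1 + B) * \<bar>mass \<Phi>\<bar>)) / 2"
    proof (rule frac_le)
      have "(1 + B) * mass \<Phi> \<le> (1 + B) * \<bar>mass \<Phi>\<bar>" "0 \<le> (1 + B) * \<bar>mass \<Phi>\<bar>"
        using B(1) by (auto intro: mult_left_mono)
      then show "2 * energy lam \<Phi> + (1 + B) * mass \<Phi> \<le> 2 * \<bar>energy lam \<Phi>\<bar> + 2 * ((1 + B) * \<bar>mass \<Phi>\<bar>)"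
        by linarith
    qed (use B(1) pi_gt3 in auto)
    also have "\<dots> = A" by (simp add: A_def)
    finally show ?thesis by simp
  qed
  have A0: "A \<ge> 0" using B(1) by (simp add: A_def)
  have H1: "hs_sq 1 (a t) \<le> ennreal A" for t
    using hs_sq_eq_val(2)[OF C.hs_fin[OF s]] h1[of t] by (simp add: ennreal_leI)
  have "hs_val s (a t) \<le> growth_const s \<Lambda> A * (1 + \<bar>t\<bar>) powr s * hs_val s (a 0)"
    by (rule C.growth[OF A0 H1])
  then have "sqrt (hs_val s (a t)) \<le> sqrt (growth_const s \<Lambda> A * (1 + \<bar>t\<bar>) powr s * hs_val s (a 0))"
    by simp
  also have "\<dots> = sqrt (growth_const s \<Lambda> A) * (1 + \<bar>t\<bar>) powr (s / 2) * sqrt (hs_val s (a 0))"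
    by (simp add: real_sqrt_mult powr_half_sqrt[symmetric] powr_powr)
  finally have "2 * pi * sqrt (hs_val s (a t)) \<le> 2 * pi * (sqrt (growth_const s \<Lambda> A) * (1 + \<bar>t\<bar>) powr (s / 2) * sqrt (hs_val s (a 0)))"
    by (rule mult_left_mono) simp
  then show ?thesis
    unfolding HsD(4)[OF u_Hs] HsD(4)[OF \<Phi>] a_def[symmetric] a_0[symmetric] A_def[symmetric] by (simp add: ac_simps)
qed

theorem theorem1p3:
  fixes lam :: "real \<Rightarrow> real" and s :: real
  assumes "smooth_circle lam" and "s \<ge> 1"
  shows "\<exists>\<epsilon>0>0. \<forall>\<epsilon>. 0 < \<epsilon> \<and> \<epsilon> < \<epsilon>0 \<longrightarrow>
    (\<exists>C :: real \<Rightarrow> real \<Rightarrow> real.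
       continuous_on (UNIV \<times> {0..}) (\<lambda>(E, M). C E M) \<and>
       (\<forall>E M. 0 \<le> M \<longrightarrow> 0 < C E M) \<and>
       (\<forall>\<Phi> u. \<Phi> \<in> Hs s \<longrightarrow> nls_solution lam s \<Phi> u \<longrightarrow>
          (\<forall>t. Hs_norm s (u t)
                 \<le> C (energy lam \<Phi>) (mass \<Phi>) * (1 + \<bar>t\<bar>) powr (s + \<epsilon>) * Hs_norm s \<Phi>)))"
proof -
  obtain B where B: "B \<ge> 0" "\<And>x. x \<in> {0..2 * pi} \<Longrightarrow> \<bar>lam x\<bar> \<le> B"
    using smooth_circle_bounded[OF assms(1)] by blast
  obtain \<Lambda> where \<Lambda>: "\<Lambda> \<ge> 0" "weighted_l1 s (coef (\<lambda>x. complex_of_real (lam x))) = ennreal \<Lambda>"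
    using weighted_l1_smooth[OF assms(1), of s]
    by (cases "weighted_l1 s (coef (\<lambda>x. complex_of_real (lam x)))") auto
  \<comment> \<open>One function serves every \<epsilon>; its argument is the bound \<open>A\<close>
    of \<open>sobolev_growth\<close>.\<close>
  define C where "C = (\<lambda>E M. sqrt (growth_const s \<Lambda> (\<bar>E\<bar> + (1 + B) * \<bar>M\<bar>)))"
  have "continuous_on (UNIV \<times> {0..}) (\<lambda>p. sqrt (growth_const s \<Lambda> (\<bar>fst p\<bar> + (1 + B) * \<bar>snd p\<bar>)))"
    using B(1) by (intro continuous_intros continuous_on_compose2[OF continuous_growth_const[OF assms(2) \<Lambda>(1)]]) auto
  then have cont: "continuous_on (UNIV \<times> {0..}) (\<lambda>(E, M). C E M)"
    by (simp add: C_def split_def)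
  have pos: "0 < C E M" for E M by (simp add: C_def growth_const_pos)
  have bound: "Hs_norm s (u t) \<le> C (energy lam \<Phi>) (mass \<Phi>) * (1 + \<bar>t\<bar>) powr (s + \<epsilon>) * Hs_norm s \<Phi>"
    if "\<epsilon> > 0" "\<Phi> \<in> Hs s" "nls_solution lam s \<Phi> u" for \<epsilon> \<Phi> u t
  proof -
    interpret nls_sol lam s \<Phi> u by unfold_locales (use assms that in auto)
    have "Hs_norm s (u t) \<le> C (energy lam \<Phi>) (mass \<Phi>) * (1 + \<bar>t\<bar>) powr (s / 2) * Hs_norm s \<Phi>"
      unfolding C_def by (rule sobolev_growth[OF \<Lambda>(1) _ B]) (simp add: \<Lambda>(2) l_def)
    also have "\<dots> \<le> C (energy lam \<Phi>) (mass \<Phi>) * (1 + \<bar>t\<bar>) powr (s + \<epsilon>) * Hs_norm s \<Phi>"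
      using assms(2) that(1) pos[THEN less_imp_le] HsD(4)[OF \<Phi>] hs_val_nonneg
      by (intro mult_right_mono mult_left_mono powr_mono) auto
    finally show ?thesis .
  qed
  \<comment> \<open>As s / 2 \<le> s + \<epsilon> for every \<epsilon> > 0, the threshold 1 is
    arbitrary.\<close>
  show ?thesis
    by (intro exI[of _ 1] conjI allI impI exI[of _ C] cont) (use pos bound in auto)
qed

end
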